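(* Any morphism $f:X\to Y$ in $\mathcal{C}/\mathcal{T}$ has a kernel and a cokernel.
   Context: Fix a field $K$. All categories are $K$-linear Krull–Schmidt categories: every object is a finite formal direct sum of indecomposable objects with local endomorphism rings. The category $\mathcal{B}$ has indecomposable objects the pairs $(x,y)\in\mathbb{R}^2$, with $\mathrm{Hom}_{\mathcal{B}}((x,y),(x',y'))=K$ if $x\le x'$ and $y\le y'$, and $0$ otherwise; composition is multiplication of scalars; the morphism corresponding to $1\in K$ is the basic morphism. Let $\mathcal{B}_\pi$ be the full additive subcategory generated by all $(x,y)$ with $|y-x|\ge\pi$. The continuous derived category $\mathcal{D}$ is the full additive subcategory of $\mathcal{B}/\mathcal{B}_\pi$ (quotient by the ideal of morphisms factoring through objects of $\mathcal{B}_\pi$) generated by the $(x,y)$ with $|y-x|<\pi$. The doubled category $\mathcal{D}^{(2)}$ is obtained by adding a second copy $(x,y)'$ of every indecomposable $(x,y)$ together with an isomorphism $\eta:(x,y)'\cong(x,y)$; put $(x,y)''=(x,y)$. Let $F$ be the automorphism of $\mathcal{D}^{(2)}$ given on objects by $F(x,y)=(y+\pi,x+\pi)'$, taking basic morphisms to basic morphisms. The continuous cluster category $\mathcal{C}=\mathcal{C}_\pi$ is the orbit category $\mathcal{D}^{(2)}/F$, with $\mathrm{Hom}_{\mathcal{C}}(X,Y)=\bigoplus_{k\in\mathbb{Z}}\mathrm{Hom}_{\mathcal{D}^{(2)}}(X,F^kY)$. The orbit of $(x,y)$ is denoted $M(x,y)$ (and that of $(x,y)'$ is $M(x,y)'\cong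 M(x,y)$), so $M(x,y)=M(y+\pi,x+\pi)'$. The standard cluster $\mathcal{T}$ is the set of objects $M\left(\frac{m\pi}{2^n},\pi+\frac{(m-1)\pi}{2^n}\right)$ for integers $n\ge0$, $0\le m<2^{n+1}$ (omitting $(\pi,\pi)$, which repeats $(0,0)$). $\mathcal{C}/\mathcal{T}$ is the quotient of $\mathcal{C}$ by the ideal of morphisms which factor through an object of $\mathrm{add}\,\mathcal{T}$ (finite direct sums of objects of $\mathcal{T}$, up to isomorphism). *)

theory Defs
  imports Complex_Main "HOL-Algebra.AbelCoset" "HOL-Algebra.Module"
begin

section \<open>Linear categories\<close>

text \<open>
  A \<open>K\<close>-linear category is given by its objects, its hom spaces (as modules in the sense of
  HOL-Algebra), identities and composition; \<open>Comp C X Y Z g f\<close> is the composite of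
  \<open>f : X \<rightarrow> Y\<close> and \<open>g : Y \<rightarrow> Z\<close>.
\<close>

record ('o, 'm, 'k) lincat =
  Obj :: "'o set"
  Hom :: "'o \<Rightarrow> 'o \<Rightarrow> ('k, 'm) module"
  Idn :: "'o \<Rightarrow> 'm"
  Comp :: "'o \<Rightarrow> 'o \<Rightarrow> 'o \<Rightarrow> 'm \<Rightarrow> 'm \<Rightarrow> 'm"

text \<open>
  The record type of modules extends that of rings; its multiplicative part plays no role for
  modules and is left unspecified.
\<close>

definition hom_module ::
    "'m set \<Rightarrow> 'm \<Rightarrow> ('m \<Rightarrow> 'm \<Rightarrow> 'm) \<Rightarrow> ('k \<Rightarrow> 'm \<Rightarrow> 'm) \<Rightarrow> ('k, 'm) module" where
  "hom_module V z a s =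
     \<lparr>carrier = V, mult = undefined, one = undefined, zero = z, add = a, smult = s\<rparr>"

definition full_subcat :: "('o, 'm, 'k) lincat \<Rightarrow> 'o set \<Rightarrow> ('o, 'm, 'k) lincat" where
  "full_subcat C S = C\<lparr>Obj := Obj C \<inter> S\<rparr>"

definition is_kernel ::
    "('o, 'm, 'k) lincat \<Rightarrow> 'o \<Rightarrow> 'o \<Rightarrow> 'm \<Rightarrow> 'o \<Rightarrow> 'm \<Rightarrow> bool" where
  "is_kernel C X Y f Z k \<longleftrightarrow>
     Z \<in> Obj C \<and> k \<in> carrier (Hom C Z X) \<and> Comp C Z X Y f k = \<zero>\<^bsub>Hom C Z Y\<^esub> \<and>
     (\<forall>W\<in>Obj C. \<forall>g\<in>carrier (Hom C W X). Comp C W X Y f g = \<zero>\<^bsub>Hom C W Y\<^esub> \<longrightarrow>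
        (\<exists>!u. u \<in> carrier (Hom C W Z) \<and> Comp C W Z X k u = g))"

definition is_cokernel ::
    "('o, 'm, 'k) lincat \<Rightarrow> 'o \<Rightarrow> 'o \<Rightarrow> 'm \<Rightarrow> 'o \<Rightarrow> 'm \<Rightarrow> bool" where
  "is_cokernel C X Y f Z c \<longleftrightarrow>
     Z \<in> Obj C \<and> c \<in> carrier (Hom C Y Z) \<and> Comp C X Y Z c f = \<zero>\<^bsub>Hom C X Z\<^esub> \<and>
     (\<forall>W\<in>Obj C. \<forall>g\<in>carrier (Hom C Y W). Comp C X Y W g f = \<zero>\<^bsub>Hom C X W\<^esub> \<longrightarrow>
        (\<exists>!u. u \<in> carrier (Hom C Z W) \<and> Comp C Y Z W u c = g))"

definition is_direct_sum :: "('o, 'm, 'k) lincat \<Rightarrow> 'o list \<Rightarrow> 'o \<Rightarrow> bool" where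
  "is_direct_sum C Xs Z \<longleftrightarrow> Z \<in> Obj C \<and> set Xs \<subseteq> Obj C \<and>
     (\<exists>\<iota> \<rho>. (\<forall>i<length Xs. \<iota> i \<in> carrier (Hom C (Xs ! i) Z) \<and> \<rho> i \<in> carrier (Hom C Z (Xs ! i))) \<and>
        (\<forall>i<length Xs. \<forall>j<length Xs. Comp C (Xs ! i) Z (Xs ! j) (\<rho> j) (\<iota> i) =
            (if i = j then Idn C (Xs ! i) else \<zero>\<^bsub>Hom C (Xs ! i) (Xs ! j)\<^esub>)) \<and>
        finsum (Hom C Z Z) (\<lambda>i. Comp C Z (Xs ! i) Z (\<iota> i) (\<rho> i)) {..<length Xs} = Idn C Z)"

text \<open>
  A direct sum is only determined up to isomorphism, so the following set is closed under
  isomorphism; the empty list contributes the zero objects.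
\<close>

definition add_closure :: "('o, 'm, 'k) lincat \<Rightarrow> 'o set \<Rightarrow> 'o set" where
  "add_closure C S = {Z. \<exists>Xs. set Xs \<subseteq> S \<and> is_direct_sum C Xs Z}"

subsection \<open>Quotients by the morphisms factoring through given objects\<close>

definition factor_ideal :: "('o, 'm, 'k) lincat \<Rightarrow> 'o set \<Rightarrow> 'o \<Rightarrow> 'o \<Rightarrow> 'm set" where
  "factor_ideal C S X Y =
     {Comp C X Z Y g f |Z f g. Z \<in> S \<and> f \<in> carrier (Hom C X Z) \<and> g \<in> carrier (Hom C Z Y)}"

definition quot_module :: "('k, 'm) module \<Rightarrow> 'm set \<Rightarrow> ('k, 'm set) module" where
  "quot_module M N =
     hom_module (a_rcosets\<^bsub>M\<^esub> N) N (set_add M) (\<lambda>a A. \<Union>x\<in>A. N +>\<^bsub>M\<^esub> (a \<odot>\<^bsub>M\<^esub> x))"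

definition quot_cat :: "('o, 'm, 'k) lincat \<Rightarrow> 'o set \<Rightarrow> ('o, 'm set, 'k) lincat" where
  "quot_cat C S =
     \<lparr>Obj = Obj C,
      Hom = (\<lambda>X Y. quot_module (Hom C X Y) (factor_ideal C S X Y)),
      Idn = (\<lambda>X. factor_ideal C S X X +>\<^bsub>Hom C X X\<^esub> Idn C X),
      Comp = (\<lambda>X Y Z B A. \<Union>g\<in>B. \<Union>f\<in>A. factor_ideal C S X Z +>\<^bsub>Hom C X Z\<^esub> Comp C X Y Z g f)\<rparr>"

subsection \<open>Orbit categories\<close>

definition int_iterate :: "('a \<Rightarrow> 'a) \<Rightarrow> int \<Rightarrow> 'a \<Rightarrow> 'a" where
  "int_iterate f k = (if 0 \<le> k then f ^^ nat k else inv_into UNIV f ^^ nat (- k))"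

definition orbit_of :: "('a \<Rightarrow> 'a) \<Rightarrow> 'a \<Rightarrow> 'a set" where
  "orbit_of f x = range (\<lambda>k. int_iterate f k x)"

definition orbit_rep :: "'a set \<Rightarrow> 'a" where
  "orbit_rep A = (SOME x. x \<in> A)"

text \<open>
  The orbit category of \<open>C\<close> under an automorphism which acts by the bijection \<open>F\<close> on objects
  and by the bijection \<open>\<Phi>\<close> on morphisms. Objects are orbits. A morphism from the orbit of
  \<open>X\<close> to the orbit of \<open>Y\<close> is an element \<open>f\<close> of the direct sum of the
  \<open>Hom(X, F\<^sup>k Y)\<close>, \<open>k \<in> \<int>\<close>, that is a family with finitely many nonzero components
  \<open>f k : X \<rightarrow> F\<^sup>k Y\<close>; here \<open>X\<close> and \<open>Y\<close> are chosen representatives (other representatives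
  give an isomorphic category). The \<open>k\<close>-th component of a composite \<open>g f\<close> is the sum over
  all \<open>i\<close> of \<open>F\<^sup>i(g (k - i)) \<circ> f i\<close>.
\<close>

definition orbit_hom ::
    "('o, 'm, 'k) lincat \<Rightarrow> ('o \<Rightarrow> 'o) \<Rightarrow> 'o \<Rightarrow> 'o \<Rightarrow> ('k, int \<Rightarrow> 'm) module" where
  "orbit_hom C F X Y =
     (let H = (\<lambda>k. Hom C X (int_iterate F k Y)) in
      hom_module {f. (\<forall>k. f k \<in> carrier (H k)) \<and> finite {k. f k \<noteq> \<zero>\<^bsub>H k\<^esub>}}
        (\<lambda>k. \<zero>\<^bsub>H k\<^esub>)
        (\<lambda>f g k. f k \<oplus>\<^bsub>H k\<^esub> g k)
        (\<lambda>a f k. a \<odot>\<^bsub>H k\<^esub> f k))"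

definition orbit_id :: "('o, 'm, 'k) lincat \<Rightarrow> ('o \<Rightarrow> 'o) \<Rightarrow> 'o \<Rightarrow> int \<Rightarrow> 'm" where
  "orbit_id C F X k = (if k = 0 then Idn C X else \<zero>\<^bsub>Hom C X (int_iterate F k X)\<^esub>)"

definition orbit_comp ::
    "('o, 'm, 'k) lincat \<Rightarrow> ('o \<Rightarrow> 'o) \<Rightarrow> ('m \<Rightarrow> 'm) \<Rightarrow> 'o \<Rightarrow> 'o \<Rightarrow> 'o \<Rightarrow>
      (int \<Rightarrow> 'm) \<Rightarrow> (int \<Rightarrow> 'm) \<Rightarrow> int \<Rightarrow> 'm" where
  "orbit_comp C F \<Phi> X Y Z g f k =
     finsum (Hom C X (int_iterate F k Z))
       (\<lambda>i. Comp C X (int_iterate F i Y) (int_iterate F k Z) (int_iterate \<Phi> i (g (k - i))) (f i))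
       {i. f i \<noteq> \<zero>\<^bsub>Hom C X (int_iterate F i Y)\<^esub>}"

definition orbit_cat ::
    "('o, 'm, 'k) lincat \<Rightarrow> ('o \<Rightarrow> 'o) \<Rightarrow> ('m \<Rightarrow> 'm) \<Rightarrow> ('o set, int \<Rightarrow> 'm, 'k) lincat" where
  "orbit_cat C F \<Phi> =
     \<lparr>Obj = orbit_of F ` Obj C,
      Hom = (\<lambda>A B. orbit_hom C F (orbit_rep A) (orbit_rep B)),
      Idn = (\<lambda>A. orbit_id C F (orbit_rep A)),
      Comp = (\<lambda>A B D. orbit_comp C F \<Phi> (orbit_rep A) (orbit_rep B) (orbit_rep D))\<rparr>"

section \<open>The continuous derived category\<close>

type_synonym point = "real \<times> real"

type_synonym 'k matrix = "nat \<Rightarrow> nat \<Rightarrow> 'k"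

definition below :: "point \<Rightarrow> point \<Rightarrow> bool" where
  "below p q \<longleftrightarrow> fst p \<le> fst q \<and> snd p \<le> snd q"

text \<open>
  An object of \<open>\<B>\<close> is the formal direct sum of the points in a list. A morphism
  \<open>Xs \<rightarrow> Ys\<close> is a matrix \<open>M\<close>, where \<open>M i j\<close> is the component
  \<open>Xs ! j \<rightarrow> Ys ! i\<close>, as a multiple of the basic morphism; entries outside the
  \<open>length Ys \<times> length Xs\<close> block are zero.
\<close>

definition B_cat :: "(point list, 'k::field matrix, 'k) lincat" where
  "B_cat =
     \<lparr>Obj = UNIV,
      Hom = (\<lambda>Xs Ys. hom_module
        {M. \<forall>i j. M i j \<noteq> 0 \<longrightarrow> i < length Ys \<and> j < length Xs \<and> below (Xs ! j) (Ys ! i)}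
        (\<lambda>i j. 0)
        (\<lambda>M N i j. M i j + N i j)
        (\<lambda>a M i j. a * M i j)),
      Idn = (\<lambda>Xs i j. if i = j \<and> i < length Xs then 1 else 0),
      Comp = (\<lambda>Xs Ys Zs N M i j. \<Sum>k<length Ys. N i k * M k j)\<rparr>"

definition D_cat :: "(point list, 'k::field matrix set, 'k) lincat" where
  "D_cat = full_subcat (quot_cat B_cat (lists {(x, y). \<bar>y - x\<bar> \<ge> pi}))
             (lists {(x, y). \<bar>y - x\<bar> < pi})"

section \<open>The continuous cluster category\<close>

text \<open>
  In the doubled category \<open>((x, y), False)\<close> stands for \<open>(x, y)\<close> and \<open>((x, y), True)\<close> for its
  copy \<open>(x, y)'\<close>. Since \<open>\<eta>\<close> is an isomorphism, it identifies the hom spaces from and to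
  \<open>(x, y)'\<close> with those from and to \<open>(x, y)\<close>; \<open>\<eta>\<close> itself is then the identity of
  \<open>(x, y)\<close>, regarded as a morphism \<open>(x, y)' \<rightarrow> (x, y)\<close>.
\<close>

definition doubled :: "('a list, 'm, 'k) lincat \<Rightarrow> (('a \<times> bool) list, 'm, 'k) lincat" where
  "doubled C =
     \<lparr>Obj = {X. map fst X \<in> Obj C},
      Hom = (\<lambda>X Y. Hom C (map fst X) (map fst Y)),
      Idn = (\<lambda>X. Idn C (map fst X)),
      Comp = (\<lambda>X Y Z. Comp C (map fst X) (map fst Y) (map fst Z))\<rparr>"

definition D2_cat :: "((point \<times> bool) list, 'k::field matrix set, 'k) lincat" where
  "D2_cat = doubled D_cat"

fun F_ind :: "point \<times> bool \<Rightarrow> point \<times> bool" where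
  "F_ind ((x, y), b) = ((y + pi, x + pi), \<not> b)"

text \<open>
  As \<open>F\<close> takes basic morphisms to basic morphisms, it maps the class of a matrix to the class of
  the same matrix. These two classes are the same set (lemma \<open>D2_Hom_F\<close> below),
  hence \<open>F\<close> acts on morphisms as the identity function.
\<close>

type_synonym 'k cluster_category =
  "((point \<times> bool) list set, int \<Rightarrow> 'k matrix set, 'k) lincat"

definition C_cat :: "'k::field cluster_category" where
  "C_cat = orbit_cat D2_cat (map F_ind) (\<lambda>A. A)"

definition M_obj :: "point \<Rightarrow> (point \<times> bool) list set" where
  "M_obj p = orbit_of (map F_ind) [(p, False)]"

definition M'_obj :: "point \<Rightarrow> (point \<times> bool) list set" where
  "M'_obj p = orbit_of (map F_ind) [(p, True)]"

definition standard_cluster :: "(point \<times> bool) list set set" where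
  "standard_cluster =
     {M_obj (x, y) |x y (n::nat) (m::nat).
        m < 2 ^ (n + 1) \<and> x = m * pi / 2 ^ n \<and> y = pi + (real m - 1) * pi / 2 ^ n \<and>
        (x, y) \<noteq> (pi, pi)}"

type_synonym 'k cluster_quotient =
  "((point \<times> bool) list set, (int \<Rightarrow> 'k matrix set) set, 'k) lincat"

definition C_mod_T :: "'k::field cluster_quotient" where
  "C_mod_T = quot_cat C_cat (add_closure (C_cat :: 'k cluster_category) standard_cluster)"

section \<open>The action of \<open>F\<close>\<close>

definition swap_pt :: "point \<Rightarrow> point" where
  "swap_pt p = (snd p + pi, fst p + pi)"

lemma map_fst_F: "map fst (map F_ind X) = map swap_pt (map fst X)"
  by (induction X) (auto simp: swap_pt_def)

lemma B_Hom_swap: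
  "Hom (B_cat :: (point list, 'k::field matrix, 'k) lincat) (map swap_pt Xs) (map swap_pt Ys) =
   Hom B_cat Xs Ys"
proof -
  have "{M. \<forall>i j. M i j \<noteq> (0::'k) \<longrightarrow>
          i < length Ys \<and> j < length Xs \<and> below (map swap_pt Xs ! j) (map swap_pt Ys ! i)} =
        {M. \<forall>i j. M i j \<noteq> 0 \<longrightarrow> i < length Ys \<and> j < length Xs \<and> below (Xs ! j) (Ys ! i)}"
    by (intro Collect_cong arg_cong[where f = All] ext) (auto simp: below_def swap_pt_def)
  then show ?thesis
    by (simp add: B_cat_def)
qed

lemma B_Comp_swap:
  "Comp B_cat (map swap_pt Xs) (map swap_pt Ys) (map swap_pt Zs) = Comp B_cat Xs Ys Zs"
  by (simp add: B_cat_def)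

lemma factor_ideal_swap:
  "factor_ideal B_cat (lists {(x, y). \<bar>y - x\<bar> \<ge> pi}) (map swap_pt Xs) (map swap_pt Ys) =
   factor_ideal B_cat (lists {(x, y). \<bar>y - x\<bar> \<ge> pi}) Xs Ys" (is "?L = ?R")
proof -
  let ?S = "lists {(x::real, y). \<bar>y - x\<bar> \<ge> pi}"
  have S: "map swap_pt Z \<in> ?S \<longleftrightarrow> Z \<in> ?S" for Z
    by (induction Z) (auto simp: swap_pt_def split_beta)
  have surj: "\<exists>W. Z = map swap_pt W" for Z
  proof
    show "Z = map swap_pt (map (\<lambda>p. (snd p - pi, fst p - pi)) Z)"
      by (induction Z) (auto simp: swap_pt_def)
  qed
  show ?thesis
  proof
    show "?L \<subseteq> ?R"
    proof
      fix m assume "m \<in> ?L"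
      then obtain Z f g where m: "m = Comp B_cat (map swap_pt Xs) Z (map swap_pt Ys) g f"
        "Z \<in> ?S" "f \<in> carrier (Hom B_cat (map swap_pt Xs) Z)"
        "g \<in> carrier (Hom B_cat Z (map swap_pt Ys))"
        unfolding factor_ideal_def by blast
      obtain W where W: "Z = map swap_pt W" using surj by blast
      show "m \<in> ?R"
        using m unfolding factor_ideal_def W B_Hom_swap B_Comp_swap S by blast
    qed
    show "?R \<subseteq> ?L"
    proof
      fix m assume "m \<in> ?R"
      then obtain Z f g where m: "m = Comp B_cat Xs Z Ys g f"
        "Z \<in> ?S" "f \<in> carrier (Hom B_cat Xs Z)" "g \<in> carrier (Hom B_cat Z Ys)"
        unfolding factor_ideal_def by blast
      have "m = Comp B_cat (map swap_pt Xs) (map swap_pt Z) (map swap_pt Ys) g f"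
        "map swap_pt Z \<in> ?S" "f \<in> carrier (Hom B_cat (map swap_pt Xs) (map swap_pt Z))"
        "g \<in> carrier (Hom B_cat (map swap_pt Z) (map swap_pt Ys))"
        using m unfolding B_Hom_swap B_Comp_swap S by blast+
      then show "m \<in> ?L"
        unfolding factor_ideal_def by blast
    qed
  qed
qed

lemma D2_Hom_F: "Hom D2_cat (map F_ind X) (map F_ind Y) = Hom D2_cat X Y"
  unfolding D2_cat_def doubled_def D_cat_def full_subcat_def quot_cat_def
  by (simp only: lincat.simps map_fst_F B_Hom_swap factor_ideal_swap)

lemma D2_Comp_F:
  "Comp D2_cat (map F_ind X) (map F_ind Y) (map F_ind Z) = Comp D2_cat X Y Z"
  unfolding D2_cat_def doubled_def D_cat_def full_subcat_def quot_cat_def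
  by (simp only: lincat.simps map_fst_F B_Hom_swap B_Comp_swap factor_ideal_swap)

lemma D2_Idn_F:
  "Idn (D2_cat :: (_, 'a::field matrix set, 'a) lincat) (map F_ind X) = Idn D2_cat X"
proof -
  have Idn: "Idn (B_cat :: (point list, 'a matrix, 'a) lincat) (map swap_pt Xs) = Idn B_cat Xs" for Xs
    by (simp add: B_cat_def)
  show ?thesis
    unfolding D2_cat_def doubled_def D_cat_def full_subcat_def quot_cat_def
    by (simp only: lincat.simps map_fst_F Idn B_Hom_swap factor_ideal_swap)
qed

lemma D2_Obj_F: "map F_ind X \<in> Obj D2_cat \<longleftrightarrow> X \<in> Obj D2_cat"
proof -
  have "map swap_pt Z \<in> lists {(x, y). \<bar>y - x\<bar> < pi} \<longleftrightarrow> Z \<in> lists {(x, y). \<bar>y - x\<bar> < pi}" for Z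
    by (induction Z) (auto simp: swap_pt_def split_beta)
  then show ?thesis
    unfolding D2_cat_def doubled_def D_cat_def full_subcat_def quot_cat_def B_cat_def
    by (simp only: lincat.simps map_fst_F mem_Collect_eq Int_iff UNIV_I)
qed

lemma bij_F_ind: "bij F_ind"
proof (rule o_bij)
  show "(\<lambda>((x, y), b). ((y - pi, x - pi), \<not> b)) \<circ> F_ind = id"
    "F_ind \<circ> (\<lambda>((x, y), b). ((y - pi, x - pi), \<not> b)) = id"
    by (auto simp: fun_eq_iff)
qed

lemma bij_map_F: "bij (map F_ind)"
  using bij_F_ind lists_image[of F_ind UNIV] by (simp add: bij_def inj_mapI)

lemma orbit_of_step:
  assumes "bij f"
  shows "orbit_of f (f x) = orbit_of f x"
proof -
  have step: "int_iterate f k (f x) = int_iterate f (k + 1) x" for k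
  proof (cases "k \<ge> 0")
    case True
    then have "nat (k + 1) = Suc (nat k)" by simp
    then show ?thesis using True by (simp add: int_iterate_def funpow_swap1)
  next
    case False
    then have "nat (- k) = Suc (nat (- (k + 1)))" by simp
    then have "int_iterate f k (f x) = (inv_into UNIV f ^^ nat (- (k + 1))) (inv_into UNIV f (f x))"
      using False by (simp add: int_iterate_def funpow_swap1)
    also have "inv_into UNIV f (f x) = x"
      using assms by (simp add: bij_is_inj)
    finally show ?thesis
      using False by (cases "k = - 1") (auto simp: int_iterate_def)
  qed
  have "range (\<lambda>k. int_iterate f (k + 1) x) = range (\<lambda>k. int_iterate f k x)"
  proof (rule Set.set_eqI)
    fix z
    show "z \<in> range (\<lambda>k. int_iterate f (k + 1) x) \<longleftrightarrow> z \<in> range (\<lambda>k. int_iterate f k x)"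
      by (auto simp: image_iff) (metis diff_add_cancel)
  qed
  then show ?thesis
    by (simp add: orbit_of_def step)
qed

lemma M_obj_eq: "M_obj (x, y) = M'_obj (y + pi, x + pi)"
proof -
  have "M'_obj (y + pi, x + pi) = orbit_of (map F_ind) (map F_ind [((x, y), False)])"
    by (simp add: M'_obj_def)
  also have "\<dots> = M_obj (x, y)"
    unfolding M_obj_def by (rule orbit_of_step) (rule bij_map_F)
  finally show ?thesis by simp
qed

end

theory Submission
  imports Defs "HOL-Library.Function_Algebras"
begin

text \<open>
  A morphism between sums of indecomposable objects of \<open>\<C>\<close> is a matrix of scalars, since the Hom space
  between two indecomposables is at most one-dimensional. Dividing by the ideal of \<open>\<T>\<close> removes the entry at
  \<open>p \<rightarrow> q\<close> if the rectangle of the plane with corners \<open>p\<close> and \<open>q\<close> contains a lift of an object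
  of \<open>\<T>\<close> (lemma \<open>C_ideal\<close>). So \<open>\<C> / \<T>\<close> is a category of matrices with entries at the pairs of
  points that are \<open>linked\<close> by a rectangle free of \<open>\<T>\<close>, and the theorem is a statement about such matrices
  (theorems \<open>matrix_kernel\<close> and \<open>matrix_cokernel\<close>). The reflection \<open>(x, y) \<mapsto> (- x, - y)\<close> reverses the
  order of the plane and preserves \<open>\<T>\<close>, so cokernels are kernels of transposed matrices.

  The kernel of a matrix is found row by row, as the kernel of a row restricted to the kernel of the
  previous rows. In a row \<open>X\<^sub>1 \<oplus> \<dots> \<oplus> X\<^sub>n \<rightarrow> Y\<close>, an entry that vanishes or factors through another entry splits
  off its summand (lemma \<open>row_kernel_insert\<close>). There remains an antichain: a staircase
  of points \<open>(x\<^sub>i, y\<^sub>i)\<close> with increasing \<open>x\<^sub>i\<close> and decreasing \<open>y\<^sub>i\<close>. Where the corner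
  \<open>(x\<^sub>i, y\<^sub>i\<^sub>+\<^sub>1)\<close> does not survive to \<open>Y\<close>, the row is decoupled (lemma \<open>row_kernel_union\<close>). Otherwise the kernel is the sum of
  these corners, each mapped to the difference of its two neighbours, and of two end
  objects for the morphisms to \<open>X\<^sub>1\<close> and \<open>X\<^sub>n\<close> that die in \<open>Y\<close> because of an object of \<open>\<T>\<close> outside
  the staircase (lemmas \<open>upper_end\<close>, \<open>lower_end\<close> and \<open>row_kernel_linked_chain\<close>).

  To verify this one tests with an indecomposable \<open>W\<close>. If \<open>W \<rightarrow> Y\<close> survives, then \<open>W\<close> reaches an interval of
  the \<open>X\<^sub>i\<close> and the corners between them, and the kernel vectors are the telescoping ones. If it does
  not survive, the lifts of \<open>\<T>\<close> in the rectangle of \<open>W\<close> and \<open>Y\<close> are all on the same side of a reached point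
  \<open>X\<^sub>i\<close>, either to its upper left or to its lower right (lemma \<open>not_both_holes\<close>). This is
  the property of the triangulation that makes the theorem true: two nested arcs are joined by a chain of arcs
  in which each step moves one end only (lemma \<open>nested_arcs_cross_corner\<close>), and such a chain from one side to the
  other would meet a rectangle that is free of \<open>\<T>\<close>. The side matches each reached \<open>X\<^sub>i\<close> with a
  reached corner, and with this matching the coefficients can be solved for in a unique way
  (lemma \<open>alternating_path_solution\<close>).
\<close>

section \<open>The dyadic triangulation\<close>

definition dyadic :: "nat \<Rightarrow> real \<Rightarrow> bool" where
  "dyadic n x \<longleftrightarrow> (\<exists>m::int. x = m * (pi / 2 ^ n))"

text \<open>
  An object \<open>M(x, y)\<close> is drawn as the arc on the circle \<open>\<real> / 2\<pi>\<close> with ends \<open>x\<close> and \<open>y + \<pi>\<close>. The arcs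
  of the standard cluster join neighbouring dyadic multiples of \<open>\<pi>\<close>; a pair \<open>a < b < a + 2\<pi>\<close> of
  lifted ends therefore bounds either a dyadic interval or the complement of one.
\<close>

definition arc :: "real \<Rightarrow> real \<Rightarrow> bool" where
  "arc a b \<longleftrightarrow> (\<exists>n. dyadic n a \<and> (b = a + pi / 2 ^ n \<or> b = a + 2 * pi - pi / 2 ^ n))"

definition lifts_T :: "point set" where
  "lifts_T = {p. arc (fst p) (snd p + pi)}"

lemma two_pi_dyadic: "2 * pi = real_of_int (2 ^ (n + 1)) * (pi / 2 ^ n)"
  by simp

lemma dyadic_add: "dyadic n a \<Longrightarrow> dyadic n b \<Longrightarrow> dyadic n (a + b)"
  unfolding dyadic_def by (metis distrib_right of_int_add)

lemma dyadic_minus: "dyadic n a \<Longrightarrow> dyadic n (- a)"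
  unfolding dyadic_def by (metis mult_minus_left of_int_minus)

lemma dyadic_unit: "dyadic n (pi / 2 ^ n)"
  unfolding dyadic_def by (rule exI[of _ 1]) simp

lemma dyadic_2pi: "dyadic n (2 * pi)"
  unfolding dyadic_def using two_pi_dyadic by blast

lemma dyadic_diff: "dyadic n a \<Longrightarrow> dyadic n b \<Longrightarrow> dyadic n (a - b)"
  using dyadic_add[OF _ dyadic_minus, of n a b] by simp

lemma dyadic_mono:
  assumes "dyadic n a" "n \<le> k"
  shows "dyadic k a"
proof -
  obtain m :: int where m: "a = m * (pi / 2 ^ n)" using assms(1) dyadic_def by blast
  have "(2::real) ^ k = 2 ^ n * 2 ^ (k - n)"
    using assms(2) by (simp flip: power_add)
  then have "a = of_int (m * 2 ^ (k - n)) * (pi / 2 ^ k)"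
    using m by simp
  then show ?thesis unfolding dyadic_def by blast
qed

lemma dyadic_gap:
  assumes "dyadic n l" "dyadic n x" "l < x" "x < l + pi / 2 ^ n"
  shows False
proof -
  obtain m m' :: int where m: "l = m * (pi / 2 ^ n)" "x = m' * (pi / 2 ^ n)"
    using assms(1,2) dyadic_def by blast
  have d: "0 < pi / 2 ^ n" by simp
  have "m < m'" using assms(3) m d by (simp add: divide_simps)
  moreover have "real_of_int m' * (pi / 2 ^ n) < (real_of_int m + 1) * (pi / 2 ^ n)"
    using assms(4) unfolding m distrib_right by simp
  then have "m' < m + 1" using d by (simp add: divide_simps)
  ultimately show False by simp
qed

lemma arc_ends:
  assumes "arc a b"
  shows "a < b" "b < a + 2 * pi"
proof -
  obtain n where n: "b = a + pi / 2 ^ n \<or> b = a + 2 * pi - pi / 2 ^ n"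
    using assms arc_def by blast
  have "0 < pi / 2 ^ n" "pi / 2 ^ n \<le> pi / 1"
    by (simp, intro divide_left_mono) auto
  moreover have "pi / 1 < 2 * pi" by simp
  ultimately show "a < b" "b < a + 2 * pi" using n by linarith+
qed

lemma arc_shift: "arc a b \<Longrightarrow> arc b (a + 2 * pi)"
  unfolding arc_def
proof (elim exE conjE)
  fix n assume *: "dyadic n a" "b = a + pi / 2 ^ n \<or> b = a + 2 * pi - pi / 2 ^ n"
  then have "dyadic n b" using dyadic_add dyadic_diff dyadic_unit dyadic_2pi by metis
  then show "\<exists>n. dyadic n b \<and> (a + 2 * pi = b + pi / 2 ^ n \<or> a + 2 * pi = b + 2 * pi - pi / 2 ^ n)"
    using *(2) by (intro exI[of _ n]) auto
qed

lemma arc_neg: "arc a b \<Longrightarrow> arc (- a) (- b + 2 * pi)"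
  unfolding arc_def using dyadic_minus by fastforce

lemma arc_gap:
  assumes "arc a b"
  obtains n where "dyadic n a" "dyadic n b"
    "b = a + pi / 2 ^ n \<or> a + 2 * pi = b + pi / 2 ^ n"
proof -
  obtain n where *: "dyadic n a" "b = a + pi / 2 ^ n \<or> b = a + 2 * pi - pi / 2 ^ n"
    using assms arc_def by blast
  then have "dyadic n b" using dyadic_add dyadic_diff dyadic_unit dyadic_2pi by metis
  then show thesis using * that[of n] by auto
qed

text \<open>
  Either arc bounds a dyadic interval, and an end of the coarser arc is also a dyadic multiple at the
  finer level, so it cannot lie strictly inside the interval of the finer arc.
\<close>

lemma arcs_noncrossing:
  assumes "arc p q" "arc r s" "p < r" "r < q" "q < s" "s < p + 2 * pi"
  shows False
proof -
  obtain n where n: "dyadic n p" "dyadic n q" "q = p + pi / 2 ^ n \<or> p + 2 * pi = q + pi / 2 ^ n"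
    using arc_gap[OF assms(1)] .
  obtain k where k: "dyadic k r" "dyadic k s" "s = r + pi / 2 ^ k \<or> r + 2 * pi = s + pi / 2 ^ k"
    using arc_gap[OF assms(2)] .
  show False
  proof (cases "k \<le> n")
    case True
    then have "dyadic n r" "dyadic n s" using k dyadic_mono by blast+
    then show False
      using n(3) dyadic_gap[of n p r] dyadic_gap[of n q s] n assms by linarith
  next
    case False
    then have "dyadic k q" "dyadic k (p + 2 * pi)"
      using n dyadic_mono[of n _ k] dyadic_add dyadic_2pi by simp_all
    then show False
      using k(3) dyadic_gap[of k r q] dyadic_gap[of k s "p + 2 * pi"] k assms by linarith
  qed
qed

lemma dyadic_half:
  assumes "dyadic (Suc n) a"
  shows "dyadic n a \<or> dyadic n (a + pi / 2 ^ Suc n)"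
proof -
  obtain m :: int where m: "a = m * (pi / 2 ^ Suc n)" using assms dyadic_def by blast
  show ?thesis
  proof (cases "even m")
    case True
    then obtain c where "m = 2 * c" by blast
    then have "a = c * (pi / 2 ^ n)" using m by simp
    then show ?thesis unfolding dyadic_def by blast
  next
    case False
    then have "even (m + 1)" by simp
    then obtain c where c: "m + 1 = 2 * c" by blast
    have "a + pi / 2 ^ Suc n = of_int (m + 1) * (pi / 2 ^ Suc n)"
      unfolding m of_int_add distrib_right by simp
    also have "\<dots> = c * (pi / 2 ^ n)" unfolding c by simp
    finally show ?thesis unfolding dyadic_def by blast
  qed
qed

text \<open>
  Each arc is a side of two triangles of the dyadic triangulation. A dyadic interval is bisected; a
  complement is split at the far end of the parent interval.
\<close>

lemma arc_triangle:
  assumes "arc a b"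
  obtains s where "a < s" "s < b" "arc a s" "arc s b"
proof -
  obtain n where n: "dyadic n a" "b = a + pi / 2 ^ n \<or> b = a + 2 * pi - pi / 2 ^ n"
    using assms arc_def by blast
  have bisect: thesis if "b = a + pi / 2 ^ n" "dyadic n a" for n
  proof (rule \<open>\<And>s. a < s \<Longrightarrow> s < b \<Longrightarrow> arc a s \<Longrightarrow> arc s b \<Longrightarrow> thesis\<close>)
    have a: "dyadic (Suc n) a"
      using \<open>dyadic n a\<close> dyadic_mono[of n a "Suc n"] by simp
    then have "dyadic (Suc n) (a + pi / 2 ^ Suc n)"
      by (rule dyadic_add[OF _ dyadic_unit])
    note a = a this
    show "arc a (a + pi / 2 ^ Suc n)" "arc (a + pi / 2 ^ Suc n) b"
      unfolding arc_def using a \<open>b = _\<close> by (auto intro!: exI[of _ "Suc n"])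
    have "pi / 2 ^ n = 2 * (pi / 2 ^ Suc n)" "0 < pi / 2 ^ Suc n" by simp_all
    then show "a < a + pi / 2 ^ Suc n" "a + pi / 2 ^ Suc n < b"
      using \<open>b = _\<close> by linarith+
  qed
  consider (small) "b = a + pi / 2 ^ n" | (half) "n = 0" "b = a + pi"
    | (big) k where "n = Suc k" "b = a + 2 * pi - pi / 2 ^ Suc k"
    using n(2) by (cases n) auto
  then show thesis
  proof cases
    case small
    then show thesis using bisect n by blast
  next
    case half
    then show thesis using bisect[of 0] n(1) by simp
  next
    case big
    let ?d = "pi / 2 ^ Suc k"
    have d: "pi / 2 ^ k = 2 * ?d" "0 < ?d" "?d \<le> pi / 2"
      by (simp_all add: field_simps)
    have ar: "arc a (a + ?d)" "arc (b - ?d) b"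
    proof -
      show "arc a (a + ?d)" using n big unfolding arc_def by blast
      have "dyadic (Suc k) (b - ?d)"
        unfolding big using n(1) unfolding big(1)
        by (intro dyadic_diff dyadic_add dyadic_unit dyadic_2pi)
      then show "arc (b - ?d) b" unfolding arc_def by (intro exI[of _ "Suc k"]) simp
    qed
    from dyadic_half n big have "dyadic k a \<or> dyadic k (a + ?d)" by blast
    then show thesis
    proof
      assume *: "dyadic k (a + ?d)"
      show thesis
      proof (rule that[of "a + ?d"])
        have "b = a + ?d + 2 * pi - pi / 2 ^ k" using d(1) big(2) by linarith
        then show "arc (a + ?d) b" unfolding arc_def using * by blast
        show "a < a + ?d" "a + ?d < b" using d big(2) pi_gt_zero by linarith+
      qed (rule ar)
    next
      assume *: "dyadic k a"
      show thesis
      proof (rule that[of "b - ?d"])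
        have "b - ?d = a + 2 * pi - pi / 2 ^ k" using d(1) big(2) by linarith
        then show "arc a (b - ?d)" unfolding arc_def using * by blast
        show "a < b - ?d" "b - ?d < b" using d big(2) pi_gt_zero by linarith+
      qed (rule ar)
    qed
  qed
qed

lemma short_arc_around:
  assumes "l < e" "e < r"
  obtains s s' where "l \<le> s" "s \<le> e" "e < s'" "s' \<le> r" "arc s s'"
proof -
  let ?m = "min (e - l) (r - e)"
  have m: "0 < ?m" using assms by simp
  obtain n where n: "(1/2) ^ n < ?m / pi"
    using m real_arch_pow_inv[of "?m / pi" "1/2"] by auto
  then have d: "pi / 2 ^ n < ?m" by (simp add: field_simps)
  let ?d = "pi / 2 ^ n"
  define s where "s = \<lfloor>e / ?d\<rfloor> * ?d"
  have d0: "0 < ?d" by simp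
  have "\<lfloor>e / ?d\<rfloor> * ?d \<le> e"
    using d0 by (metis of_int_floor_le pos_le_divide_eq)
  then have s1: "s \<le> e" by (simp add: s_def)
  have "e / ?d < \<lfloor>e / ?d\<rfloor> + 1" by linarith
  then have "e < (\<lfloor>e / ?d\<rfloor> + 1) * ?d" using d0 by (metis pos_divide_less_eq)
  then have s2: "e < s + ?d" by (simp add: s_def algebra_simps)
  have "arc s (s + ?d)" unfolding arc_def dyadic_def s_def by blast
  then show thesis using that[of s "s + ?d"] s1 s2 d by linarith
qed

text \<open>
  Arcs accumulate only at the boundary of the strip \<open>a < b < a + 2\<pi>\<close>; hence suprema over bounded
  families of arcs that stay away from it are attained.
\<close>

lemma finite_arcs:
  assumes "0 < e"
  shows "finite {(a, b). arc a b \<and> \<bar>a\<bar> \<le> B \<and> e \<le> b - a \<and> b - a \<le> 2 * pi - e}" (is "finite ?S")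
proof -
  obtain N where N: "(1/2) ^ N < e / pi"
    using assms real_arch_pow_inv[of "e / pi" "1/2"] by auto
  define M where "M = \<lceil>\<bar>B\<bar> * 2 ^ N / pi\<rceil>"
  let ?f = "\<lambda>(n, m::int, c). (m * (pi / 2 ^ n), m * (pi / 2 ^ n) + (if c then pi / 2 ^ n else 2 * pi - pi / 2 ^ n))"
  have "?S \<subseteq> ?f ` ({..N} \<times> {- M..M} \<times> UNIV)"
  proof clarify
    fix a b assume *: "arc a b" "\<bar>a\<bar> \<le> B" "e \<le> b - a" "b - a \<le> 2 * pi - e"
    obtain n where n: "dyadic n a" "b = a + pi / 2 ^ n \<or> b = a + 2 * pi - pi / 2 ^ n"
      using * arc_def by blast
    obtain m :: int where m: "a = m * (pi / 2 ^ n)" using n dyadic_def by blast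
    have "e \<le> pi / 2 ^ n" using n * by auto
    then have "e / pi \<le> (1/2) ^ n" by (simp add: field_simps)
    then have "(1/2) ^ N < (1/2::real) ^ n" using N by linarith
    then have "n < N" by (simp add: power_strict_decreasing_iff)
    then have nN: "n \<le> N" by simp
    have "\<bar>m\<bar> = \<bar>a\<bar> * 2 ^ n / pi" unfolding m by (simp add: abs_mult)
    also have "\<dots> \<le> \<bar>B\<bar> * 2 ^ N / pi"
      using * nN by (intro divide_right_mono mult_mono power_increasing) auto
    also have "\<dots> \<le> M" unfolding M_def by linarith
    finally have "\<bar>m\<bar> \<le> M" by linarith
    then have "(n, m, b = a + pi / 2 ^ n) \<in> {..N} \<times> {- M..M} \<times> UNIV" using nN by auto
    moreover have "(a, b) = ?f (n, m, b = a + pi / 2 ^ n)" using n m by auto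
    ultimately show "(a, b) \<in> ?f ` ({..N} \<times> {- M..M} \<times> UNIV)" by (rule image_eqI[rotated])
  qed
  then show ?thesis by (rule finite_subset) auto
qed

text \<open>
  Between two nested arcs there is a chain of arcs in which consecutive members are two sides of a
  triangle, so each step moves only one end. Starting from \<open>(t1, t2)\<close>, which is to the upper left of
  the point \<open>(x, y)\<close>, and ending at \<open>(u1, u2)\<close>, which is to its lower right, the chain cannot avoid both
  the lower left and the upper right quadrant. In the proof, the chain is replaced by a shortest
  arc that is still on the left of \<open>(x, y)\<close>: the third vertex of its inner triangle decides.
\<close>

lemma nested_arcs_cross_corner:
  assumes "arc t1 t2" "arc u1 u2" "t1 \<le> x" "x < u1" "u2 \<le> y" "y < t2"
  shows "\<exists>a b. arc a b \<and> t1 \<le> a \<and> u2 \<le> b \<and> (a \<le> x \<and> b \<le> y \<or> x < a \<and> a \<le> u1 \<and> y < b \<and> b \<le> t2)"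
proof -
  let ?S = "{(a, b). arc a b \<and> t1 \<le> a \<and> a \<le> x \<and> u2 \<le> b \<and> b \<le> t2}"
  let ?e = "min (u2 - u1) (2 * pi - (t2 - t1))"
  have e: "0 < ?e" using arc_ends[OF assms(1)] arc_ends[OF assms(2)] by simp
  have "?S \<subseteq> {(a, b). arc a b \<and> \<bar>a\<bar> \<le> max \<bar>t1\<bar> \<bar>x\<bar> \<and> ?e \<le> b - a \<and> b - a \<le> 2 * pi - ?e}"
    using assms by auto
  then have fin: "finite ?S" using finite_arcs[OF e] by (rule finite_subset)
  have "(t1, t2) \<in> ?S" using assms by auto
  then have ne: "?S \<noteq> {}" by blast
  obtain a b where ab: "(a, b) \<in> ?S" and min: "\<And>p. p \<in> ?S \<Longrightarrow> b - a \<le> snd p - fst p"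
    using arg_min_if_finite[OF fin ne, of "\<lambda>p. snd p - fst p"]
    by (metis (no_types, lifting) linorder_not_less prod.collapse fst_conv snd_conv)
  then obtain s where s: "a < s" "s < b" "arc a s" "arc s b"
    using arc_triangle by blast
  have u: "u1 < u2" "t2 < t1 + 2 * pi" using arc_ends assms by blast+
  have "\<not> u2 \<le> s"
  proof
    assume "u2 \<le> s"
    then have "(a, s) \<in> ?S" using ab s by auto
    from min[OF this] show False using s by simp
  qed
  moreover have "s \<le> u1 \<or> u2 \<le> s"
    using arcs_noncrossing[OF s(3) assms(2)] ab s assms u by force
  ultimately have su: "s \<le> u1" by blast
  show ?thesis
  proof (cases "b \<le> y")
    case True
    then show ?thesis using ab by auto
  next
    case False
    have "\<not> s \<le> x"
    proof
      assume "s \<le> x"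
      then have "(s, b) \<in> ?S" using ab s by auto
      from min[OF this] show False using s by simp
    qed
    then show ?thesis using False ab s su by (intro exI[of _ s] exI[of _ b]) auto
  qed
qed


section \<open>Basic morphisms that survive in the quotient\<close>

text \<open>
  The action of the \<open>k\<close>-th power of \<open>F\<close> on the points of the plane.
\<close>

definition Fpow :: "int \<Rightarrow> point \<Rightarrow> point" where
  "Fpow k p = (if even k then (fst p + k * pi, snd p + k * pi) else (snd p + k * pi, fst p + k * pi))"

lemma Fpow_0 [simp]: "Fpow 0 p = p"
  by (simp add: Fpow_def)

lemma Fpow_Fpow [simp]: "Fpow k (Fpow l p) = Fpow (k + l) p"
  by (auto simp: Fpow_def algebra_simps)

lemma Fpow_1: "Fpow 1 p = swap_pt p"
  by (simp add: Fpow_def swap_pt_def)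

lemma below_Fpow [simp]: "below (Fpow k p) (Fpow k q) \<longleftrightarrow> below p q"
  by (auto simp: below_def Fpow_def)

lemma below_refl [simp]: "below p p"
  by (simp add: below_def)

lemma below_trans: "below p q \<Longrightarrow> below q r \<Longrightarrow> below p r"
  by (auto simp: below_def)

lemma arc_translate: "arc a b \<Longrightarrow> arc (a + of_int m * (2 * pi)) (b + of_int m * (2 * pi))"
proof -
  assume "arc a b"
  then obtain n where n: "dyadic n a" "b = a + pi / 2 ^ n \<or> b = a + 2 * pi - pi / 2 ^ n"
    using arc_def by blast
  have "of_int m * (2 * pi) = of_int (m * 2 ^ (n + 1)) * (pi / 2 ^ n)"
    by simp
  then have "dyadic n (of_int m * (2 * pi))"
    unfolding dyadic_def by blast
  then have "dyadic n (a + of_int m * (2 * pi))"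
    using n dyadic_add by blast
  then show ?thesis unfolding arc_def using n(2) by (intro exI[of _ n]) auto
qed

lemma lifts_T_Fpow_imp: "p \<in> lifts_T \<Longrightarrow> Fpow k p \<in> lifts_T"
proof -
  assume "p \<in> lifts_T"
  then have p: "arc (fst p) (snd p + pi)" by (simp add: lifts_T_def)
  show ?thesis
  proof (cases "even k")
    case True
    then obtain m where "k = 2 * m" by blast
    then show ?thesis using arc_translate[OF p, of m] by (simp add: lifts_T_def Fpow_def algebra_simps)
  next
    case False
    then obtain m where "k = 2 * m + 1" using oddE by blast
    then show ?thesis using arc_translate[OF arc_shift[OF p], of m]
      by (simp add: lifts_T_def Fpow_def algebra_simps)
  qed
qed

lemma lifts_T_Fpow [simp]: "Fpow k p \<in> lifts_T \<longleftrightarrow> p \<in> lifts_T"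
  using lifts_T_Fpow_imp[of p k] lifts_T_Fpow_imp[of "Fpow k p" "- k"] by auto

definition reflect :: "point \<Rightarrow> point" where
  "reflect p = (- fst p, - snd p)"

lemma reflect_reflect [simp]: "reflect (reflect p) = p"
  by (simp add: reflect_def)

lemma below_reflect [simp]: "below (reflect p) (reflect q) \<longleftrightarrow> below q p"
  by (auto simp: below_def reflect_def)

lemma reflect_Fpow: "reflect (Fpow k p) = Fpow (- k) (reflect p)"
  by (auto simp: reflect_def Fpow_def)

lemma lifts_T_reflect_imp: "p \<in> lifts_T \<Longrightarrow> reflect p \<in> lifts_T"
  using arc_neg[of "fst p" "snd p + pi"] by (simp add: lifts_T_def reflect_def)

lemma lifts_T_reflect [simp]: "reflect p \<in> lifts_T \<longleftrightarrow> p \<in> lifts_T"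
  using lifts_T_reflect_imp[of p] lifts_T_reflect_imp[of "reflect p"] by auto

text \<open>
  The basic morphism \<open>p \<rightarrow> q\<close> factors through the points of the rectangle with corners \<open>p\<close> and \<open>q\<close> and
  through no others. It survives the two quotients exactly if this rectangle stays inside the strip and
  contains no lift of an object of \<open>\<T>\<close>.
\<close>

definition live :: "point \<Rightarrow> point \<Rightarrow> bool" where
  "live p q \<longleftrightarrow> below p q \<and> fst q < snd p + pi \<and> snd q < fst p + pi \<and>
     (\<forall>t\<in>lifts_T. \<not> (below p t \<and> below t q))"

lemma live_Fpow_imp:
  assumes "live p q"
  shows "live (Fpow k p) (Fpow k q)"
  unfolding live_def
proof (intro conjI ballI)
  show "below (Fpow k p) (Fpow k q)" using assms live_def by simp
  show "fst (Fpow k q) < snd (Fpow k p) + pi" "snd (Fpow k q) < fst (Fpow k p) + pi"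
    using assms by (auto simp: live_def Fpow_def)
  fix t assume "t \<in> lifts_T"
  then have "\<not> (below p (Fpow (- k) t) \<and> below (Fpow (- k) t) q)"
    using assms unfolding live_def by simp
  then show "\<not> (below (Fpow k p) t \<and> below t (Fpow k q))"
    using below_Fpow[of k _ "Fpow (- k) t"] below_Fpow[of k "Fpow (- k) t"] by simp
qed

lemma live_Fpow [simp]: "live (Fpow k p) (Fpow k q) \<longleftrightarrow> live p q"
  using live_Fpow_imp[of p q k] live_Fpow_imp[of "Fpow k p" "Fpow k q" "- k"] by auto

lemma live_reflect_imp:
  assumes "live p q"
  shows "live (reflect q) (reflect p)"
  unfolding live_def
proof (intro conjI ballI)
  show "below (reflect q) (reflect p)" using assms live_def by simp
  show "fst (reflect p) < snd (reflect q) + pi" "snd (reflect p) < fst (reflect q) + pi"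
    using assms by (auto simp: live_def reflect_def)
  fix t assume "t \<in> lifts_T"
  then have "\<not> (below p (reflect t) \<and> below (reflect t) q)"
    using assms unfolding live_def by simp
  then show "\<not> (below (reflect q) t \<and> below t (reflect p))"
    using below_reflect[of q "reflect t"] below_reflect[of "reflect t" p] by auto
qed

lemma live_reflect [simp]: "live (reflect q) (reflect p) \<longleftrightarrow> live p q"
  using live_reflect_imp[of p q] live_reflect_imp[of "reflect q" "reflect p"] by auto

lemma live_below: "live p q \<Longrightarrow> below p q"
  by (simp add: live_def)

lemma live_between:
  assumes "live p q" "below p r" "below r q"
  shows "live p r" "live r q"
  using assms unfolding live_def below_def by force+

lemma live_self:
  assumes "live p q"
  shows "live p p" "live q q"
  using live_between[OF assms, of p] live_between[OF assms, of q] assms live_below by simp_all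

text \<open>
  Short dyadic intervals exist around every point of the circle. This makes the boundary of the strip
  behave like \<open>\<T>\<close>: a rectangle that is composed of two surviving ones and reaches the boundary already
  contains an arc that bounds the complement of a short interval.
\<close>

lemma leaving_strip_meets_T:
  assumes "live w x" "live x y" "fst w + pi \<le> snd y"
  shows "\<exists>t\<in>lifts_T. below w t \<and> below t y"
proof -
  have *: "fst w \<le> fst x" "snd w \<le> snd x" "fst x \<le> fst y" "snd x < fst w + pi" "snd y < fst x + pi"
    using assms by (auto simp: live_def below_def)
  have "snd w - pi < fst w" "fst w < fst y" using * assms(3) by linarith+
  then obtain s s' where s: "snd w - pi \<le> s" "s \<le> fst w" "fst w < s'" "s' \<le> fst y" "arc s s'"
    using short_arc_around by blast
  have "(s', s + pi) \<in> lifts_T"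
    using arc_shift[OF s(5)] by (simp add: lifts_T_def algebra_simps)
  moreover have "below w (s', s + pi)" "below (s', s + pi) y"
    using s assms(3) by (auto simp: below_def)
  ultimately show ?thesis by blast
qed

lemma live_comp:
  assumes "live w x" "live x y" and free: "\<And>t. t \<in> lifts_T \<Longrightarrow> below w t \<Longrightarrow> below t y \<Longrightarrow> False"
  shows "live w y"
proof -
  have "\<not> fst w + pi \<le> snd y"
    using leaving_strip_meets_T[OF assms(1,2)] free by blast
  moreover have "\<not> snd w + pi \<le> fst y"
  proof
    assume "snd w + pi \<le> fst y"
    then have "fst (Fpow 1 w) + pi \<le> snd (Fpow 1 y)" by (simp add: Fpow_def)
    then obtain t where t: "t \<in> lifts_T" "below (Fpow 1 w) t" "below t (Fpow 1 y)"
      using leaving_strip_meets_T[of "Fpow 1 w" "Fpow 1 x" "Fpow 1 y"] assms by auto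
    then show False
      using free[of "Fpow (- 1) t"] below_Fpow[of 1 w "Fpow (- 1) t"] below_Fpow[of 1 "Fpow (- 1) t" y] by simp
  qed
  moreover have "below w y" using assms live_below below_trans by blast
  ultimately show ?thesis using free by (auto simp: live_def)
qed

text \<open>
  Let \<open>w \<rightarrow> x \<rightarrow> y\<close> be surviving morphisms whose composite dies. The points of \<open>\<T>\<close> in the rectangle of
  \<open>w\<close> and \<open>y\<close> are then in neither of the two smaller rectangles, so each is to the upper left or
  to the lower right of \<open>x\<close>.
\<close>

definition hole_upper :: "point \<Rightarrow> point \<Rightarrow> point \<Rightarrow> bool" where
  "hole_upper w x y \<longleftrightarrow>
     (\<exists>t\<in>lifts_T. below w t \<and> below t y \<and> fst t < fst x \<and> snd x < snd t)"

definition hole_lower :: "point \<Rightarrow> point \<Rightarrow> point \<Rightarrow> bool" where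
  "hole_lower w x y \<longleftrightarrow>
     (\<exists>t\<in>lifts_T. below w t \<and> below t y \<and> fst x < fst t \<and> snd t < snd x)"

lemma hole_upper_Fpow: "hole_upper (Fpow 1 w) (Fpow 1 x) (Fpow 1 y) \<longleftrightarrow> hole_lower w x y"
proof
  assume "hole_upper (Fpow 1 w) (Fpow 1 x) (Fpow 1 y)"
  then obtain t where t: "t \<in> lifts_T" "below (Fpow 1 w) t" "below t (Fpow 1 y)"
    "fst t < fst (Fpow 1 x)" "snd (Fpow 1 x) < snd t"
    unfolding hole_upper_def by blast
  then show "hole_lower w x y"
    unfolding hole_lower_def
    using below_Fpow[of 1 w "Fpow (- 1) t"] below_Fpow[of 1 "Fpow (- 1) t" y]
    by (intro bexI[of _ "Fpow (- 1) t"]) (auto simp: Fpow_def[of 1] Fpow_def[of "-1" t] simp flip: lifts_T_Fpow[of "- 1" t])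
next
  assume "hole_lower w x y"
  then obtain t where "t \<in> lifts_T" "below w t" "below t y" "fst x < fst t" "snd t < snd x"
    unfolding hole_lower_def by blast
  then show "hole_upper (Fpow 1 w) (Fpow 1 x) (Fpow 1 y)"
    unfolding hole_upper_def by (intro bexI[of _ "Fpow 1 t"]) (auto simp: Fpow_def below_def simp flip: lifts_T_Fpow[of 1 t])
qed

lemma hole_not_live: "hole_upper w x y \<Longrightarrow> \<not> live w y" "hole_lower w x y \<Longrightarrow> \<not> live w y"
  by (auto simp: hole_upper_def hole_lower_def live_def)

lemma some_hole:
  assumes "live w x" "live x y" "\<not> live w y"
  shows "hole_upper w x y \<or> hole_lower w x y"
proof -
  obtain t where t: "t \<in> lifts_T" "below w t" "below t y"
    using live_comp[OF assms(1,2)] assms(3) by blast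
  then have "\<not> below t x" "\<not> below x t"
    using assms by (auto simp: live_def)
  then show ?thesis
    using t unfolding hole_upper_def hole_lower_def below_def by force
qed

text \<open>
  A chain of arcs from an upper hole to a lower hole would have to pass through one of the two rectangles
  that are free of \<open>\<T>\<close>.
\<close>

lemma not_both_holes:
  assumes "live w x" "live x y"
  shows "\<not> (hole_upper w x y \<and> hole_lower w x y)"
proof
  assume "hole_upper w x y \<and> hole_lower w x y"
  then obtain t u where t: "t \<in> lifts_T" "below w t" "below t y" "fst t < fst x" "snd x < snd t"
    and u: "u \<in> lifts_T" "below w u" "below u y" "fst x < fst u" "snd u < snd x"
    unfolding hole_upper_def hole_lower_def by blast
  obtain a b where ab: "arc a b" "fst t \<le> a" "snd u + pi \<le> b"
    "a \<le> fst x \<and> b \<le> snd x + pi \<or> fst x < a \<and> a \<le> fst u \<and> snd x + pi < b \<and> b \<le> snd t + pi"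
    using nested_arcs_cross_corner[of "fst t" "snd t + pi" "fst u" "snd u + pi" "fst x" "snd x + pi"] t u
    by (auto simp: lifts_T_def)
  have T: "(a, b - pi) \<in> lifts_T" using ab by (simp add: lifts_T_def)
  have "below w (a, b - pi) \<and> below (a, b - pi) x \<or> below x (a, b - pi) \<and> below (a, b - pi) y"
    using ab t u by (auto simp: below_def)
  then show False using T assms by (auto simp: live_def)
qed

text \<open>
  The morphisms into \<open>x\<close> that die in \<open>y\<close> because of an upper hole form a representable functor: it is
  represented by the point level with \<open>x\<close> and with first coordinate that of the rightmost hole. If that point
  itself does not survive to \<open>x\<close>, or if there is no hole at all, no such morphism exists. The largest
  first coordinate is attained by the finiteness of the relevant arcs.
\<close>

lemma upper_end:
  assumes xy: "live x y"
  shows "(\<forall>w. \<not> (live w x \<and> hole_upper w x y)) \<or>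
         (\<exists>z. live z x \<and> (\<forall>w. live w z \<longleftrightarrow> live w x \<and> hole_upper w x y))"
proof (cases "snd x = snd y")
  case True
  then show ?thesis by (auto simp: hole_upper_def below_def)
next
  case False
  have b: "fst x \<le> fst y" "snd x < snd y" "fst y < snd x + pi" "snd y < fst x + pi"
    using xy False by (auto simp: live_def below_def)
  \<comment> \<open>A short arc around \<open>?e\<close> gives a hole whose first coordinate exceeds \<open>snd y - pi\<close>; holes further
    right stay away from the boundary of the strip.\<close>
  let ?e = "snd y - pi"
  have "(snd x - pi + ?e) / 2 < ?e" "?e < (?e + fst x) / 2" using b by auto
  then obtain s s' where s: "(snd x - pi + ?e) / 2 \<le> s" "s \<le> ?e" "?e < s'" "s' \<le> (?e + fst x) / 2" "arc s s'"
    using short_arc_around by blast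
  let ?Q = "{t \<in> lifts_T. s' \<le> fst t \<and> fst t < fst x \<and> snd x < snd t \<and> snd t \<le> snd y}"
  have T0: "(s', s + pi) \<in> ?Q"
    using arc_shift[OF s(5)] s b by (auto simp: lifts_T_def field_simps)
  let ?d = "min (snd x + pi - fst x) (pi - snd y + s')"
  have d: "0 < ?d" using b s by auto
  let ?A = "{(a, b). arc a b \<and> \<bar>a\<bar> \<le> max \<bar>s'\<bar> \<bar>fst x\<bar> \<and> ?d \<le> b - a \<and> b - a \<le> 2 * pi - ?d}"
  have "?Q \<subseteq> (\<lambda>(a, b). (a, b - pi)) ` ?A"
  proof
    fix t assume "t \<in> ?Q"
    then have "(fst t, snd t + pi) \<in> ?A" by (auto simp: lifts_T_def)
    then show "t \<in> (\<lambda>(a, b). (a, b - pi)) ` ?A" by (rule rev_image_eqI) simp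
  qed
  then have "finite ?Q" using finite_arcs[OF d] by (rule finite_subset[OF _ finite_imageI])
  then have fin: "finite (fst ` ?Q)" by (rule finite_imageI)
  have "Max (fst ` ?Q) \<in> fst ` ?Q" using Max_in[OF fin] T0 by blast
  then obtain t where tQ: "t \<in> ?Q" and t: "fst t = Max (fst ` ?Q)" by (metis (no_types, lifting) imageE)
  have tmax: "fst t' \<le> fst t" if "t' \<in> ?Q" for t'
    unfolding t using Max_ge[OF fin imageI[OF that]] .
  have max: "fst t' \<le> fst t" if "t' \<in> lifts_T" "fst t' < fst x" "snd x < snd t'" "snd t' \<le> snd y" for t'
    using tmax[of t'] that tQ by force
  define z where "z = (fst t, snd x)"
  have zx: "below z x" using tQ by (auto simp: z_def below_def)
  have to_z: "live w z \<and> live z x" if w: "live w x" "hole_upper w x y" for w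
  proof -
    obtain t' where "t' \<in> lifts_T" "below w t'" "below t' y" "fst t' < fst x" "snd x < snd t'"
      using w(2) unfolding hole_upper_def by blast
    then have "fst w \<le> fst t" using max[of t'] by (auto simp: below_def)
    then have "below w z" using w live_below by (auto simp: z_def below_def)
    then show ?thesis using live_between[OF w(1) _ zx] by blast
  qed
  show ?thesis
  proof (cases "live z x")
    case False
    then show ?thesis using to_z by blast
  next
    case zx_live: True
    have "live w x \<and> hole_upper w x y" if wz: "live w z" for w
    proof -
      have w: "below w z" using wz live_below by blast
      have "hole_upper w x y"
        unfolding hole_upper_def using w tQ b by (intro bexI[of _ t]) (auto simp: below_def z_def)
      moreover have "live w x"
      proof (rule live_comp[OF wz zx_live])
        fix u assume u: "u \<in> lifts_T" "below w u" "below u x"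
        have "\<not> below u z" "\<not> below z u" using u wz zx_live by (auto simp: live_def)
        then have u2: "fst t < fst u" "snd u < snd x" using u by (auto simp: z_def below_def)
        obtain a b where ab: "arc a b" "fst t \<le> a" "snd u + pi \<le> b"
          "a \<le> fst t \<and> b \<le> snd x + pi \<or> fst t < a \<and> a \<le> fst u \<and> snd x + pi < b \<and> b \<le> snd t + pi"
          using nested_arcs_cross_corner[of "fst t" "snd t + pi" "fst u" "snd u + pi" "fst t" "snd x + pi"] tQ u u2
          by (auto simp: lifts_T_def)
        have T: "(a, b - pi) \<in> lifts_T" using ab by (simp add: lifts_T_def)
        from ab(4) show False
        proof
          assume "a \<le> fst t \<and> b \<le> snd x + pi"
          then have "below w (a, b - pi)" "below (a, b - pi) z"
            using ab u w by (auto simp: below_def z_def)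
          then show False using T wz by (auto simp: live_def)
        next
          assume *: "fst t < a \<and> a \<le> fst u \<and> snd x + pi < b \<and> b \<le> snd t + pi"
          then have "\<not> a < fst x" using max[OF T] tQ by auto
          then have "below x (a, b - pi)" "below (a, b - pi) y"
            using * u tQ b by (auto simp: below_def)
          then show False using T xy by (auto simp: live_def)
        qed
      qed
      ultimately show ?thesis by blast
    qed
    then show ?thesis using zx_live to_z by blast
  qed
qed

lemma lower_end:
  assumes "live x y"
  shows "(\<forall>w. \<not> (live w x \<and> hole_lower w x y)) \<or>
         (\<exists>z. live z x \<and> (\<forall>w. live w z \<longleftrightarrow> live w x \<and> hole_lower w x y))"
proof -
  have "live (Fpow 1 x) (Fpow 1 y)" using assms by simp
  from upper_end[OF this] show ?thesis
  proof
    assume *: "\<forall>w. \<not> (live w (Fpow 1 x) \<and> hole_upper w (Fpow 1 x) (Fpow 1 y))"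
    have "\<not> (live w x \<and> hole_lower w x y)" for w
      using *[rule_format, of "Fpow 1 w"] by (simp add: hole_upper_Fpow)
    then show ?thesis by blast
  next
    assume "\<exists>z. live z (Fpow 1 x) \<and> (\<forall>w. live w z \<longleftrightarrow> live w (Fpow 1 x) \<and> hole_upper w (Fpow 1 x) (Fpow 1 y))"
    then obtain z where z: "live z (Fpow 1 x)"
      "\<And>w. live w z \<longleftrightarrow> live w (Fpow 1 x) \<and> hole_upper w (Fpow 1 x) (Fpow 1 y)" by blast
    have "live (Fpow (- 1) z) x" using z(1) live_Fpow[of 1 "Fpow (- 1) z" x] by simp
    moreover have "live w (Fpow (- 1) z) \<longleftrightarrow> live w x \<and> hole_lower w x y" for w
      using z(2)[of "Fpow 1 w"] live_Fpow[of 1 w "Fpow (- 1) z"] by (simp add: hole_upper_Fpow)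
    ultimately show ?thesis by blast
  qed
qed

text \<open>
  As \<open>z\<close> survives to \<open>y\<close>, an upper hole of \<open>x\<close> has to be to the left of \<open>z\<close> as well; so \<open>w\<close> is also to the
  left of \<open>z\<close>.
\<close>

lemma upper_hole_extends:
  assumes "live w x" "hole_upper w x y" "live z y" "below z x" "snd z = snd x"
  shows "live w z"
proof -
  obtain t where t: "t \<in> lifts_T" "below w t" "below t y" "fst t < fst x" "snd x < snd t"
    using assms(2) unfolding hole_upper_def by blast
  then have "\<not> below z t" using assms(3) by (auto simp: live_def)
  then have "below w z"
    using t assms live_below[OF assms(1)] by (auto simp: below_def)
  then show ?thesis using live_between[OF assms(1)] assms(4) by blast
qed

lemma upper_hole_restricts:
  assumes "live w z" "live z y" "\<not> hole_lower w z y" "\<not> live w y" "live x y" "below z x" "snd z = snd x"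
  shows "live w x" "hole_upper w x y"
proof -
  have U: "hole_upper w z y" using some_hole[OF assms(1,2,4)] assms(3) by blast
  then show "hole_upper w x y"
    unfolding hole_upper_def using assms(6,7) by (auto simp: below_def)
  show "live w x"
  proof (rule live_comp[OF assms(1)])
    show "live z x" using live_between[OF assms(2,6)] assms live_below by blast
    fix t assume t: "t \<in> lifts_T" "below w t" "below t x"
    have "below t y" using t assms live_below below_trans by blast
    then have "\<not> below z t" "\<not> below t z" using t assms(1,2) by (auto simp: live_def)
    then have "hole_lower w z y"
      unfolding hole_lower_def using t \<open>below t y\<close> assms(6,7) by (auto simp: below_def)
    then show False using assms by blast
  qed
qed

lemma lower_hole_extends:
  assumes "live w x" "hole_lower w x y" "live z y" "below z x" "fst z = fst x"
  shows "live w z"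
  using upper_hole_extends[of "Fpow 1 w" "Fpow 1 x" "Fpow 1 y" "Fpow 1 z"] assms
  by (simp add: hole_upper_Fpow) (simp add: Fpow_def)

lemma hole_lower_Fpow: "hole_lower (Fpow 1 w) (Fpow 1 x) (Fpow 1 y) \<longleftrightarrow> hole_upper w x y"
proof -
  have "hole_upper (Fpow 2 w) (Fpow 2 x) (Fpow 2 y) \<longleftrightarrow> hole_upper w x y"
  proof -
    have imp: "hole_upper (Fpow k w) (Fpow k x) (Fpow k y)" if "hole_upper w x y" "even k" for k w x y
    proof -
      obtain t where "t \<in> lifts_T" "below w t" "below t y" "fst t < fst x" "snd x < snd t"
        using \<open>hole_upper w x y\<close> unfolding hole_upper_def by blast
      then show ?thesis
        unfolding hole_upper_def using \<open>even k\<close>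
        by (intro bexI[of _ "Fpow k t"]) (auto simp: Fpow_def below_def simp flip: lifts_T_Fpow[of k t])
    qed
    show ?thesis
      using imp[of w x y 2] imp[of "Fpow 2 w" "Fpow 2 x" "Fpow 2 y" "- 2"] by auto
  qed
  then show ?thesis using hole_upper_Fpow[of "Fpow 1 w" "Fpow 1 x" "Fpow 1 y"] by simp
qed

lemma lower_hole_restricts:
  assumes "live w z" "live z y" "\<not> hole_upper w z y" "\<not> live w y" "live x y" "below z x" "fst z = fst x"
  shows "live w x" "hole_lower w x y"
proof -
  have "snd (Fpow 1 z) = snd (Fpow 1 x)" using assms(7) by (simp add: Fpow_def)
  then show "live w x" "hole_lower w x y"
    using upper_hole_restricts[of "Fpow 1 w" "Fpow 1 z" "Fpow 1 y" "Fpow 1 x"] assms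
    by (simp_all add: hole_upper_Fpow hole_lower_Fpow)
qed

section \<open>Kernels of rows in degree zero\<close>

text \<open>
  Consider the path \<open>0, 1, 1, 2, 2, \<dots>\<close> in which unknowns \<open>h j\<close> and equations \<open>h i - h (i - 1) = b i\<close>
  alternate. The hypotheses give a perfect matching of the unknowns in \<open>J\<close> and the equations in \<open>I\<close>: an
  equation \<open>i \<in> L\<close> is matched with \<open>h i\<close>, the others with \<open>h (i - 1)\<close>. The equations of the first kind are
  solved by recursion from the left and those of the second kind from the right, and the two recursions do not meet.
\<close>

lemma alternating_path_solution:
  fixes b :: "nat \<Rightarrow> 'k::field"
  assumes fin: "finite I" and I0: "0 \<notin> I" and LI: "L \<subseteq> I"
    and A: "\<And>i. i \<in> L \<Longrightarrow> i \<in> J"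
    and B: "\<And>j. Suc j \<in> I - L \<Longrightarrow> j \<in> J"
    and C: "\<And>j. j \<in> J \<Longrightarrow> j \<in> L \<or> Suc j \<in> I - L"
    and D: "\<And>j. j \<in> L \<Longrightarrow> Suc j \<in> I - L \<Longrightarrow> False"
  shows "\<exists>!h. (\<forall>j. h j \<noteq> 0 \<longrightarrow> j \<in> J) \<and> (\<forall>i\<in>I. h i - h (i - 1) = b i)"
proof -
  obtain N where N: "\<And>i. i \<in> I \<Longrightarrow> i \<le> N"
    using fin unfolding finite_nat_set_iff_bounded_le by blast
  define hL where "hL = rec_nat 0 (\<lambda>j r. if Suc j \<in> L then b (Suc j) + r else 0)"
  have hL: "hL (Suc j) = (if Suc j \<in> L then b (Suc j) + hL j else 0)" for j
    unfolding hL_def by (rule rec_nat_Suc_imp, rule refl)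
  have "hL 0 = 0" by (simp add: hL_def)
  then have hL0: "hL j = 0" if "j \<notin> L" for j
    using that hL by (cases j) simp_all
  define r where "r = rec_nat 0 (\<lambda>d s. if Suc (N - d) \<in> I - L then s - b (Suc (N - d)) else 0)"
  define hU where "hU j = (if j \<le> N then r (Suc (N - j)) else 0)" for j
  have r_Suc: "r (Suc d) = (if Suc (N - d) \<in> I - L then r d - b (Suc (N - d)) else 0)" for d
    unfolding r_def by (rule rec_nat_Suc_imp, rule refl)
  have hU: "hU j = (if Suc j \<in> I - L then hU (Suc j) - b (Suc j) else 0)" for j
  proof (cases "Suc j \<le> N")
    case True
    then have "N - (N - j) = j" "hU (Suc j) = r (N - j)" "hU j = r (Suc (N - j))"
      by (simp_all add: hU_def Suc_diff_Suc)
    then show ?thesis using r_Suc[of "N - j"] by presburger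
  next
    case False
    then have "Suc j \<notin> I" using N by blast
    moreover have "hU j = 0"
    proof (cases "j \<le> N")
      case True
      then have "N - (N - j) = j" by simp
      then show ?thesis using r_Suc[of "N - j"] True \<open>Suc j \<notin> I\<close> by (simp only: hU_def if_True Diff_iff simp_thms if_False)
    qed (simp add: hU_def)
    ultimately show ?thesis by simp
  qed
  show ?thesis
  proof (rule ex1I[of _ "\<lambda>j. hL j + hU j"], intro conjI allI impI ballI)
    fix j assume "hL j + hU j \<noteq> 0"
    then have "j \<in> L \<or> Suc j \<in> I - L"
      using hL0[of j] hU[of j] by (metis add_0_right)
    then show "j \<in> J" using A B by blast
  next
    fix i assume "i \<in> I"
    then obtain j where i: "i = Suc j" using I0 by (cases i) auto
    show "hL i + hU i - (hL (i - 1) + hU (i - 1)) = b i"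
    proof (cases "i \<in> L")
      case True
      then have "Suc i \<notin> I - L" using D by blast
      then have "hU i = 0" using hU[of i] by (auto split: if_splits)
      moreover have "hU j = 0" using hU[of j] True i by simp
      ultimately show ?thesis using True i hL[of j] by simp
    next
      case False
      then have "j \<notin> L" using D \<open>i \<in> I\<close> i by blast
      then show ?thesis using False i \<open>i \<in> I\<close> hU[of j] hL0[of j] hL0[of i] by simp
    qed
  next
    fix h' assume h': "(\<forall>j. h' j \<noteq> 0 \<longrightarrow> j \<in> J) \<and> (\<forall>i\<in>I. h' i - h' (i - 1) = b i)"
    define d where "d j = h' j - (hL j + hU j)" for j
    have dJ: "d j = 0" if "j \<notin> J" for j
    proof -
      have "j \<notin> L" "Suc j \<notin> I - L" using that A B by blast+
      then show ?thesis using conjunct1[OF h', rule_format, of j] that hL0[of j] hU[of j]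
        unfolding d_def by (metis add_0_right diff_self)
    qed
    have step: "d (Suc j) = d j" if "Suc j \<in> I" for j
    proof -
      have "h' (Suc j) - h' j = b (Suc j)" using conjunct2[OF h', rule_format, OF that] by simp
      moreover have "hL (Suc j) + hU (Suc j) - (hL j + hU j) = b (Suc j)"
      proof (cases "Suc j \<in> L")
        case True
        then have "Suc (Suc j) \<notin> I - L" using D by blast
        then have "hU (Suc j) = 0" using hU[of "Suc j"] by (auto split: if_splits)
        moreover have "hU j = 0" using hU[of j] True by simp
        ultimately show ?thesis using True hL[of j] by simp
      next
        case False
        then have "j \<notin> L" using D that by blast
        then show ?thesis using False that hU[of j] hL0[of j] hL0[of "Suc j"] by simp
      qed
      ultimately show ?thesis by (simp add: d_def algebra_simps)
    qed
    have dL: "d j = 0" if "j \<in> L" for j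
      using that
    proof (induction j)
      case 0
      then show ?case using LI I0 by blast
    next
      case (Suc j)
      then have "d (Suc j) = d j" using step LI by blast
      moreover have "d j = 0"
        using dJ C[of j] Suc by (cases "j \<in> J") auto
      ultimately show ?case by simp
    qed
    have dU: "Suc j \<in> I - L \<Longrightarrow> d j = 0" for j
    proof (induction "N - j" arbitrary: j rule: less_induct)
      case less
      then have "d (Suc j) = d j" using step by blast
      moreover have "d (Suc j) = 0"
      proof (cases "Suc j \<in> J")
        case True
        then have "Suc (Suc j) \<in> I - L" using C less.prems by blast
        moreover have "N - Suc j < N - j" using N[of "Suc j"] less.prems by simp
        ultimately show ?thesis using less.hyps by blast
      qed (rule dJ)
      ultimately show ?case by simp
    qed
    have "d j = 0" for j
      using dJ dL dU C by blast
    then show "h' = (\<lambda>j. hL j + hU j)" by (simp add: d_def fun_eq_iff)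
  qed
qed

text \<open>
  The morphisms from \<open>w\<close> to the sum of the points \<open>X i\<close>, \<open>i \<in> I\<close>, of degree \<open>0\<close>, that is, without a
  power of \<open>F\<close>.
\<close>

definition vecs :: "point \<Rightarrow> nat set \<Rightarrow> (nat \<Rightarrow> point) \<Rightarrow> (nat \<Rightarrow> 'k::field) set" where
  "vecs w I X = {g. \<forall>i. g i \<noteq> 0 \<longrightarrow> i \<in> I \<and> live w (X i)}"

text \<open>
  The composite of \<open>h\<close> with the matrix \<open>k\<close> is \<open>g\<close>, where all entries at points to which \<open>w\<close> does not
  survive are dropped.
\<close>

definition solves :: "point \<Rightarrow> (nat \<Rightarrow> point) \<Rightarrow> nat set \<Rightarrow> (nat \<Rightarrow> nat \<Rightarrow> 'k::field) \<Rightarrow>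
    (nat \<Rightarrow> 'k) \<Rightarrow> (nat \<Rightarrow> 'k) \<Rightarrow> bool" where
  "solves w X J k g h \<longleftrightarrow> (\<forall>i. (if live w (X i) then \<Sum>j\<in>J. k i j * h j else 0) = g i)"

text \<open>
  The points \<open>Z j\<close> with the matrix \<open>k\<close> are a kernel, in degree \<open>0\<close>, of the row \<open>a\<close> of morphisms from the
  points \<open>X i\<close> to the single point \<open>y\<close>. Points \<open>w\<close> suffice as test objects, because a morphism from a sum is a family
  of columns.
\<close>

definition row_kernel :: "nat set \<Rightarrow> (nat \<Rightarrow> point) \<Rightarrow> point \<Rightarrow> (nat \<Rightarrow> 'k::field) \<Rightarrow>
    nat set \<Rightarrow> (nat \<Rightarrow> point) \<Rightarrow> (nat \<Rightarrow> nat \<Rightarrow> 'k) \<Rightarrow> bool" where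
  "row_kernel I X y a J Z k \<longleftrightarrow> finite J \<and> (\<forall>j\<in>J. live (Z j) (Z j)) \<and>
     (\<forall>i j. k i j \<noteq> 0 \<longrightarrow> i \<in> I \<and> j \<in> J \<and> live (Z j) (X i)) \<and>
     (\<forall>j\<in>J. live (Z j) y \<longrightarrow> (\<Sum>i\<in>I. a i * k i j) = 0) \<and>
     (\<forall>w. \<forall>g\<in>vecs w I X. (live w y \<longrightarrow> (\<Sum>i\<in>I. a i * g i) = 0) \<longrightarrow>
        (\<exists>!h. h \<in> vecs w J Z \<and> solves w X J k g h))"

lemma row_kernelD:
  assumes "row_kernel I X y a J Z k" "g \<in> vecs w I X" "live w y \<Longrightarrow> (\<Sum>i\<in>I. a i * g i) = 0"
  shows "\<exists>!h. h \<in> vecs w J Z \<and> solves w X J k g h"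
  using assms unfolding row_kernel_def by blast

lemma row_kernel_empty: "row_kernel {} X y a {} Z (\<lambda>i j. 0)"
  by (auto simp: row_kernel_def vecs_def solves_def intro!: ex1I[of _ "\<lambda>i. 0"])

text \<open>
  A column \<open>c\<close> that is killed by the row and has a unit at \<open>i\<close> splits off the summand \<open>X i\<close>: subtracting
  a multiple of \<open>c\<close> removes the coordinate \<open>i\<close> from any vector of the kernel.
\<close>

lemma row_kernel_insert:
  assumes fin: "finite I" and i: "i \<in> I"
    and a: "\<And>r. r \<in> I \<Longrightarrow> a r \<noteq> 0 \<Longrightarrow> live (X r) y"
    and c: "c \<in> vecs (X i) I X" "c i = 1" "live (X i) y \<Longrightarrow> (\<Sum>r\<in>I. a r * c r) = 0"
    and K: "row_kernel (I - {i}) X y a J Z k" and m: "m \<notin> J"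
  shows "row_kernel I X y a (insert m J) (Z(m := X i)) (\<lambda>r j. if j = m then c r else k r j)"
    (is "row_kernel I X y a ?J ?Z ?k")
  unfolding row_kernel_def
proof (intro conjI ballI allI impI)
  have finJ: "finite J" using K row_kernel_def by blast
  then show "finite ?J" by simp
  have ksup: "k r j \<noteq> 0 \<Longrightarrow> r \<in> I - {i} \<and> j \<in> J \<and> live (Z j) (X r)" for r j
    using K unfolding row_kernel_def by blast
  have ksum: "j \<in> J \<Longrightarrow> live (Z j) y \<Longrightarrow> (\<Sum>r\<in>I - {i}. a r * k r j) = 0" for j
    using K unfolding row_kernel_def by blast
  have csup: "c r \<noteq> 0 \<Longrightarrow> r \<in> I \<and> live (X i) (X r)" for r
    using c(1) by (simp add: vecs_def)
  show "live (?Z j) (?Z j)" if "j \<in> ?J" for j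
    using that K csup[of i] c(2) by (auto simp: row_kernel_def)
  show "r \<in> I" "j \<in> ?J" "live (?Z j) (X r)" if "?k r j \<noteq> 0" for r j
    using that ksup[of r j] csup[of r] m by (auto split: if_splits)
  show "(\<Sum>r\<in>I. a r * ?k r j) = 0" if "j \<in> ?J" "live (?Z j) y" for j
  proof (cases "j = m")
    case True
    then show ?thesis using that c(3) by simp
  next
    case False
    then have "j \<in> J" "live (Z j) y" using that by auto
    moreover have "k i j = 0" using ksup by blast
    ultimately show ?thesis using ksum[of j] False fin i by (simp add: sum.remove[of I i])
  qed
  fix w g assume g: "g \<in> vecs w I X" and gy: "live w y \<longrightarrow> (\<Sum>r\<in>I. a r * g r) = 0"
  have gsup: "g r \<noteq> 0 \<Longrightarrow> r \<in> I \<and> live w (X r)" for r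
    using g by (simp add: vecs_def)
  define g' where "g' r = g r - (if live w (X r) then g i * c r else 0)" for r
  have g'i: "g' i = 0" using gsup[of i] c(2) by (auto simp: g'_def)
  have g': "g' \<in> vecs w (I - {i}) X"
    unfolding vecs_def
  proof (intro CollectI allI impI)
    fix r assume r: "g' r \<noteq> 0"
    then have "g r \<noteq> 0 \<or> c r \<noteq> 0 \<and> live w (X r)" by (auto simp: g'_def split: if_splits)
    then have "r \<in> I \<and> live w (X r)" using gsup csup by blast
    moreover have "r \<noteq> i" using r g'i by auto
    ultimately show "r \<in> I - {i} \<and> live w (X r)" by blast
  qed
  have "(\<Sum>r\<in>I - {i}. a r * g' r) = 0" if wy: "live w y"
  proof -
    have "(\<Sum>r\<in>I - {i}. a r * g' r) = (\<Sum>r\<in>I. a r * g' r)"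
      using g'i fin i by (simp add: sum.remove[of I i])
    also have "\<dots> = (\<Sum>r\<in>I. a r * g r - g i * (a r * c r))"
    proof (rule sum.cong)
      fix r assume r: "r \<in> I"
      have "live w (X r)" if "g i \<noteq> 0" "a r \<noteq> 0" "c r \<noteq> 0"
      proof (rule live_between(1)[OF wy])
        show "below (X r) y" using a r that live_below by blast
        show "below w (X r)" using gsup csup that live_below below_trans by blast
      qed
      then show "a r * g' r = a r * g r - g i * (a r * c r)"
        by (auto simp: g'_def algebra_simps)
    qed simp
    also have "\<dots> = (\<Sum>r\<in>I. a r * g r) - g i * (\<Sum>r\<in>I. a r * c r)"
      by (simp add: sum_subtractf sum_distrib_left)
    also have "\<dots> = - (g i * (\<Sum>r\<in>I. a r * c r))" using gy wy by simp
    also have "\<dots> = 0"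
    proof (rule ccontr)
      assume *: "- (g i * (\<Sum>r\<in>I. a r * c r)) \<noteq> 0"
      then have "(\<Sum>r\<in>I. a r * c r) \<noteq> 0" by auto
      then obtain r where r: "r \<in> I" "a r * c r \<noteq> 0" by (rule sum.not_neutral_contains_not_neutral)
      have "live (X i) y"
      proof (rule live_between(2)[OF wy])
        show "below w (X i)" using gsup[of i] * live_below by auto
        have "live (X i) (X r)" "live (X r) y" using r csup a by auto
        then show "below (X i) y" using live_below below_trans by blast
      qed
      then show False using c(3) * by simp
    qed
    finally show ?thesis .
  qed
  then have "\<exists>!h. h \<in> vecs w J Z \<and> solves w X J k g' h"
    by (rule row_kernelD[OF K g'])
  then obtain h where h: "h \<in> vecs w J Z" "solves w X J k g' h"
    and huniq: "\<And>h'. h' \<in> vecs w J Z \<Longrightarrow> solves w X J k g' h' \<Longrightarrow> h' = h"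
    by blast
  have sum_m: "(\<Sum>j\<in>?J. ?k r j * h' j) = c r * h' m + (\<Sum>j\<in>J. k r j * h' j)" for r h'
  proof -
    have "(\<Sum>j\<in>J. ?k r j * h' j) = (\<Sum>j\<in>J. k r j * h' j)"
      using m by (intro sum.cong) auto
    then show ?thesis using finJ m by simp
  qed
  have hm: "h m = 0" using h(1) m by (auto simp: vecs_def)
  have ki: "(\<Sum>j\<in>J. k i j * h' j) = 0" for h'
    using ksup by (intro sum.neutral) force
  show "\<exists>!h. h \<in> vecs w ?J ?Z \<and> solves w X ?J ?k g h"
  proof (rule ex1I[of _ "h(m := g i)"], intro conjI)
    show "h(m := g i) \<in> vecs w ?J ?Z"
      using h(1) gsup by (auto simp: vecs_def)
    have same: "(\<Sum>j\<in>J. k r j * (h(m := g i)) j) = (\<Sum>j\<in>J. k r j * h j)" for r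
      using m by (intro sum.cong) auto
    show "solves w X ?J ?k g (h(m := g i))"
      unfolding solves_def sum_m same
    proof
      fix r
      have "(if live w (X r) then \<Sum>j\<in>J. k r j * h j else 0) = g' r"
        using h(2) by (simp add: solves_def)
      then show "(if live w (X r) then c r * (h(m := g i)) m + (\<Sum>j\<in>J. k r j * h j) else 0) = g r"
        by (auto simp: g'_def)
    qed
  next
    fix h' assume h': "h' \<in> vecs w ?J ?Z \<and> solves w X ?J ?k g h'"
    then have eq: "(if live w (X r) then c r * h' m + (\<Sum>j\<in>J. k r j * h' j) else 0) = g r" for r
      unfolding solves_def sum_m by blast
    have h'm: "h' m = g i"
    proof (cases "live w (X i)")
      case True
      then show ?thesis using eq[of i] c(2) ki by simp
    next
      case False
      then have "h' m = 0" using h' unfolding vecs_def by (auto dest: spec[of _ m])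
      then show ?thesis using False gsup[of i] by auto
    qed
    have "h'(m := 0) = h"
    proof (rule huniq)
      show "h'(m := 0) \<in> vecs w J Z" using h' by (auto simp: vecs_def split: if_splits)
      have same: "(\<Sum>j\<in>J. k r j * (h'(m := 0)) j) = (\<Sum>j\<in>J. k r j * h' j)" for r
        using m by (intro sum.cong) auto
      show "solves w X J k g' (h'(m := 0))"
        unfolding solves_def same
      proof
        fix r
        show "(if live w (X r) then \<Sum>j\<in>J. k r j * h' j else 0) = g' r"
          using eq[of r] h'm by (auto simp: g'_def algebra_simps split: if_splits)
      qed
    qed
    then show "h' = h(m := g i)" using h'm by auto
  qed
qed

text \<open>
  If no point that survives to \<open>y\<close> reaches both halves of the row, then the relation imposed by the row
  is a relation on one half only, so the kernel is the sum of the kernels of the halves.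
\<close>

lemma row_kernel_union:
  assumes fin: "finite I1" "finite I2" and dis: "I1 \<inter> I2 = {}"
    and K1: "row_kernel I1 X y a J1 Z1 k1" and K2: "row_kernel I2 X y a J2 Z2 k2"
    and dec: "\<And>w i1 i2. live w y \<Longrightarrow> i1 \<in> I1 \<Longrightarrow> i2 \<in> I2 \<Longrightarrow> live w (X i1) \<Longrightarrow> live w (X i2) \<Longrightarrow> False"
  shows "\<exists>J Z k. row_kernel (I1 \<union> I2) X y a J Z k"
proof -
  have F: "finite J1" "finite J2" using K1 K2 row_kernel_def by blast+
  have s1: "k1 r j \<noteq> 0 \<Longrightarrow> r \<in> I1 \<and> j \<in> J1 \<and> live (Z1 j) (X r)" for r j
    using K1 unfolding row_kernel_def by blast
  have s2: "k2 r j \<noteq> 0 \<Longrightarrow> r \<in> I2 \<and> j \<in> J2 \<and> live (Z2 j) (X r)" for r j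
    using K2 unfolding row_kernel_def by blast
  \<comment> \<open>Even and odd indices keep the summands of the two kernels apart.\<close>
  define e o' where "e j = 2 * j" and "o' j = 2 * j + 1" for j :: nat
  define J where "J = e ` J1 \<union> o' ` J2"
  define Z where "Z j = (if even j then Z1 (j div 2) else Z2 (j div 2))" for j
  define k where "k r j = (if even j then k1 r (j div 2) else k2 r (j div 2))" for r j
  have [simp]: "Z (e j) = Z1 j" "Z (o' j) = Z2 j" "k r (e j) = k1 r j" "k r (o' j) = k2 r j" for j r
    by (simp_all add: Z_def k_def e_def o'_def)
  have inj: "inj_on e A" "inj_on o' A" for A by (simp_all add: inj_on_def e_def o'_def)
  have eo: "e i \<noteq> o' j" for i j unfolding e_def o'_def by presburger
  have cases: "(\<exists>i. j = e i) \<or> (\<exists>i. j = o' i)" for j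
    unfolding e_def o'_def by presburger
  have all_nat: "(\<forall>j. P j) \<longleftrightarrow> (\<forall>i. P (e i)) \<and> (\<forall>i. P (o' i))" for P
    using cases by metis
  have mem: "e j \<in> J \<longleftrightarrow> j \<in> J1" "o' j \<in> J \<longleftrightarrow> j \<in> J2" for j
    using eo eo[symmetric] unfolding J_def by (auto simp: e_def o'_def)
  have sumJ: "(\<Sum>j\<in>J. f j) = (\<Sum>j\<in>J1. f (e j)) + (\<Sum>j\<in>J2. f (o' j))" for f :: "nat \<Rightarrow> 'a"
  proof -
    have "e ` J1 \<inter> o' ` J2 = {}" using eo by auto
    then have "(\<Sum>j\<in>J. f j) = (\<Sum>j\<in>e ` J1. f j) + (\<Sum>j\<in>o' ` J2. f j)"
      unfolding J_def using F by (intro sum.union_disjoint) auto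
    then show ?thesis by (simp add: sum.reindex[OF inj(1)] sum.reindex[OF inj(2)])
  qed
  have sumI: "(\<Sum>r\<in>I1 \<union> I2. f r) = (\<Sum>r\<in>I1. f r) + (\<Sum>r\<in>I2. f r)" for f :: "nat \<Rightarrow> 'a"
    using fin dis by (rule sum.union_disjoint)
  have "row_kernel (I1 \<union> I2) X y a J Z k"
    unfolding row_kernel_def
  proof (intro conjI ballI allI impI)
    show "finite J" using F by (simp add: J_def)
    show "live (Z j) (Z j)" if "j \<in> J" for j
      using that K1 K2 unfolding J_def row_kernel_def by auto
    show "r \<in> I1 \<union> I2" "j \<in> J" "live (Z j) (X r)" if "k r j \<noteq> 0" for r j
      using cases[of j] that s1 s2 mem by auto
    show "(\<Sum>r\<in>I1 \<union> I2. a r * k r j) = 0" if "j \<in> J" "live (Z j) y" for j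
    proof -
      have "(\<Sum>r\<in>I1. a r * k2 r i) = 0" "(\<Sum>r\<in>I2. a r * k1 r i) = 0" for i
        using s1 s2 dis by (metis (no_types, lifting) sum.neutral disjoint_iff mult_zero_right)+
      then show ?thesis
        using cases[of j] that K1 K2 by (auto simp: sumI mem row_kernel_def)
    qed
    fix w g assume g: "g \<in> vecs w (I1 \<union> I2) X" and gy: "live w y \<longrightarrow> (\<Sum>r\<in>I1 \<union> I2. a r * g r) = 0"
    define g1 g2 where "g1 r = (if r \<in> I1 then g r else 0)" and "g2 r = (if r \<in> I2 then g r else 0)" for r
    have gg: "g r = g1 r + g2 r" for r
      using g dis by (auto simp: g1_def g2_def vecs_def)
    have gv: "g1 \<in> vecs w I1 X" "g2 \<in> vecs w I2 X"
      using g by (auto simp: vecs_def g1_def g2_def)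
    have S: "(\<Sum>r\<in>I1. a r * g r) = (\<Sum>r\<in>I1. a r * g1 r)" "(\<Sum>r\<in>I2. a r * g r) = (\<Sum>r\<in>I2. a r * g2 r)"
      by (simp_all add: g1_def g2_def)
    have "(\<Sum>r\<in>I1. a r * g1 r) = 0 \<and> (\<Sum>r\<in>I2. a r * g2 r) = 0" if wy: "live w y"
    proof (cases "\<exists>r\<in>I1. live w (X r)")
      case True
      then have "g2 = (\<lambda>r. 0)" using gv(2) dec[OF wy] by (auto simp: vecs_def fun_eq_iff)
      then show ?thesis using gy wy by (simp add: sumI S)
    next
      case False
      then have "g1 = (\<lambda>r. 0)" using gv(1) by (auto simp: vecs_def fun_eq_iff)
      then show ?thesis using gy wy by (simp add: sumI S)
    qed
    then have "\<exists>!h. h \<in> vecs w J1 Z1 \<and> solves w X J1 k1 g1 h" "\<exists>!h. h \<in> vecs w J2 Z2 \<and> solves w X J2 k2 g2 h"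
      using row_kernelD[OF K1 gv(1)] row_kernelD[OF K2 gv(2)] by simp_all
    then obtain h1 h2 where h1: "h1 \<in> vecs w J1 Z1" "solves w X J1 k1 g1 h1"
      and u1: "\<And>h'. h' \<in> vecs w J1 Z1 \<Longrightarrow> solves w X J1 k1 g1 h' \<Longrightarrow> h' = h1"
      and h2: "h2 \<in> vecs w J2 Z2" "solves w X J2 k2 g2 h2"
      and u2: "\<And>h'. h' \<in> vecs w J2 Z2 \<Longrightarrow> solves w X J2 k2 g2 h' \<Longrightarrow> h' = h2"
      by metis
    have parts: "h \<in> vecs w J Z \<and> solves w X J k g h \<longleftrightarrow>
        (h \<circ> e \<in> vecs w J1 Z1 \<and> solves w X J1 k1 g1 (h \<circ> e)) \<and>
        (h \<circ> o' \<in> vecs w J2 Z2 \<and> solves w X J2 k2 g2 (h \<circ> o'))" for h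
    proof -
      have V: "h \<in> vecs w J Z \<longleftrightarrow> h \<circ> e \<in> vecs w J1 Z1 \<and> h \<circ> o' \<in> vecs w J2 Z2"
        unfolding vecs_def mem_Collect_eq all_nat[of "\<lambda>j. h j \<noteq> 0 \<longrightarrow> j \<in> J \<and> live w (Z j)"]
        by (simp add: mem)
      have z1: "r \<notin> I1 \<Longrightarrow> (\<Sum>j\<in>J1. k1 r j * h' j) = 0" for r h'
        using s1 by (intro sum.neutral) force
      have z2: "r \<notin> I2 \<Longrightarrow> (\<Sum>j\<in>J2. k2 r j * h' j) = 0" for r h'
        using s2 by (intro sum.neutral) force
      have "(if live w (X r) then \<Sum>j\<in>J. k r j * h j else 0) = g r \<longleftrightarrow>
         (if live w (X r) then \<Sum>j\<in>J1. k1 r j * (h \<circ> e) j else 0) = g1 r \<and>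
         (if live w (X r) then \<Sum>j\<in>J2. k2 r j * (h \<circ> o') j else 0) = g2 r" for r
      proof -
        define A B where "A = (\<Sum>j\<in>J1. k1 r j * (h \<circ> e) j)" and "B = (\<Sum>j\<in>J2. k2 r j * (h \<circ> o') j)"
        have S: "(\<Sum>j\<in>J. k r j * h j) = A + B" by (simp add: sumJ A_def B_def)
        have "r \<notin> I1 \<and> A = 0 \<and> g1 r = 0 \<or> r \<notin> I2 \<and> B = 0 \<and> g2 r = 0"
          using z1[of r "h \<circ> e"] z2[of r "h \<circ> o'"] dis by (auto simp: A_def B_def g1_def g2_def)
        then show ?thesis
          unfolding A_def[symmetric] B_def[symmetric] S gg[of r] by auto
      qed
      then have "solves w X J k g h \<longleftrightarrow> solves w X J1 k1 g1 (h \<circ> e) \<and> solves w X J2 k2 g2 (h \<circ> o')"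
        unfolding solves_def by blast
      then show ?thesis using V by blast
    qed
    define h where "h j = (if even j then h1 (j div 2) else h2 (j div 2))" for j
    have he: "h \<circ> e = h1" "h \<circ> o' = h2" by (auto simp: h_def e_def o'_def fun_eq_iff)
    show "\<exists>!h. h \<in> vecs w J Z \<and> solves w X J k g h"
    proof (rule ex1I[of _ h])
      show "h \<in> vecs w J Z \<and> solves w X J k g h" unfolding parts he using h1 h2 by blast
      fix h' assume "h' \<in> vecs w J Z \<and> solves w X J k g h'"
      then have "h' \<circ> e = h1" "h' \<circ> o' = h2" using parts u1 u2 by blast+
      then have "h' \<circ> e = h \<circ> e" "h' \<circ> o' = h \<circ> o'" using he by auto
      then show "h' = h" using all_nat[of "\<lambda>j. h' j = h j"] by (simp add: fun_eq_iff)
    qed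
  qed
  then show ?thesis by blast
qed

lemma row_kernel_reindex:
  assumes bij: "bij_betw s I' I" and K: "row_kernel I' (X \<circ> s) y (a \<circ> s) J Z k"
  shows "\<exists>k. row_kernel I X y a J Z k"
proof -
  define t where "t = inv_into I' s"
  have st: "i \<in> I \<Longrightarrow> t i \<in> I' \<and> s (t i) = i" "r \<in> I' \<Longrightarrow> s r \<in> I \<and> t (s r) = r" for i r
    using bij unfolding t_def bij_betw_def by (auto simp: inv_into_into f_inv_into_f)
  define k' where "k' i j = (if i \<in> I then k (t i) j else 0)" for i j
  have sumI: "(\<Sum>i\<in>I. f i) = (\<Sum>r\<in>I'. f (s r))" for f :: "nat \<Rightarrow> 'a"
    using sum.reindex_bij_betw[OF bij] by metis
  have ks: "k r j \<noteq> 0 \<Longrightarrow> r \<in> I' \<and> j \<in> J \<and> live (Z j) (X (s r))" for r j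
    using K unfolding row_kernel_def by auto
  have "row_kernel I X y a J Z k'"
    unfolding row_kernel_def
  proof (intro conjI ballI allI impI)
    show "finite J" using K row_kernel_def by blast
    show "live (Z j) (Z j)" if "j \<in> J" for j using that K unfolding row_kernel_def by blast
    show "i \<in> I" "j \<in> J" "live (Z j) (X i)" if "k' i j \<noteq> 0" for i j
      using that ks[of "t i" j] st by (auto simp: k'_def split: if_splits)
    show "(\<Sum>i\<in>I. a i * k' i j) = 0" if "j \<in> J" "live (Z j) y" for j
    proof -
      have "(\<Sum>r\<in>I'. (a \<circ> s) r * k r j) = 0" using K that unfolding row_kernel_def by blast
      then show ?thesis unfolding sumI k'_def using st by simp
    qed
    fix w g assume g: "g \<in> vecs w I X" and gy: "live w y \<longrightarrow> (\<Sum>i\<in>I. a i * g i) = 0"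
    define g' where "g' r = (if r \<in> I' then g (s r) else 0)" for r
    have "g' \<in> vecs w I' (X \<circ> s)" using g by (auto simp: vecs_def g'_def)
    moreover have "live w y \<longrightarrow> (\<Sum>r\<in>I'. (a \<circ> s) r * g' r) = 0"
      using gy unfolding sumI by (simp add: g'_def)
    ultimately have ex: "\<exists>!h. h \<in> vecs w J Z \<and> solves w (X \<circ> s) J k g' h"
      using row_kernelD[OF K] by blast
    have "solves w (X \<circ> s) J k g' h \<longleftrightarrow> solves w X J k' g h" for h
    proof
      assume h: "solves w (X \<circ> s) J k g' h"
      show "solves w X J k' g h"
        unfolding solves_def
      proof
        fix i
        show "(if live w (X i) then \<Sum>j\<in>J. k' i j * h j else 0) = g i"
        proof (cases "i \<in> I")
          case True
          then show ?thesis using h[unfolded solves_def, rule_format, of "t i"] st(1)[OF True] True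
            by (auto simp: k'_def g'_def split: if_splits)
        next
          case False
          then show ?thesis using g by (auto simp: k'_def vecs_def)
        qed
      qed
    next
      assume h: "solves w X J k' g h"
      show "solves w (X \<circ> s) J k g' h"
        unfolding solves_def
      proof
        fix r
        show "(if live w ((X \<circ> s) r) then \<Sum>j\<in>J. k r j * h j else 0) = g' r"
        proof (cases "r \<in> I'")
          case True
          then show ?thesis using h[unfolded solves_def, rule_format, of "s r"] st(2)[OF True] True
            by (auto simp: k'_def g'_def split: if_splits)
        next
          case False
          then have "k r j = 0" for j using ks by blast
          then show ?thesis using False by (simp add: g'_def)
        qed
      qed
    qed
    then show "\<exists>!h. h \<in> vecs w J Z \<and> solves w X J k' g h" using ex by simp
  qed
  then show ?thesis by blast
qed

text \<open>
  The largest point to the lower left of both \<open>p\<close> and \<open>q\<close>, if \<open>q\<close> is to the lower right of \<open>p\<close>.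
\<close>

definition corner :: "point \<Rightarrow> point \<Rightarrow> point" where
  "corner p q = (fst p, snd q)"

text \<open>
  The points \<open>X p, \<dots>, X q\<close> descend to the right like a staircase, and the corners between neighbours
  survive to \<open>y\<close>. The kernel is the sum of these corners, each mapped to the difference of its neighbours,
  and of the objects of \<open>upper_end\<close> for \<open>X p\<close> and of \<open>lower_end\<close> for \<open>X q\<close>. To see this, test with a point
  \<open>w\<close>. If \<open>w\<close> survives to \<open>y\<close>, it reaches the points in an interval of indices and exactly the corners
  between them, and the kernel condition is that a telescoping sum vanishes. If it does not survive, there is no condition
  on the vectors; the side on which a reached point sees its holes then matches it with the corner on this side,
  so the coordinates are given by the solution for an alternating path.
\<close>

lemma row_kernel_linked_chain:
  fixes a :: "nat \<Rightarrow> 'k::field"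
  assumes p: "1 \<le> p" "p \<le> q"
    and a: "\<And>i. i \<in> {p..q} \<Longrightarrow> a i \<noteq> 0" and Xy: "\<And>i. i \<in> {p..q} \<Longrightarrow> live (X i) y"
    and mono: "\<And>i j. p \<le> i \<Longrightarrow> i < j \<Longrightarrow> j \<le> q \<Longrightarrow> fst (X i) < fst (X j) \<and> snd (X j) < snd (X i)"
    and link: "\<And>i. i \<in> {p..<q} \<Longrightarrow> live (corner (X i) (X (Suc i))) y"
  shows "\<exists>J Z k. row_kernel {p..q} X y a J Z k"
proof -
  define EU where "EU z \<longleftrightarrow> live z (X p) \<and> (\<forall>w. live w z \<longleftrightarrow> live w (X p) \<and> hole_upper w (X p) y)" for z
  define EL where "EL z \<longleftrightarrow> live z (X q) \<and> (\<forall>w. live w z \<longleftrightarrow> live w (X q) \<and> hole_lower w (X q) y)" for z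
  have EUd: "EU z \<Longrightarrow> live w z \<longleftrightarrow> live w (X p) \<and> hole_upper w (X p) y" for z w
    unfolding EU_def by blast
  have ELd: "EL z \<Longrightarrow> live w z \<longleftrightarrow> live w (X q) \<and> hole_lower w (X q) y" for z w
    unfolding EL_def by blast
  have EUx: "(\<forall>w. \<not> (live w (X p) \<and> hole_upper w (X p) y)) \<or> (\<exists>z. EU z)"
    using upper_end[OF Xy[of p]] p unfolding EU_def by simp
  have ELx: "(\<forall>w. \<not> (live w (X q) \<and> hole_lower w (X q) y)) \<or> (\<exists>z. EL z)"
    using lower_end[OF Xy[of q]] p unfolding EL_def by simp
  \<comment> \<open>The end objects exist only if some morphism dies by a hole on the outer side. The corner between
    \<open>X j\<close> and \<open>X (Suc j)\<close> has index \<open>j\<close>, so the ends take the indices \<open>p - 1\<close> and \<open>q\<close>; \<open>p \<ge> 1\<close> leaves room.\<close>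
  define J where "J = {p..<q} \<union> {j. j = p - 1 \<and> (\<exists>z. EU z)} \<union> {j. j = q \<and> (\<exists>z. EL z)}"
  define Z where "Z j = (if j = p - 1 then SOME z. EU z else if j = q then SOME z. EL z
      else corner (X j) (X (Suc j)))" for j
  \<comment> \<open>The scalars are such that \<open>a i * k i j\<close> is \<open>1\<close> for \<open>i = j\<close> and \<open>- 1\<close> for \<open>i = Suc j\<close>.\<close>
  define k where "k i j = (if i \<in> {p..q} \<and> j \<in> J then
      (if j = i then 1 / a i else 0) - (if j = i - 1 then 1 / a i else 0) else 0)" for i j
  have finJ: "finite J" unfolding J_def by simp
  have Zmid: "Z j = corner (X j) (X (Suc j))" "j \<in> J" if "j \<in> {p..<q}" for j
  proof -
    have "j \<noteq> p - 1" "j \<noteq> q" using that p by auto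
    then show "Z j = corner (X j) (X (Suc j))" by (simp add: Z_def)
    show "j \<in> J" using that unfolding J_def by blast
  qed
  have Jcases: thesis if jJ: "j \<in> J" and cases:
    "j = p - 1 \<Longrightarrow> EU (Z j) \<Longrightarrow> thesis" "j = q \<Longrightarrow> EL (Z j) \<Longrightarrow> thesis"
    "j \<in> {p..<q} \<Longrightarrow> Z j = corner (X j) (X (Suc j)) \<Longrightarrow> thesis" for j thesis
  proof -
    consider "j = p - 1" "\<exists>z. EU z" | "j = q" "\<exists>z. EL z" | "j \<in> {p..<q}"
      using jJ unfolding J_def by blast
    then show thesis
    proof cases
      case 1
      then show ?thesis using cases(1) unfolding Z_def by (simp add: someI_ex)
    next
      case 2
      moreover have "q \<noteq> p - 1" using p by auto
      ultimately have "Z j = (SOME z. EL z)" by (simp add: Z_def)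
      then show ?thesis using cases(2)[OF 2(1)] someI_ex[OF 2(2)] by simp
    next
      case 3
      then show ?thesis using cases(3) Zmid(1) by blast
    qed
  qed
  have ZU: "p - 1 \<in> J \<and> EU (Z (p - 1))" if "\<exists>z. EU z"
    using that someI_ex[OF that] unfolding J_def Z_def by simp
  have ZL: "q \<in> J \<and> EL (Z q)" if "\<exists>z. EL z"
    using that someI_ex[OF that] p unfolding J_def Z_def by auto
  have between: "below (corner (X j) (X (Suc j))) (X j)" "below (corner (X j) (X (Suc j))) (X (Suc j))"
    if "j \<in> {p..<q}" for j
    using mono[of j "Suc j"] that by (auto simp: corner_def below_def)
  have endU_not: "\<not> live w y" if "EU z" "live w z" for w z
    using that hole_not_live unfolding EU_def by blast
  have endL_not: "\<not> live w y" if "EL z" "live w z" for w z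
    using that hole_not_live unfolding EL_def by blast
  have below_y: "below (X i) y" if "i \<in> {p..q}" for i using Xy[OF that] live_below by blast
  have Z_X: "live (Z j) (X i)" if "j \<in> J" "i \<in> {p..q}" "j = i \<or> j = i - 1" for i j
    using that(1)
  proof (rule Jcases)
    assume "j = p - 1" "EU (Z j)"
    moreover have "i = p" using that p \<open>j = p - 1\<close> by auto
    ultimately show ?thesis by (simp add: EU_def)
  next
    assume "j = q" "EL (Z j)"
    moreover have "i = q" using that p \<open>j = q\<close> by auto
    ultimately show ?thesis by (simp add: EL_def)
  next
    assume j: "j \<in> {p..<q}" "Z j = corner (X j) (X (Suc j))"
    then have "i = j \<or> i = Suc j" using that p by auto
    then have "below (Z j) (X i)" using between[OF j(1)] j(2) by auto
    then show ?thesis using live_between(1)[OF link[OF j(1)]] j(2) below_y[OF that(2)] by simp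
  qed
  have ksum: "(\<Sum>j\<in>J. k i j * h j) = (h i - h (i - 1)) / a i"
    if i: "i \<in> {p..q}" and h: "\<And>j. h j \<noteq> 0 \<Longrightarrow> j \<in> J" for i h
  proof -
    have "(\<Sum>j\<in>J. k i j * h j) = (\<Sum>j\<in>J. (if i = j then h j / a i else 0) - (if i - 1 = j then h j / a i else 0))"
      using i by (intro sum.cong) (auto simp: k_def algebra_simps)
    also have "\<dots> = (if i \<in> J then h i / a i else 0) - (if i - 1 \<in> J then h (i - 1) / a i else 0)"
      using finJ by (simp add: sum_subtractf)
    also have "\<dots> = (h i - h (i - 1)) / a i"
    proof -
      have "i \<notin> J \<Longrightarrow> h i = 0" "i - 1 \<notin> J \<Longrightarrow> h (i - 1) = 0" using h by blast+
      then show ?thesis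
        by (cases "i \<in> J"; cases "i - 1 \<in> J") (simp_all add: diff_divide_distrib)
    qed
    finally show ?thesis .
  qed
  have "row_kernel {p..q} X y a J Z k"
    unfolding row_kernel_def
  proof (intro conjI ballI allI impI)
    show "finite J" by (rule finJ)
    show "live (Z j) (Z j)" if "j \<in> J" for j
      using that
    proof (rule Jcases)
      assume "EU (Z j)" then show ?thesis using live_self unfolding EU_def by blast
    next
      assume "EL (Z j)" then show ?thesis using live_self unfolding EL_def by blast
    next
      assume "j \<in> {p..<q}" "Z j = corner (X j) (X (Suc j))"
      then show ?thesis using live_self(1)[OF link] by simp
    qed
    show "i \<in> {p..q}" "j \<in> J" "live (Z j) (X i)" if "k i j \<noteq> 0" for i j
      using that Z_X[of j i] by (auto simp: k_def split: if_splits)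
    show "(\<Sum>i\<in>{p..q}. a i * k i j) = 0" if "j \<in> J" "live (Z j) y" for j
      using that(1)
    proof (rule Jcases)
      assume "EU (Z j)"
      then have "live (Z j) (Z j)" using live_self unfolding EU_def by blast
      then show ?thesis using endU_not \<open>EU (Z j)\<close> that by blast
    next
      assume "EL (Z j)"
      then have "live (Z j) (Z j)" using live_self unfolding EL_def by blast
      then show ?thesis using endL_not \<open>EL (Z j)\<close> that by blast
    next
      assume j: "j \<in> {p..<q}"
      have "(\<Sum>i\<in>{p..q}. a i * k i j) = (\<Sum>i\<in>{p..q}. (if j = i then 1 else 0) - (if Suc j = i then 1 else 0))"
        using that(1) p a by (intro sum.cong) (auto simp: k_def)
      also have "\<dots> = 0" using j by (simp add: sum_subtractf)
      finally show ?thesis .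
    qed
    fix w g assume g: "g \<in> vecs w {p..q} X" and gy: "live w y \<longrightarrow> (\<Sum>i\<in>{p..q}. a i * g i) = 0"
    define I where "I = {i\<in>{p..q}. live w (X i)}"
    define Jw where "Jw = {j\<in>J. live w (Z j)}"
    have I: "finite I" "0 \<notin> I" using p by (auto simp: I_def)
    have gI: "g i = 0" if "i \<notin> I" for i using g that by (auto simp: vecs_def I_def)
    have vec_iff: "h \<in> vecs w J Z \<longleftrightarrow> (\<forall>j. h j \<noteq> 0 \<longrightarrow> j \<in> Jw)" for h :: "nat \<Rightarrow> 'k"
      by (auto simp: vecs_def Jw_def)
    have solves_iff: "solves w X J k g h \<longleftrightarrow> (\<forall>i\<in>I. h i - h (i - 1) = a i * g i)"
      if h: "h \<in> vecs w J Z" for h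
    proof -
      have "(if live w (X i) then \<Sum>j\<in>J. k i j * h j else 0) = g i \<longleftrightarrow>
          (i \<in> I \<longrightarrow> h i - h (i - 1) = a i * g i)" for i
      proof (cases "i \<in> I")
        case True
        then have i: "i \<in> {p..q}" "live w (X i)" by (auto simp: I_def)
        have "(\<Sum>j\<in>J. k i j * h j) = (h i - h (i - 1)) / a i"
          using ksum[OF i(1)] h by (auto simp: vecs_def)
        then show ?thesis using i True a[OF i(1)] by (auto simp: field_simps)
      next
        case False
        then show ?thesis using gI[OF False] by (auto simp: I_def k_def)
      qed
      then show ?thesis unfolding solves_def by blast
    qed
    have "\<exists>!h. (\<forall>j. h j \<noteq> 0 \<longrightarrow> j \<in> Jw) \<and> (\<forall>i\<in>I. h i - h (i - 1) = a i * g i)"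
    proof (cases "live w y")
      case False
      define L where "L = {i\<in>I. hole_lower w (X i) y}"
      have up: "hole_upper w (X i) y" if "i \<in> I - L" for i
        using that some_hole[of w "X i" y] False Xy by (auto simp: I_def L_def)
      show ?thesis
      proof (rule alternating_path_solution[OF I, of L])
        show "L \<subseteq> I" by (auto simp: L_def)
      next
        fix i assume "i \<in> L"
        then have i: "i \<in> {p..q}" "live w (X i)" "hole_lower w (X i) y" by (auto simp: L_def I_def)
        show "i \<in> Jw"
        proof (cases "i = q")
          case True
          then have "\<exists>z. EL z" using ELx i by blast
          then show ?thesis using ZL i True unfolding Jw_def EL_def by blast
        next
          case False
          then have i': "i \<in> {p..<q}" using i by auto
          have "live w (corner (X i) (X (Suc i)))"
            using lower_hole_extends[OF i(2,3) link[OF i'] between(1)[OF i']] by (simp add: corner_def)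
          then show ?thesis using Zmid[OF i'] unfolding Jw_def by simp
        qed
      next
        fix j assume j: "Suc j \<in> I - L"
        then have i: "Suc j \<in> {p..q}" "live w (X (Suc j))" "hole_upper w (X (Suc j)) y"
          using up by (auto simp: I_def)
        show "j \<in> Jw"
        proof (cases "Suc j = p")
          case True
          then have w: "live w (X p)" "hole_upper w (X p) y" "p - 1 = j" using i(2,3) by auto
          then have "\<exists>z. EU z" using EUx by blast
          then have "p - 1 \<in> J" "live w (Z (p - 1))" using ZU w(1,2) unfolding EU_def by blast+
          then show ?thesis using w(3) by (simp add: Jw_def)
        next
          case False
          then have i': "j \<in> {p..<q}" using i by auto
          have "live w (corner (X j) (X (Suc j)))"
            using upper_hole_extends[OF i(2,3) link[OF i'] between(2)[OF i']] by (simp add: corner_def)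
          then show ?thesis using Zmid[OF i'] unfolding Jw_def by simp
        qed
      next
        fix j assume j: "j \<in> Jw"
        then have wz: "live w (Z j)" "j \<in> J" by (auto simp: Jw_def)
        from wz(2) show "j \<in> L \<or> Suc j \<in> I - L"
        proof (rule Jcases)
          assume "j = p - 1" "EU (Z j)"
          then have "Suc j = p" "live w (X p)" "hole_upper w (X p) y"
            using wz(1) p EUd by auto
          then show ?thesis
            using not_both_holes[of w "X p" y] Xy[of p] p by (auto simp: L_def I_def)
        next
          assume "j = q" "EL (Z j)"
          then show ?thesis using wz(1) p ELd by (auto simp: L_def I_def)
        next
          assume j: "j \<in> {p..<q}" "Z j = corner (X j) (X (Suc j))"
          let ?z = "corner (X j) (X (Suc j))"
          have z: "live w ?z" "live ?z y" using wz j link by auto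
          have Xs: "live (X j) y" "live (X (Suc j)) y" using Xy j by auto
          have fs: "snd ?z = snd (X (Suc j))" "fst ?z = fst (X j)" by (simp_all add: corner_def)
          show ?thesis
          proof (cases "hole_lower w ?z y")
            case True
            then have nU: "\<not> hole_upper w ?z y" using not_both_holes[OF z] by blast
            note lower_hole_restricts[OF z nU False Xs(1) between(1)[OF j(1)] fs(2)]
            then show ?thesis using j by (auto simp: L_def I_def)
          next
            case nL: False
            note upper_hole_restricts[OF z nL False Xs(2) between(2)[OF j(1)] fs(1)]
            moreover from this have "\<not> hole_lower w (X (Suc j)) y"
              using not_both_holes Xs by blast
            ultimately show ?thesis using j by (auto simp: L_def I_def)
          qed
        qed
      next
        fix j assume j: "j \<in> L" "Suc j \<in> I - L"
        then have j': "j \<in> {p..<q}" by (auto simp: L_def I_def)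
        obtain t where t: "t \<in> lifts_T" "below w t" "below t y" "fst (X j) < fst t" "snd t < snd (X j)"
          using j(1) unfolding L_def hole_lower_def by blast
        have s: "live w (X (Suc j))" "live (X (Suc j)) y" "\<not> hole_lower w (X (Suc j)) y"
          using j Xy by (auto simp: L_def I_def)
        have "\<not> below t (X (Suc j))" "\<not> below (X (Suc j)) t" using t s by (auto simp: live_def)
        moreover have "\<not> (fst (X (Suc j)) < fst t \<and> snd t < snd (X (Suc j)))"
          using s(3) t unfolding hole_lower_def by blast
        ultimately have "below (corner (X j) (X (Suc j))) t"
          using t by (auto simp: below_def corner_def)
        then show False using link[OF j'] t by (auto simp: live_def)
      qed
    next
      case wy: True
      have Jw: "j \<in> {p..<q} \<and> j \<in> I \<and> Suc j \<in> I" if "j \<in> Jw" for j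
      proof -
        have wz: "live w (Z j)" "j \<in> J" using that by (auto simp: Jw_def)
        from wz(2) show ?thesis
        proof (rule Jcases)
          assume "EU (Z j)" then show ?thesis using endU_not wz wy by blast
        next
          assume "EL (Z j)" then show ?thesis using endL_not wz wy by blast
        next
          assume j: "j \<in> {p..<q}" "Z j = corner (X j) (X (Suc j))"
          have "below w (X j)" "below w (X (Suc j))"
            using live_below[OF wz(1)] between[OF j(1)] j(2) below_trans by auto
          then have "live w (X j)" "live w (X (Suc j))"
            using live_between(1)[OF wy] below_y j by auto
          then show ?thesis using j by (auto simp: I_def)
        qed
      qed
      define m where "m = Max I"
      have mI: "m \<in> I" "\<And>i. i \<in> I \<Longrightarrow> i \<le> m" if "I \<noteq> {}"
        unfolding m_def using I that by auto
      \<comment> \<open>There is one equation more than unknowns; that for the last index \<open>m\<close> follows from the others,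
        because both sides have the same sum.\<close>
      have "\<exists>!h. (\<forall>j. h j \<noteq> 0 \<longrightarrow> j \<in> Jw) \<and> (\<forall>i\<in>I - {m}. h i - h (i - 1) = a i * g i)"
      proof (rule alternating_path_solution[where L = "I - {m}"])
        fix i assume i: "i \<in> I - {m}"
        then have im: "i < m" "m \<in> I" using mI by (auto simp: order_less_le)
        then have i': "i \<in> {p..<q}" "Suc i \<le> m" "m \<le> q" using i by (auto simp: I_def)
        have "live w (X i)" "live w (X m)" using i im by (auto simp: I_def)
        then have "below w (X i)" "below w (X m)" using live_below by auto
        moreover have "snd (X m) \<le> snd (X (Suc i))"
          using mono[of "Suc i" m] i' by (cases "Suc i = m") auto
        ultimately have "below w (corner (X i) (X (Suc i)))"
          by (auto simp: below_def corner_def)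
        then have "live w (corner (X i) (X (Suc i)))"
          using live_between(1)[OF wy] live_below[OF link[OF i'(1)]] by blast
        then show "i \<in> Jw" using Zmid[OF i'(1)] unfolding Jw_def by simp
      next
        fix j assume j: "j \<in> Jw"
        then have "j \<in> I" "Suc j \<le> m" using Jw[OF j] mI by auto
        then show "j \<in> I - {m} \<or> Suc j \<in> I - {m} - (I - {m})" by auto
      qed (use I in auto)
      moreover have "h m - h (m - 1) = a m * g m"
        if "m \<in> I" and h: "\<forall>j. h j \<noteq> 0 \<longrightarrow> j \<in> Jw" and eq: "\<forall>i\<in>I - {m}. h i - h (i - 1) = a i * g i" for h
      proof -
        have s1: "(\<Sum>i\<in>I. h i) = (\<Sum>j\<in>Jw. h j)"
          using h Jw I by (intro sum.mono_neutral_right) auto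
        have "(\<Sum>i\<in>I. h (i - 1)) = (\<Sum>i\<in>Suc ` Jw. h (i - 1))"
        proof (rule sum.mono_neutral_right)
          show "\<forall>i\<in>I - Suc ` Jw. h (i - 1) = 0"
          proof (rule ballI, rule ccontr)
            fix i assume i: "i \<in> I - Suc ` Jw" "h (i - 1) \<noteq> 0"
            then have "i - 1 \<in> Jw" "i = Suc (i - 1)" using h I(2) by (auto intro: Suc_pred[symmetric] gr0I)
            then show False using i by blast
          qed
        qed (use Jw I in auto)
        also have "\<dots> = (\<Sum>j\<in>Jw. h j)" by (simp add: sum.reindex)
        finally have "(\<Sum>i\<in>I. h i - h (i - 1)) = 0" using s1 by (simp add: sum_subtractf)
        moreover have "(\<Sum>i\<in>I. a i * g i) = 0"
        proof -
          have "(\<Sum>i\<in>I. a i * g i) = (\<Sum>i\<in>{p..q}. a i * g i)"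
            using gI by (intro sum.mono_neutral_left) (auto simp: I_def)
          then show ?thesis using gy wy by simp
        qed
        moreover have "(\<Sum>i\<in>I - {m}. h i - h (i - 1)) = (\<Sum>i\<in>I - {m}. a i * g i)"
          using eq by (intro sum.cong) auto
        ultimately have "h m - h (m - 1) + (\<Sum>i\<in>I - {m}. a i * g i) = a m * g m + (\<Sum>i\<in>I - {m}. a i * g i)"
          using I that(1) by (simp add: sum.remove[of I m])
        then show ?thesis by (simp only: add_right_cancel)
      qed
      ultimately have eq: "(\<forall>j. h j \<noteq> 0 \<longrightarrow> j \<in> Jw) \<and> (\<forall>i\<in>I. h i - h (i - 1) = a i * g i) \<longleftrightarrow>
          (\<forall>j. h j \<noteq> 0 \<longrightarrow> j \<in> Jw) \<and> (\<forall>i\<in>I - {m}. h i - h (i - 1) = a i * g i)" for h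
        by (metis DiffI DiffD1 singletonD)
      show ?thesis unfolding eq by fact
    qed
    then show "\<exists>!h. h \<in> vecs w J Z \<and> solves w X J k g h"
    proof -
      have "h \<in> vecs w J Z \<and> solves w X J k g h \<longleftrightarrow>
          (\<forall>j. h j \<noteq> 0 \<longrightarrow> j \<in> Jw) \<and> (\<forall>i\<in>I. h i - h (i - 1) = a i * g i)" for h
        using solves_iff vec_iff by blast
      then show ?thesis using \<open>\<exists>!h. (\<forall>j. h j \<noteq> 0 \<longrightarrow> j \<in> Jw) \<and> (\<forall>i\<in>I. h i - h (i - 1) = a i * g i)\<close>
        by simp
    qed
  qed
  then show ?thesis by blast
qed

text \<open>
  Where a corner does not survive to \<open>y\<close>, the row is decoupled, since a point that survives to \<open>y\<close> and reaches both
  sides would be below the corner.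
\<close>

lemma row_kernel_chain:
  fixes a :: "nat \<Rightarrow> 'k::field"
  assumes "1 \<le> p"
    and a: "\<And>i. i \<in> {p..q} \<Longrightarrow> a i \<noteq> 0" and Xy: "\<And>i. i \<in> {p..q} \<Longrightarrow> live (X i) y"
    and mono: "\<And>i j. p \<le> i \<Longrightarrow> i < j \<Longrightarrow> j \<le> q \<Longrightarrow> fst (X i) < fst (X j) \<and> snd (X j) < snd (X i)"
  shows "\<exists>J Z k. row_kernel {p..q} X y a J Z k"
  using assms
proof (induction "Suc q - p" arbitrary: p q rule: less_induct)
  case less
  consider "q < p" | "p \<le> q" "\<forall>i\<in>{p..<q}. live (corner (X i) (X (Suc i))) y"
    | i where "i \<in> {p..<q}" "\<not> live (corner (X i) (X (Suc i))) y" by force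
  then show ?case
  proof cases
    case 1
    then have "{p..q} = {}" by simp
    then show ?thesis using row_kernel_empty by metis
  next
    case 2
    then show ?thesis using row_kernel_linked_chain[of p q a X y] less.prems by blast
  next
    case 3
    have "\<exists>J Z k. row_kernel {p..i} X y a J Z k"
      using 3 less.prems by (intro less.hyps) auto
    then obtain J1 Z1 k1 where K1: "row_kernel {p..i} X y a J1 Z1 k1" by blast
    have "\<exists>J Z k. row_kernel {Suc i..q} X y a J Z k"
      using 3 less.prems by (intro less.hyps) auto
    then obtain J2 Z2 k2 where K2: "row_kernel {Suc i..q} X y a J2 Z2 k2" by blast
    have "{p..q} = {p..i} \<union> {Suc i..q}" using 3 by auto
    moreover have "\<exists>J Z k. row_kernel ({p..i} \<union> {Suc i..q}) X y a J Z k"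
    proof (rule row_kernel_union[OF _ _ _ K1 K2])
      fix w i1 i2
      assume w: "live w y" "i1 \<in> {p..i}" "i2 \<in> {Suc i..q}" "live w (X i1)" "live w (X i2)"
      have "fst (X i1) \<le> fst (X i)" "snd (X i2) \<le> snd (X (Suc i))"
        using less.prems(4)[of i1 i] less.prems(4)[of "Suc i" i2] w 3
        by (cases "i1 = i"; cases "i2 = Suc i"; force)+
      then have "below w (corner (X i) (X (Suc i)))"
        using live_below[OF w(4)] live_below[OF w(5)] by (auto simp: below_def corner_def)
      moreover have "below (corner (X i) (X (Suc i))) y"
        using live_below[OF less.prems(3)[of i]] live_below[OF less.prems(3)[of "Suc i"]] 3
        by (auto simp: below_def corner_def)
      ultimately show False using live_between(2)[OF w(1)] 3 by blast
    qed auto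
    ultimately show ?thesis by simp
  qed
qed

text \<open>
  Incomparable points, ordered by their first coordinates, form a descending staircase.
\<close>

lemma row_kernel_antichain:
  fixes a :: "nat \<Rightarrow> 'k::field"
  assumes fin: "finite I"
    and a: "\<And>i. i \<in> I \<Longrightarrow> a i \<noteq> 0" and Xy: "\<And>i. i \<in> I \<Longrightarrow> live (X i) y"
    and anti: "\<And>i j. i \<in> I \<Longrightarrow> j \<in> I \<Longrightarrow> i \<noteq> j \<Longrightarrow> \<not> below (X i) (X j)"
  shows "\<exists>J Z k. row_kernel I X y a J Z k"
proof -
  let ?x = "\<lambda>i. fst (X i)"
  have inj: "inj_on ?x I"
  proof (rule inj_onI, rule ccontr)
    fix i j assume "i \<in> I" "j \<in> I" "?x i = ?x j" "i \<noteq> j"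
    then show False using anti[of i j] anti[of j i] by (auto simp: below_def)
  qed
  define xs where "xs = sorted_list_of_set (?x ` I)"
  have xs: "sorted_wrt (<) xs" "set xs = ?x ` I" "length xs = card I"
    unfolding xs_def using fin card_image[OF inj] by simp_all
  define s where "s n = inv_into I ?x (xs ! (n - 1))" for n
  have sI: "s n \<in> I" "?x (s n) = xs ! (n - 1)" if "n \<in> {1..card I}" for n
  proof -
    have "n - 1 < length xs" using that xs(3) by auto
    then have "xs ! (n - 1) \<in> ?x ` I" using xs(2) nth_mem by blast
    then show "s n \<in> I" "?x (s n) = xs ! (n - 1)"
      unfolding s_def by (auto intro: inv_into_into f_inv_into_f)
  qed
  have less: "?x (s i) < ?x (s j)" if "1 \<le> i" "i < j" "j \<le> card I" for i j
    using that sI(2)[of i] sI(2)[of j] xs(1,3) by (auto simp: sorted_wrt_iff_nth_less)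
  have "inj_on s {1..card I}"
    by (rule linorder_inj_onI) (use less in fastforce)+
  moreover have "s ` {1..card I} = I"
  proof (rule card_subset_eq[OF fin])
    show "s ` {1..card I} \<subseteq> I" using sI by blast
    show "card (s ` {1..card I}) = card I" using card_image[OF \<open>inj_on s {1..card I}\<close>] by simp
  qed
  ultimately have bij: "bij_betw s {1..card I} I" by (simp add: bij_betw_def)
  have "\<exists>J Z k. row_kernel {1..card I} (X \<circ> s) y (a \<circ> s) J Z k"
  proof (rule row_kernel_chain)
    fix i j assume ij: "1 \<le> i" "i < j" "j \<le> card I"
    then have "s i \<in> I" "s j \<in> I" "?x (s i) < ?x (s j)" using sI less by auto
    then show "fst ((X \<circ> s) i) < fst ((X \<circ> s) j) \<and> snd ((X \<circ> s) j) < snd ((X \<circ> s) i)"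
      using anti[of "s i" "s j"] by (force simp: below_def)
  qed (use sI a Xy in auto)
  then show ?thesis using row_kernel_reindex[OF bij] by blast
qed

text \<open>
  A zero entry splits off its summand; so does an entry that factors through another entry, after a
  change of basis. Only antichains remain.
\<close>

theorem row_kernel_exists:
  fixes a :: "nat \<Rightarrow> 'k::field"
  assumes "finite I" "\<And>i. i \<in> I \<Longrightarrow> a i \<noteq> 0 \<Longrightarrow> live (X i) y" "\<And>i. i \<in> I \<Longrightarrow> live (X i) (X i)"
  shows "\<exists>J Z k. row_kernel I X y a J Z k"
  using assms
proof (induction "card I" arbitrary: I rule: less_induct)
  case less
  have step: ?case
    if i: "i \<in> I" and c: "c \<in> vecs (X i) I X" "c i = 1" "(\<Sum>r\<in>I. a r * c r) = 0" for i and c :: "nat \<Rightarrow> 'k"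
  proof -
    have "card (I - {i}) < card I" using less.prems(1) i by (meson card_Diff1_less)
    then obtain J Z k where K: "row_kernel (I - {i}) X y a J Z k"
      using less.hyps[of "I - {i}"] less.prems by auto
    then have "finite J" using row_kernel_def by blast
    then obtain m where "m \<notin> J" using ex_new_if_finite infinite_UNIV_nat by blast
    then show ?thesis
      using row_kernel_insert[OF less.prems(1) i less.prems(2) c(1,2) _ K] c(3) by blast
  qed
  show ?case
  proof (cases "\<exists>i\<in>I. a i = 0")
    case True
    then obtain i where i: "i \<in> I" "a i = 0" by blast
    show ?thesis
    proof (rule step[OF i(1)])
      show "(\<lambda>r. if r = i then 1 else 0) \<in> vecs (X i) I X"
        using i less.prems(3) by (auto simp: vecs_def)
      show "(\<Sum>r\<in>I. a r * (if r = i then 1 else 0)) = 0"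
        using i by (intro sum.neutral) auto
    qed simp
  next
    case nz: False
    show ?thesis
    proof (cases "\<exists>i\<in>I. \<exists>j\<in>I. i \<noteq> j \<and> below (X i) (X j)")
      case True
      then obtain i j where ij: "i \<in> I" "j \<in> I" "i \<noteq> j" "below (X i) (X j)" by blast
      \<comment> \<open>The entry at \<open>i\<close> factors through that at \<open>j\<close>, so this column is killed by the row.\<close>
      let ?c = "\<lambda>r. if r = i then 1 else if r = j then - (a i / a j) else 0"
      have "live (X i) y" "live (X j) y" using less.prems(2) nz ij by auto
      then have "live (X i) (X j)" using live_between(1)[OF _ ij(4)] live_below by blast
      show ?thesis
      proof (rule step[OF ij(1)])
        show "?c \<in> vecs (X i) I X"
          using ij less.prems(3) \<open>live (X i) (X j)\<close> by (auto simp: vecs_def)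
        have "(\<Sum>r\<in>I. a r * ?c r) = (\<Sum>r\<in>I. (if r = i then a i else 0) + (if r = j then - a i else 0))"
          using nz ij by (intro sum.cong) auto
        then show "(\<Sum>r\<in>I. a r * ?c r) = 0"
          using ij less.prems(1) by (simp add: sum.distrib)
      qed simp
    next
      case False
      show ?thesis by (rule row_kernel_antichain) (use less.prems nz False in auto)
    qed
  qed
qed

section \<open>The matrix category of surviving morphisms\<close>

lemma live_Fpow_move: "live (Fpow k p) q \<longleftrightarrow> live p (Fpow (- k) q)"
  using live_Fpow[of "- k" "Fpow k p" q] by simp

lemma live_degree:
  assumes "live p (Fpow k q)" "live p (Fpow l q)"
  shows "k = l"
proof -
  have False if "live p q" "live p (Fpow m q)" "m \<noteq> 0" for p q m
  proof -
    have q: "fst p \<le> fst q" "snd p \<le> snd q" "fst q < snd p + pi" "snd q < fst p + pi"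
      using that(1) by (auto simp: live_def below_def)
    show False
    proof (cases "even m")
      case True
      then have m: "m \<ge> 2 \<or> m \<le> - 2" using that(3) by presburger
      have *: "fst p \<le> fst q + m * pi" "fst q + m * pi < snd p + pi" "snd q + m * pi < fst p + pi"
        "snd p \<le> snd q + m * pi"
        using that(2) True by (auto simp: live_def below_def Fpow_def)
      from m show False
      proof
        assume "m \<ge> 2"
        then have "2 * pi \<le> m * pi" by (intro mult_right_mono) auto
        then show False using * q by linarith
      next
        assume "m \<le> - 2"
        then have "m * pi \<le> (- 2) * pi" by (intro mult_right_mono) auto
        then show False using * q by linarith
      qed
    next
      case False
      then have m: "m \<ge> 1 \<or> m \<le> - 1" using that(3) by presburger
      have *: "fst p \<le> snd q + m * pi" "snd q + m * pi < snd p + pi" "fst q + m * pi < fst p + pi"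
        "snd p \<le> fst q + m * pi"
        using that(2) False by (auto simp: live_def below_def Fpow_def)
      from m show False
      proof
        assume "m \<ge> 1"
        then have "1 * pi \<le> m * pi" by (intro mult_right_mono) auto
        then show False using * q by linarith
      next
        assume "m \<le> - 1"
        then have "m * pi \<le> (- 1) * pi" by (intro mult_right_mono) auto
        then show False using * q by linarith
      qed
    qed
  qed
  from this[of p "Fpow k q" "l - k"] show ?thesis using assms by auto
qed

text \<open>
  Two points are linked if the Hom space between the orbits of the points in the quotient \<open>\<C> / \<T>\<close> is
  nonzero. It is then one-dimensional, since the power of \<open>F\<close> is unique.
\<close>

definition linked :: "point \<Rightarrow> point \<Rightarrow> bool" where
  "linked p q \<longleftrightarrow> (\<exists>k. live p (Fpow k q))"

text \<open>
  The degrees of two nonzero basic morphisms add up; their composite is the basic morphism \<open>p \<rightarrow> r\<close> if that one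
  survives in the total degree, and zero otherwise.
\<close>

definition composable :: "point \<Rightarrow> point \<Rightarrow> point \<Rightarrow> bool" where
  "composable p q r \<longleftrightarrow> (\<exists>k l. live p (Fpow k q) \<and> live q (Fpow l r) \<and> live p (Fpow (k + l) r))"

lemma linked_Fpow_right [simp]: "linked p (Fpow m q) \<longleftrightarrow> linked p q"
proof
  show "linked p (Fpow m q) \<Longrightarrow> linked p q" unfolding linked_def by auto
  assume "linked p q"
  then obtain k where "live p (Fpow k q)" unfolding linked_def by blast
  then have "live p (Fpow (k - m) (Fpow m q))" by simp
  then show "linked p (Fpow m q)" unfolding linked_def by blast
qed

lemma linked_Fpow_left [simp]: "linked (Fpow m p) q \<longleftrightarrow> linked p q"
proof -
  have "linked (Fpow m p) q \<longleftrightarrow> linked p (Fpow (- m) q)"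
    unfolding linked_def live_Fpow_move by (simp add: algebra_simps)
  then show ?thesis by simp
qed

lemma live_linked: "live p q \<Longrightarrow> linked p q"
  unfolding linked_def by (rule exI[of _ 0]) simp

lemma linked_self: "linked p q \<Longrightarrow> live p p \<and> live q q"
proof -
  assume "linked p q"
  then obtain k where "live p (Fpow k q)" unfolding linked_def by blast
  from live_self[OF this] show ?thesis by simp
qed

lemma composable_linked: "composable p q r \<Longrightarrow> linked p q \<and> linked q r \<and> linked p r"
  unfolding composable_def linked_def by blast

lemma composable_Fpow_left [simp]: "composable (Fpow m p) q r \<longleftrightarrow> composable p q r"
proof -
  have "composable (Fpow m p) q r" if "composable p q r" for m p
  proof -
    obtain k l where "live p (Fpow k q)" "live q (Fpow l r)" "live p (Fpow (k + l) r)"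
      using \<open>composable p q r\<close> unfolding composable_def by blast
    then have "live (Fpow m p) (Fpow (m + k) q)" "live q (Fpow l r)" "live (Fpow m p) (Fpow ((m + k) + l) r)"
      using live_Fpow[of m p] by (metis Fpow_Fpow add.assoc)+
    then show ?thesis unfolding composable_def by blast
  qed
  from this[of p m] this[of "Fpow m p" "- m"] show ?thesis by auto
qed

lemma composable_Fpow_right [simp]: "composable p q (Fpow m r) \<longleftrightarrow> composable p q r"
proof -
  have "composable p q (Fpow m r)" if "composable p q r" for m r
  proof -
    obtain k l where "live p (Fpow k q)" "live q (Fpow l r)" "live p (Fpow (k + l) r)"
      using \<open>composable p q r\<close> unfolding composable_def by blast
    then have "live q (Fpow (l - m) (Fpow m r))" "live p (Fpow (k + (l - m)) (Fpow m r))"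
      by (simp_all add: algebra_simps)
    then show ?thesis using \<open>live p (Fpow k q)\<close> unfolding composable_def by blast
  qed
  from this[of r m] this[of "Fpow m r" "- m"] show ?thesis by auto
qed

lemma composable_Fpow_mid [simp]: "composable p (Fpow m q) r \<longleftrightarrow> composable p q r"
proof -
  have "composable p (Fpow m q) r" if "composable p q r" for m q
  proof -
    obtain k l where kl: "live p (Fpow k q)" "live q (Fpow l r)" "live p (Fpow (k + l) r)"
      using \<open>composable p q r\<close> unfolding composable_def by blast
    then have "live p (Fpow (k - m) (Fpow m q))" "live (Fpow m q) (Fpow (l + m) r)"
      using live_Fpow[of m q "Fpow l r"] by (simp_all add: algebra_simps)
    moreover have "live p (Fpow ((k - m) + (l + m)) r)" using kl(3) by simp
    ultimately show ?thesis unfolding composable_def by blast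
  qed
  from this[of q m] this[of "Fpow m q" "- m"] show ?thesis by auto
qed

lemma composable_iff_live:
  assumes "live x y"
  shows "composable w x y \<longleftrightarrow> (\<exists>d. live (Fpow d w) x \<and> live (Fpow d w) y)"
proof
  assume "composable w x y"
  then obtain k l where kl: "live w (Fpow k x)" "live x (Fpow l y)" "live w (Fpow (k + l) y)"
    unfolding composable_def by blast
  have "l = 0" using live_degree[OF kl(2), of 0] assms by simp
  then show "\<exists>d. live (Fpow d w) x \<and> live (Fpow d w) y"
    using kl by (intro exI[of _ "- k"]) (simp add: live_Fpow_move)
next
  assume "\<exists>d. live (Fpow d w) x \<and> live (Fpow d w) y"
  then obtain d where d: "live (Fpow d w) x" "live (Fpow d w) y" by blast
  then have "live w (Fpow (- d) x)" "live x (Fpow 0 y)" "live w (Fpow (- d + 0) y)"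
    using assms by (simp_all add: live_Fpow_move)
  then show "composable w x y" unfolding composable_def by blast
qed

lemma live_shift_unique: "live (Fpow d w) x \<Longrightarrow> live (Fpow e w) x \<Longrightarrow> d = e"
  using live_degree[of w "- d" x "- e"] by (simp add: live_Fpow_move)

lemma composable_at_target:
  assumes "live x y" "live (Fpow d w) y"
  shows "composable w x y \<longleftrightarrow> live (Fpow d w) x"
  using composable_iff_live[OF assms(1)] live_shift_unique[OF assms(2)] assms(2) by blast

lemma composable_id:
  assumes "linked p q"
  shows "composable p p q" "composable p q q"
proof -
  obtain k where k: "live p (Fpow k q)" using assms linked_def by blast
  then have "live p (Fpow 0 p)" "live q (Fpow 0 q)" using assms linked_self by auto
  moreover have "live p (Fpow (0 + k) q)" "live p (Fpow (k + 0) q)" using k by simp_all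
  ultimately show "composable p p q" "composable p q q" unfolding composable_def using k by blast+
qed

text \<open>
  Both sides say that the threefold composite survives, for the points between the ends of a surviving
  rectangle survive as well.
\<close>

lemma composable_assoc:
  "composable p q s \<and> composable q r s \<longleftrightarrow> composable p q r \<and> composable p r s"
proof
  assume "composable p q s \<and> composable q r s"
  then obtain k l a b where kl: "live p (Fpow k q)" "live q (Fpow l s)" "live p (Fpow (k + l) s)"
    and ab: "live q (Fpow a r)" "live r (Fpow b s)" "live q (Fpow (a + b) s)"
    unfolding composable_def by blast
  have l: "l = a + b" using live_degree kl(2) ab(3) by blast
  have "below p (Fpow k q)" "below (Fpow k q) (Fpow (k + a) r)"
    using live_below[OF kl(1)] live_below[OF ab(1)] below_Fpow[of k q "Fpow a r"] by auto
  then have "below p (Fpow (k + a) r)" using below_trans by blast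
  moreover have "below (Fpow (k + a) r) (Fpow (k + a + b) s)"
    using live_below[OF ab(2)] below_Fpow[of "k + a" r "Fpow b s"] by auto
  ultimately have "live p (Fpow (k + a) r)"
    using live_between(1)[of p "Fpow (k + a + b) s"] kl(3) l by (simp add: add.assoc)
  moreover have "live p (Fpow (k + a + b) s)" using kl(3) l by (simp add: add.assoc)
  ultimately show "composable p q r \<and> composable p r s"
    unfolding composable_def using kl ab by blast
next
  assume "composable p q r \<and> composable p r s"
  then obtain k l a b where kl: "live p (Fpow k q)" "live q (Fpow l r)" "live p (Fpow (k + l) r)"
    and ab: "live p (Fpow a r)" "live r (Fpow b s)" "live p (Fpow (a + b) s)"
    unfolding composable_def by blast
  have a: "a = k + l" using live_degree kl(3) ab(1) by blast
  have "below p (Fpow k q)" using live_below kl by blast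
  moreover have "below (Fpow k q) (Fpow (k + l) r)" "below (Fpow (k + l) r) (Fpow (k + l + b) s)"
    using live_below[OF kl(2)] below_Fpow[of k q "Fpow l r"]
      live_below[OF ab(2)] below_Fpow[of "k + l" r "Fpow b s"] by auto
  then have "below (Fpow k q) (Fpow (k + (l + b)) s)" using below_trans by (metis add.assoc)
  ultimately have "live (Fpow k q) (Fpow (k + (l + b)) s)"
    using live_between(2)[of p "Fpow (k + (l + b)) s" "Fpow k q"] ab(3) a by (simp add: add.assoc)
  then have "live q (Fpow (l + b) s)" using live_Fpow[of k q "Fpow (l + b) s"] by simp
  moreover have "live p (Fpow (k + (l + b)) s)" using ab(3) a by (simp add: add.assoc)
  ultimately show "composable p q s \<and> composable q r s"
    unfolding composable_def using kl ab by blast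
qed

text \<open>
  Matrices with entries at the related pairs only. For the relation \<open>linked\<close> they are the morphisms of
  \<open>\<C> / \<T>\<close> between sums of indecomposables, and \<open>live_mult\<close> is their composition.
\<close>

definition matrices :: "(point \<Rightarrow> point \<Rightarrow> bool) \<Rightarrow> point list \<Rightarrow> point list \<Rightarrow> 'k::field matrix set" where
  "matrices R P Q = {M. \<forall>i j. M i j \<noteq> 0 \<longrightarrow> i < length Q \<and> j < length P \<and> R (P ! j) (Q ! i)}"

text \<open>
  The morphisms from the single indecomposable \<open>w\<close> to the sum of the list \<open>Xs\<close>, on which matrices act.
\<close>

definition cols :: "point \<Rightarrow> point list \<Rightarrow> (nat \<Rightarrow> 'k::field) set" where
  "cols w Xs = {g. \<forall>i. g i \<noteq> 0 \<longrightarrow> i < length Xs \<and> linked w (Xs ! i)}"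

definition live_action :: "point \<Rightarrow> point list \<Rightarrow> point list \<Rightarrow> (nat \<Rightarrow> nat \<Rightarrow> 'k::field) \<Rightarrow> (nat \<Rightarrow> 'k) \<Rightarrow> nat \<Rightarrow> 'k" where
  "live_action w Xs Ys f g i = (\<Sum>s<length Xs. if composable w (Xs ! s) (Ys ! i) then f i s * g s else 0)"

definition live_mult :: "point list \<Rightarrow> point list \<Rightarrow> point list \<Rightarrow>
    (nat \<Rightarrow> nat \<Rightarrow> 'k::field) \<Rightarrow> (nat \<Rightarrow> nat \<Rightarrow> 'k) \<Rightarrow> nat \<Rightarrow> nat \<Rightarrow> 'k" where
  "live_mult Xs Ys Zs N M i j =
     (\<Sum>s<length Ys. if composable (Xs ! j) (Ys ! s) (Zs ! i) then N i s * M s j else 0)"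

lemma live_mult_live_action: "live_mult Xs Ys Zs N M i j = live_action (Xs ! j) Ys Zs N (\<lambda>s. M s j) i"
  by (simp add: live_mult_def live_action_def)

lemma live_action_cols:
  assumes "f \<in> matrices linked Xs Ys"
  shows "live_action w Xs Ys f g \<in> cols w Ys"
  unfolding cols_def
proof (intro CollectI allI impI)
  fix i assume "live_action w Xs Ys f g i \<noteq> 0"
  then obtain s where "(if composable w (Xs ! s) (Ys ! i) then f i s * g s else 0) \<noteq> 0"
    unfolding live_action_def using sum.not_neutral_contains_not_neutral by blast
  then have "composable w (Xs ! s) (Ys ! i)" "f i s \<noteq> 0" by (auto split: if_splits)
  then show "i < length Ys \<and> linked w (Ys ! i)"
    using assms composable_linked unfolding matrices_def by blast
qed

lemma live_mult_mat:
  assumes "N \<in> matrices linked Ys Zs" "M \<in> matrices linked Xs Ys"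
  shows "live_mult Xs Ys Zs N M \<in> matrices linked Xs Zs"
  unfolding matrices_def
proof (intro CollectI allI impI)
  fix i j assume *: "live_mult Xs Ys Zs N M i j \<noteq> 0"
  then have "i < length Zs \<and> linked (Xs ! j) (Zs ! i)"
    using live_action_cols[OF assms(1), of "Xs ! j" "\<lambda>s. M s j"] unfolding live_mult_live_action cols_def by blast
  moreover obtain s where "(if composable (Xs ! j) (Ys ! s) (Zs ! i) then N i s * M s j else 0) \<noteq> 0"
    using * unfolding live_mult_def by (rule sum.not_neutral_contains_not_neutral)
  then have "M s j \<noteq> 0" by (auto split: if_splits)
  then have "j < length Xs" using assms(2) unfolding matrices_def by blast
  ultimately show "i < length Zs \<and> j < length Xs \<and> linked (Xs ! j) (Zs ! i)" by blast
qed

lemma live_action_live_mult: "live_action w Zs Ys (live_mult Zs Xs Ys f k) h = live_action w Xs Ys f (live_action w Zs Xs k h)"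
proof
  fix i
  have "live_action w Zs Ys (live_mult Zs Xs Ys f k) h i = (\<Sum>j<length Zs. \<Sum>s<length Xs.
      if composable w (Zs ! j) (Ys ! i) \<and> composable (Zs ! j) (Xs ! s) (Ys ! i) then f i s * k s j * h j else 0)"
    unfolding live_action_def live_mult_def by (intro sum.cong) (auto simp: sum_distrib_right intro!: sum.cong)
  also have "\<dots> = (\<Sum>s<length Xs. \<Sum>j<length Zs.
      if composable w (Zs ! j) (Xs ! s) \<and> composable w (Xs ! s) (Ys ! i) then f i s * k s j * h j else 0)"
    unfolding composable_assoc by (rule sum.swap)
  also have "\<dots> = live_action w Xs Ys f (live_action w Zs Xs k h) i"
    unfolding live_action_def by (intro sum.cong) (auto simp: sum_distrib_left mult.assoc intro!: sum.cong)
  finally show "live_action w Zs Ys (live_mult Zs Xs Ys f k) h i = live_action w Xs Ys f (live_action w Zs Xs k h) i" .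
qed

section \<open>Kernels and cokernels of matrices\<close>

lemma row_kernel_initial_segment:
  assumes "row_kernel I X y a J Z k"
  shows "\<exists>n Z k. row_kernel I X y a {..<n::nat} Z k"
proof -
  have fin: "finite J" using assms row_kernel_def by blast
  define n where "n = card J"
  obtain s where bij: "bij_betw s {..<n} J"
    using ex_bij_betw_nat_finite[OF fin] unfolding n_def by (auto simp: lessThan_atLeast0)
  define t where "t = inv_into {..<n} s"
  have st: "j \<in> J \<Longrightarrow> t j < n \<and> s (t j) = j" "m < n \<Longrightarrow> s m \<in> J \<and> t (s m) = m" for j m
    using bij unfolding t_def bij_betw_def by (auto simp: f_inv_into_f dest: inv_into_into)
  let ?Z = "Z \<circ> s" and ?k = "\<lambda>i m. if m < n then k i (s m) else 0"
  have sumJ: "(\<Sum>j\<in>J. f j) = (\<Sum>m<n. f (s m))" for f :: "nat \<Rightarrow> 'a"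
    using sum.reindex_bij_betw[OF bij] by metis
  have ks: "k i j \<noteq> 0 \<Longrightarrow> i \<in> I \<and> j \<in> J \<and> live (Z j) (X i)" for i j
    using assms unfolding row_kernel_def by blast
  have "row_kernel I X y a {..<n} ?Z ?k"
    unfolding row_kernel_def
  proof (intro conjI ballI allI impI)
    show "live (?Z m) (?Z m)" if "m \<in> {..<n}" for m
      using that st assms unfolding row_kernel_def by auto
    show "i \<in> I" "m \<in> {..<n}" "live (?Z m) (X i)" if "?k i m \<noteq> 0" for i m
      using that ks[of i "s m"] by (auto split: if_splits)
    show "(\<Sum>i\<in>I. a i * ?k i m) = 0" if "m \<in> {..<n}" "live (?Z m) y" for m
    proof -
      have "s m \<in> J" "live (Z (s m)) y" using that st by auto
      then have "(\<Sum>i\<in>I. a i * k i (s m)) = 0" using assms unfolding row_kernel_def by blast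
      then show ?thesis using that by simp
    qed
    fix w g assume g: "g \<in> vecs w I X" "live w y \<longrightarrow> (\<Sum>i\<in>I. a i * g i) = 0"
    then have "\<exists>!h. h \<in> vecs w J Z \<and> solves w X J k g h" using row_kernelD[OF assms] by blast
    then obtain h where h: "h \<in> vecs w J Z" "solves w X J k g h"
      and uniq: "\<And>h'. h' \<in> vecs w J Z \<Longrightarrow> solves w X J k g h' \<Longrightarrow> h' = h" by blast
    show "\<exists>!h. h \<in> vecs w {..<n} ?Z \<and> solves w X {..<n} ?k g h"
    proof (rule ex1I[of _ "\<lambda>m. if m < n then h (s m) else 0"], intro conjI)
      show "(\<lambda>m. if m < n then h (s m) else 0) \<in> vecs w {..<n} ?Z"
        using h(1) by (auto simp: vecs_def)
      show "solves w X {..<n} ?k g (\<lambda>m. if m < n then h (s m) else 0)"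
      proof -
        have "(\<Sum>m<n. (if m < n then k i (s m) else 0) * (if m < n then h (s m) else 0)) =
            (\<Sum>m<n. k i (s m) * h (s m))" for i
          by (intro sum.cong) auto
        then show ?thesis using h(2) unfolding solves_def sumJ by metis
      qed
    next
      fix h' assume h': "h' \<in> vecs w {..<n} ?Z \<and> solves w X {..<n} ?k g h'"
      define h2 where "h2 j = (if j \<in> J then h' (t j) else 0)" for j
      have "h2 = h"
      proof (rule uniq)
        show "h2 \<in> vecs w J Z"
          unfolding vecs_def
        proof (intro CollectI allI impI)
          fix j assume "h2 j \<noteq> 0"
          then have "j \<in> J" "h' (t j) \<noteq> 0" by (auto simp: h2_def split: if_splits)
          then show "j \<in> J \<and> live w (Z j)" using h' st(1) unfolding vecs_def by force
        qed
        show "solves w X J k g h2"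
        proof -
          have "(\<Sum>m<n. k i (s m) * h2 (s m)) = (\<Sum>m<n. (if m < n then k i (s m) else 0) * h' m)" for i
            using st(2) by (intro sum.cong) (auto simp: h2_def)
          then show ?thesis using h' unfolding solves_def sumJ by metis
        qed
      qed
      then have "h' m = h (s m)" if "m < n" for m using st(2)[OF that] unfolding h2_def by auto
      moreover have "h' m = 0" if "\<not> m < n" for m using h' that unfolding vecs_def by blast
      ultimately show "h' = (\<lambda>m. if m < n then h (s m) else 0)" by auto
    qed
  qed simp
  then show ?thesis by blast
qed

text \<open>
  The sources of a row can be replaced by lifts from which the row has degree \<open>0\<close>. A vector at \<open>w\<close> is the
  sum of its homogeneous parts, and the part of degree \<open>e\<close> is a vector of degree \<open>0\<close> at the lift
  \<open>Fpow e w\<close>. So a kernel in degree \<open>0\<close> is a kernel.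
\<close>

lemma kernel_of_row:
  fixes f :: "nat \<Rightarrow> nat \<Rightarrow> 'k::field"
  assumes f: "f \<in> matrices linked Xs Ys"
  shows "\<exists>Zs k. (\<forall>z\<in>set Zs. live z z) \<and> k \<in> matrices linked Zs Xs \<and>
     (\<forall>w. \<forall>h\<in>cols w Zs. live_action w Xs Ys f (live_action w Zs Xs k h) i = 0) \<and>
     (\<forall>w. \<forall>g\<in>cols w Xs. live_action w Xs Ys f g i = 0 \<longrightarrow>
        (\<exists>!h. h \<in> cols w Zs \<and> live_action w Zs Xs k h = g))"
proof -
  define y where "y = Ys ! i"
  have "\<exists>d. f i s \<noteq> 0 \<longrightarrow> live (Fpow d (Xs ! s)) y" for s
  proof (cases "f i s = 0")
    case False
    then have "linked (Xs ! s) y" using f unfolding matrices_def y_def by blast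
    then obtain k where "live (Xs ! s) (Fpow k y)" unfolding linked_def by blast
    then have "live (Fpow (- k) (Xs ! s)) y" by (simp add: live_Fpow_move)
    then show ?thesis by blast
  qed simp
  then obtain d where d: "\<And>s. f i s \<noteq> 0 \<Longrightarrow> live (Fpow (d s) (Xs ! s)) y" by metis
  define X where "X s = Fpow (d s) (Xs ! s)" for s
  define I where "I = {s. s < length Xs \<and> live (Xs ! s) (Xs ! s)}"
  have Xy: "f i s \<noteq> 0 \<Longrightarrow> live (X s) y" for s using d by (simp add: X_def)
  have fI: "f i s \<noteq> 0 \<Longrightarrow> s \<in> I" for s
    using f linked_self unfolding matrices_def I_def by blast
  have finI: "finite I" by (simp add: I_def)
  have "\<exists>J Z k. row_kernel I X y (f i) J Z k"
    by (rule row_kernel_exists[OF finI]) (auto simp: Xy, auto simp: I_def X_def)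
  then obtain n Z and k :: "nat \<Rightarrow> nat \<Rightarrow> 'k" where K: "row_kernel I X y (f i) {..<n} Z k"
    using row_kernel_initial_segment by metis
  have ksup: "k r j \<noteq> 0 \<Longrightarrow> r \<in> I \<and> j < n \<and> live (Z j) (X r)" for r j
    using K unfolding row_kernel_def by blast
  have kzero: "j < n \<Longrightarrow> live (Z j) y \<Longrightarrow> (\<Sum>r\<in>I. f i r * k r j) = 0" for j
    using K unfolding row_kernel_def by blast
  define Zs where "Zs = map Z [0..<n]"
  have Zs: "length Zs = n" "j < n \<Longrightarrow> Zs ! j = Z j" for j by (simp_all add: Zs_def)
  have kmat: "k \<in> matrices linked Zs Xs"
    unfolding matrices_def
  proof (intro CollectI allI impI)
    fix r j assume "k r j \<noteq> 0"
    then have "r \<in> I" "j < n" "linked (Z j) (X r)" using ksup live_linked by blast+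
    then show "r < length Xs \<and> j < length Zs \<and> linked (Zs ! j) (Xs ! r)"
      by (simp add: I_def X_def Zs)
  qed
  have self: "\<forall>z\<in>set Zs. live z z" using K unfolding row_kernel_def Zs_def by auto
  define part :: "point \<Rightarrow> (nat \<Rightarrow> point) \<Rightarrow> (nat \<Rightarrow> 'k) \<Rightarrow> int \<Rightarrow> nat \<Rightarrow> 'k"
    where "part w P g e r = (if live (Fpow e w) (P r) then g r else 0)" for w P g e r
  have partX: "part w X g e \<in> vecs (Fpow e w) I X" if "g \<in> cols w Xs" for w g e
    unfolding vecs_def
  proof (intro CollectI allI impI)
    fix r assume "part w X g e r \<noteq> 0"
    then have r: "live (Fpow e w) (X r)" "g r \<noteq> 0" by (auto simp: part_def split: if_splits)
    then have "r < length Xs" "linked w (Xs ! r)" using that unfolding cols_def by blast+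
    then show "r \<in> I \<and> live (Fpow e w) (X r)" using r linked_self unfolding I_def by blast
  qed
  have partZ: "part w Z h e \<in> vecs (Fpow e w) {..<n} Z" if "h \<in> cols w Zs" for w h e
    using that unfolding vecs_def cols_def part_def by (auto simp: Zs split: if_splits)
  have comp_X: "composable w (Xs ! s) q \<longleftrightarrow> composable w (X s) q"
    "composable w q (Xs ! s) \<longleftrightarrow> composable w q (X s)" for w s q
    by (simp_all add: X_def)
  have live_action_f: "live_action w Xs Ys f g i = (\<Sum>s\<in>I. f i s * part w X g e s)" if e: "live (Fpow e w) y" for w g e
  proof -
    have "live_action w Xs Ys f g i = (\<Sum>s<length Xs. f i s * part w X g e s)"
      unfolding live_action_def y_def[symmetric] comp_X
    proof (rule sum.cong)
      fix s
      show "(if composable w (X s) y then f i s * g s else 0) = f i s * part w X g e s"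
        using composable_at_target[OF Xy e, of s] by (cases "f i s = 0") (auto simp: part_def)
    qed simp
    also have "\<dots> = (\<Sum>s\<in>I. f i s * part w X g e s)"
      using fI by (intro sum.mono_neutral_right) (auto simp: I_def)
    finally show ?thesis .
  qed
  have live_action_f0: "live_action w Xs Ys f g i = 0" if "\<And>e. \<not> live (Fpow e w) y" for w g
  proof -
    have "\<not> linked w y" unfolding linked_def
    proof
      assume "\<exists>k. live w (Fpow k y)"
      then obtain e where "live w (Fpow e y)" by blast
      then have "live (Fpow (- e) w) y" by (simp add: live_Fpow_move)
      then show False using that by blast
    qed
    then have "\<not> composable w q y" for q using composable_linked by blast
    then show ?thesis unfolding live_action_def y_def[symmetric] by simp
  qed
  have live_action_k: "live_action w Zs Xs k h r = (\<Sum>j<n. k r j * part w Z h e j)" if e: "live (Fpow e w) (X r)" for w h e r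
    unfolding live_action_def Zs(1) comp_X
  proof (rule sum.cong)
    fix j assume "j \<in> {..<n}"
    then have "Zs ! j = Z j" using Zs by simp
    moreover have "k r j \<noteq> 0 \<Longrightarrow> composable w (Z j) (X r) \<longleftrightarrow> live (Fpow e w) (Z j)"
      using composable_at_target[OF _ e] ksup by blast
    ultimately show "(if composable w (Zs ! j) (X r) then k r j * h j else 0) = k r j * part w Z h e j"
      by (cases "k r j = 0") (auto simp: part_def)
  qed simp
  have eq_iff: "live_action w Zs Xs k h = g \<longleftrightarrow> (\<forall>e. solves (Fpow e w) X {..<n} k (part w X g e) (part w Z h e))"
    if g: "g \<in> cols w Xs" for w g h
  proof
    assume eq: "live_action w Zs Xs k h = g"
    show "\<forall>e. solves (Fpow e w) X {..<n} k (part w X g e) (part w Z h e)"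
      unfolding solves_def
    proof (intro allI)
      fix e r
      show "(if live (Fpow e w) (X r) then \<Sum>j<n. k r j * part w Z h e j else 0) = part w X g e r"
        using live_action_k[of e w r h] eq by (simp add: part_def[of w X])
    qed
  next
    assume sol: "\<forall>e. solves (Fpow e w) X {..<n} k (part w X g e) (part w Z h e)"
    show "live_action w Zs Xs k h = g"
    proof
      fix r
      show "live_action w Zs Xs k h r = g r"
      proof (cases "\<exists>e. live (Fpow e w) (X r)")
        case True
        then obtain e where e: "live (Fpow e w) (X r)" by blast
        have "(\<Sum>j<n. k r j * part w Z h e j) = part w X g e r"
          using sol[rule_format, of e, unfolded solves_def, rule_format, of r] e by simp
        then show ?thesis unfolding live_action_k[OF e] using e by (simp add: part_def)
      next
        case False
        have "\<not> linked w (Xs ! r)"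
        proof
          assume "linked w (Xs ! r)"
          then have "linked w (X r)" by (simp add: X_def)
          then obtain e where "live w (Fpow e (X r))" unfolding linked_def by blast
          then have "live (Fpow (- e) w) (X r)" by (simp add: live_Fpow_move)
          then show False using False by blast
        qed
        then have "g r = 0" "live_action w Zs Xs k h r = 0"
          using g live_action_cols[OF kmat, of w h] unfolding cols_def by blast+
        then show ?thesis by simp
      qed
    qed
  qed
  have zero: "live_action w Xs Ys f (live_action w Zs Xs k h) i = 0" if h: "h \<in> cols w Zs" for w h
  proof (cases "\<exists>e. live (Fpow e w) y")
    case False
    then show ?thesis using live_action_f0 by blast
  next
    case True
    then obtain e where e: "live (Fpow e w) y" by blast
    have "f i r * part w X (live_action w Zs Xs k h) e r = (\<Sum>j<n. f i r * k r j * part w Z h e j)" for r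
    proof (cases "live (Fpow e w) (X r)")
      case True
      then show ?thesis by (simp add: live_action_k part_def[of w X] sum_distrib_left mult.assoc)
    next
      case False
      have "f i r * k r j * part w Z h e j = 0" for j
      proof (rule ccontr)
        assume "\<not> ?thesis"
        then have "live (X r) y" "live (Z j) (X r)" "live (Fpow e w) (Z j)"
          using Xy ksup by (auto simp: part_def split: if_splits)
        then have "live (Fpow e w) (X r)"
          using live_between(1)[OF e] live_below below_trans by blast
        then show False using False by blast
      qed
      then have "(\<Sum>j<n. f i r * k r j * part w Z h e j) = 0" by (intro sum.neutral) blast
      then show ?thesis using False by (simp add: part_def[of w X])
    qed
    then have "live_action w Xs Ys f (live_action w Zs Xs k h) i = (\<Sum>r\<in>I. \<Sum>j<n. f i r * k r j * part w Z h e j)"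
      unfolding live_action_f[OF e] by simp
    also have "\<dots> = (\<Sum>j<n. (\<Sum>r\<in>I. f i r * k r j) * part w Z h e j)"
      unfolding sum_distrib_right by (rule sum.swap)
    also have "\<dots> = 0"
    proof (intro sum.neutral ballI, rule ccontr)
      fix j assume j: "j \<in> {..<n}" "(\<Sum>r\<in>I. f i r * k r j) * part w Z h e j \<noteq> 0"
      then have wz: "live (Fpow e w) (Z j)" by (auto simp: part_def split: if_splits)
      obtain r where "f i r * k r j \<noteq> 0"
      proof -
        have "(\<Sum>r\<in>I. f i r * k r j) \<noteq> 0" using j(2) by auto
        then show thesis using that by (rule sum.not_neutral_contains_not_neutral)
      qed
      then have "live (Z j) (X r)" "live (X r) y" using ksup Xy by auto
      then have "live (Z j) y" using live_between(2)[OF e] live_below[OF wz] live_below below_trans by blast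
      then show False using kzero[of j] j by simp
    qed
    finally show ?thesis .
  qed
  have univ: "\<exists>!h. h \<in> cols w Zs \<and> live_action w Zs Xs k h = g"
    if g: "g \<in> cols w Xs" "live_action w Xs Ys f g i = 0" for w g
  proof -
    have ex: "\<exists>!h. h \<in> vecs (Fpow e w) {..<n} Z \<and> solves (Fpow e w) X {..<n} k (part w X g e) h" for e
      by (rule row_kernelD[OF K partX[OF g(1)]]) (use live_action_f[of e w g] g(2) in simp)
    then have "\<forall>e. \<exists>h. h \<in> vecs (Fpow e w) {..<n} Z \<and> solves (Fpow e w) X {..<n} k (part w X g e) h"
      by blast
    then obtain H where "\<forall>e. H e \<in> vecs (Fpow e w) {..<n} Z \<and> solves (Fpow e w) X {..<n} k (part w X g e) (H e)"
      by (rule choice[THEN exE])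
    then have H: "\<And>e. H e \<in> vecs (Fpow e w) {..<n} Z"
      "\<And>e. solves (Fpow e w) X {..<n} k (part w X g e) (H e)"
      by blast+
    have Huniq: "h' = H e" if "h' \<in> vecs (Fpow e w) {..<n} Z" "solves (Fpow e w) X {..<n} k (part w X g e) h'" for h' e
      using ex[of e] H[of e] that by blast
    define h where "h j = (if \<exists>e. live (Fpow e w) (Z j) then H (THE e. live (Fpow e w) (Z j)) j else 0)" for j
    have the: "(THE e. live (Fpow e w) (Z j)) = e" if "live (Fpow e w) (Z j)" for j e
      using that live_shift_unique by blast
    have hpart: "part w Z h e = H e" for e
    proof
      fix j
      show "part w Z h e j = H e j"
      proof (cases "live (Fpow e w) (Z j)")
        case True
        then show ?thesis using the[OF True] by (auto simp: part_def h_def)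
      next
        case False
        then show ?thesis using H(1)[of e] unfolding vecs_def part_def by auto
      qed
    qed
    show ?thesis
    proof (rule ex1I[of _ h], intro conjI)
      show "h \<in> cols w Zs"
        unfolding cols_def
      proof (intro CollectI allI impI)
        fix j assume "h j \<noteq> 0"
        then obtain e where e: "live (Fpow e w) (Z j)" by (auto simp: h_def split: if_splits)
        then have "H e j \<noteq> 0" using \<open>h j \<noteq> 0\<close> hpart[of e] by (auto simp: part_def fun_eq_iff split: if_splits)
        then have "j < n" using H(1) unfolding vecs_def by blast
        moreover have "linked w (Z j)" using live_linked[OF e] by simp
        ultimately show "j < length Zs \<and> linked w (Zs ! j)" by (simp add: Zs)
      qed
      show "live_action w Zs Xs k h = g" unfolding eq_iff[OF g(1)] hpart using H(2) by blast
    next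
      fix h' assume h': "h' \<in> cols w Zs \<and> live_action w Zs Xs k h' = g"
      then have sol: "solves (Fpow e w) X {..<n} k (part w X g e) (part w Z h' e)" for e
        using eq_iff[OF g(1)] by blast
      have "part w Z h' e = H e" for e
        using Huniq[OF partZ sol] h' by blast
      then have same: "part w Z h' e = part w Z h e" for e using hpart by simp
      show "h' = h"
      proof
        fix j
        show "h' j = h j"
        proof (cases "\<exists>e. live (Fpow e w) (Z j)")
          case True
          then obtain e where "live (Fpow e w) (Z j)" by blast
          then show ?thesis using fun_cong[OF same[of e], of j] by (simp add: part_def)
        next
          case False
          have "h' j = 0"
          proof (rule ccontr)
            assume "h' j \<noteq> 0"
            then have "j < n" "linked w (Z j)" using h' Zs unfolding cols_def by force+
            then obtain e where "live w (Fpow e (Z j))" unfolding linked_def by blast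
            then have "live (Fpow (- e) w) (Z j)" by (simp add: live_Fpow_move)
            then show False using False by blast
          qed
          then show ?thesis using False by (simp add: h_def)
        qed
      qed
    qed
  qed
  show ?thesis using self kmat zero univ by blast
qed


text \<open>
  The kernel of \<open>m + 1\<close> rows is the kernel of the last row, restricted to the kernel of the first \<open>m\<close> rows.
\<close>

lemma kernel_of_rows:
  fixes f :: "nat \<Rightarrow> nat \<Rightarrow> 'k::field"
  assumes f: "f \<in> matrices linked Xs Ys"
  shows "\<exists>Zs k. (\<forall>z\<in>set Zs. live z z) \<and> k \<in> matrices linked Zs Xs \<and>
     (\<forall>w. \<forall>h\<in>cols w Zs. \<forall>i<m. live_action w Xs Ys f (live_action w Zs Xs k h) i = 0) \<and>
     (\<forall>w. \<forall>g\<in>cols w Xs. (\<forall>i<m. live_action w Xs Ys f g i = 0) \<longrightarrow>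
        (\<exists>!h. h \<in> cols w Zs \<and> live_action w Zs Xs k h = g))"
proof (induction m)
  case 0
  have "(\<lambda>i j. 0) \<in> matrices linked Xs Xs" by (simp add: matrices_def)
  from kernel_of_row[OF this, of 0] obtain Zs k
    where K: "\<forall>z\<in>set Zs. live z z" "k \<in> matrices linked Zs Xs"
     "\<forall>w. \<forall>g\<in>cols w Xs. live_action w Xs Xs (\<lambda>i j. 0::'k) g 0 = 0 \<longrightarrow> (\<exists>!h. h \<in> cols w Zs \<and> live_action w Zs Xs k h = g)"
    by (elim exE conjE)
  have "live_action w Xs Xs (\<lambda>i j. 0::'k) g 0 = 0" for w g by (auto simp: live_action_def intro!: sum.neutral)
  then show ?case using K by (intro exI[of _ Zs] exI[of _ k]) auto
next
  case (Suc m)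
  then obtain Zs k where K1: "k \<in> matrices linked Zs Xs"
    and K2: "\<forall>w. \<forall>h\<in>cols w Zs. \<forall>i<m. live_action w Xs Ys f (live_action w Zs Xs k h) i = 0"
    and K3: "\<forall>w. \<forall>g\<in>cols w Xs. (\<forall>i<m. live_action w Xs Ys f g i = 0) \<longrightarrow>
        (\<exists>!h. h \<in> cols w Zs \<and> live_action w Zs Xs k h = g)"
    by (elim exE conjE)
  note K = K1 K2[rule_format] and Ku = K3[rule_format]
  let ?f = "live_mult Zs Xs Ys f k"
  have "?f \<in> matrices linked Zs Ys" using live_mult_mat f K by blast
  from kernel_of_row[OF this, of m] obtain Vs v where V1: "\<forall>z\<in>set Vs. live z z" "v \<in> matrices linked Vs Zs"
    and V2: "\<forall>w. \<forall>h\<in>cols w Vs. live_action w Zs Ys ?f (live_action w Vs Zs v h) m = 0"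
    and V3: "\<forall>w. \<forall>g\<in>cols w Zs. live_action w Zs Ys ?f g m = 0 \<longrightarrow>
        (\<exists>!h. h \<in> cols w Vs \<and> live_action w Vs Zs v h = g)"
    by (elim exE conjE)
  note V = V1 V2[rule_format] and Vu = V3[rule_format]
  let ?v = "live_mult Vs Zs Xs k v"
  have "?v \<in> matrices linked Vs Xs" using live_mult_mat K V by blast
  moreover have "live_action w Xs Ys f (live_action w Vs Xs ?v h) i = 0" if "h \<in> cols w Vs" "i < Suc m" for w h i
  proof (cases "i = m")
    case True
    then show ?thesis using V(3)[OF that(1)] by (simp add: live_action_live_mult)
  next
    case False
    then show ?thesis using K(2)[OF live_action_cols[OF V(2)]] that by (simp add: live_action_live_mult)
  qed
  moreover have "\<exists>!h. h \<in> cols w Vs \<and> live_action w Vs Xs ?v h = g"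
    if g: "g \<in> cols w Xs" "\<forall>i<Suc m. live_action w Xs Ys f g i = 0" for w g
  proof -
    obtain u where u: "u \<in> cols w Zs" "live_action w Zs Xs k u = g"
      and uu: "\<And>u'. u' \<in> cols w Zs \<Longrightarrow> live_action w Zs Xs k u' = g \<Longrightarrow> u' = u"
    proof -
      have "\<exists>!h. h \<in> cols w Zs \<and> live_action w Zs Xs k h = g" by (rule Ku[OF g(1)]) (use g(2) in simp)
      then show thesis using that by blast
    qed
    have "live_action w Zs Ys ?f u m = 0" using u(2) g(2) by (simp add: live_action_live_mult)
    from Vu[OF u(1) this] obtain h where h: "h \<in> cols w Vs" "live_action w Vs Zs v h = u"
      and hu: "\<And>h'. h' \<in> cols w Vs \<Longrightarrow> live_action w Vs Zs v h' = u \<Longrightarrow> h' = h" by blast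
    show ?thesis
    proof (rule ex1I[of _ h], intro conjI)
      show "h \<in> cols w Vs" by (rule h)
      show "live_action w Vs Xs ?v h = g" using h u by (simp add: live_action_live_mult)
      fix h' assume h': "h' \<in> cols w Vs \<and> live_action w Vs Xs ?v h' = g"
      then have "live_action w Vs Zs v h' = u" using uu live_action_cols[OF V(2)] by (simp add: live_action_live_mult)
      then show "h' = h" using hu h' by blast
    qed
  qed
  ultimately show ?case using V(1) by blast
qed

theorem matrix_kernel:
  fixes f :: "nat \<Rightarrow> nat \<Rightarrow> 'k::field"
  assumes f: "f \<in> matrices linked Xs Ys"
  shows "\<exists>Zs k. (\<forall>z\<in>set Zs. live z z) \<and> k \<in> matrices linked Zs Xs \<and> live_mult Zs Xs Ys f k = (\<lambda>i j. 0) \<and>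
     (\<forall>Ws. \<forall>g\<in>matrices linked Ws Xs. live_mult Ws Xs Ys f g = (\<lambda>i j. 0) \<longrightarrow>
        (\<exists>!u. u \<in> matrices linked Ws Zs \<and> live_mult Ws Zs Xs k u = g))"
proof -
  from kernel_of_rows[OF f, of "length Ys"] obtain Zs k
    where K1: "\<forall>z\<in>set Zs. live z z" "k \<in> matrices linked Zs Xs"
    and K2: "\<forall>w. \<forall>h\<in>cols w Zs. \<forall>i<length Ys. live_action w Xs Ys f (live_action w Zs Xs k h) i = 0"
    and K3: "\<forall>w. \<forall>g\<in>cols w Xs. (\<forall>i<length Ys. live_action w Xs Ys f g i = 0) \<longrightarrow>
        (\<exists>!h. h \<in> cols w Zs \<and> live_action w Zs Xs k h = g)"
    by (elim exE conjE)
  note K = K1 K2[rule_format] and Ku = K3[rule_format]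
  have col: "(\<lambda>s. M s j) \<in> cols (As ! j) Bs" if "M \<in> matrices linked As Bs" for M :: "nat \<Rightarrow> nat \<Rightarrow> 'k" and As Bs j
    using that unfolding matrices_def cols_def by blast
  have zero: "live_mult Zs Xs Ys f k = (\<lambda>i j. 0)"
  proof (intro ext)
    fix i j
    show "live_mult Zs Xs Ys f k i j = 0"
    proof (rule ccontr)
      assume nz: "live_mult Zs Xs Ys f k i j \<noteq> 0"
      then have ij: "i < length Ys" "j < length Zs" "linked (Zs ! j) (Ys ! i)"
        using live_mult_mat[OF f K(2)] unfolding matrices_def by blast+
      let ?e = "\<lambda>s. if s = j then 1 else (0::'k)"
      have "live (Zs ! j) (Zs ! j)" using ij K(1) by auto
      then have e: "?e \<in> cols (Zs ! j) Zs" using ij live_linked by (auto simp: cols_def)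
      have "live_action (Zs ! j) Zs Ys (live_mult Zs Xs Ys f k) ?e i = 0"
        unfolding live_action_live_mult using K(3)[OF e ij(1)] .
      moreover have "live_action (Zs ! j) Zs Ys (live_mult Zs Xs Ys f k) ?e i = live_mult Zs Xs Ys f k i j"
      proof -
        have "live_action (Zs ! j) Zs Ys (live_mult Zs Xs Ys f k) ?e i =
            (\<Sum>s<length Zs. if s = j then live_mult Zs Xs Ys f k i j else 0)"
          unfolding live_action_def using composable_id(1)[OF ij(3)] by (intro sum.cong) auto
        then show ?thesis using ij(2) by simp
      qed
      ultimately show False using nz by simp
    qed
  qed
  have "\<exists>!u. u \<in> matrices linked Ws Zs \<and> live_mult Ws Zs Xs k u = g"
    if g: "g \<in> matrices linked Ws Xs" "live_mult Ws Xs Ys f g = (\<lambda>i j. 0)" for Ws g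
  proof -
    have "\<exists>!h. h \<in> cols (Ws ! j) Zs \<and> live_action (Ws ! j) Zs Xs k h = (\<lambda>s. g s j)" for j
    proof (rule Ku[OF col[OF g(1)]])
      fix i
      have "live_mult Ws Xs Ys f g i j = 0" using g(2) by simp
      then show "live_action (Ws ! j) Xs Ys f (\<lambda>s. g s j) i = 0" by (simp add: live_mult_live_action)
    qed
    note ex = this
    have "\<forall>j. \<exists>h. h \<in> cols (Ws ! j) Zs \<and> live_action (Ws ! j) Zs Xs k h = (\<lambda>s. g s j)"
      using ex by blast
    then obtain H where "\<forall>j. H j \<in> cols (Ws ! j) Zs \<and> live_action (Ws ! j) Zs Xs k (H j) = (\<lambda>s. g s j)"
      by (rule choice[THEN exE])
    then have H: "\<And>j. H j \<in> cols (Ws ! j) Zs" "\<And>j. live_action (Ws ! j) Zs Xs k (H j) = (\<lambda>s. g s j)"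
      by blast+
    have Hu: "h = H j" if "h \<in> cols (Ws ! j) Zs" "live_action (Ws ! j) Zs Xs k h = (\<lambda>s. g s j)" for j h
      using ex[of j] H that by blast
    let ?u = "\<lambda>s j. if j < length Ws then H j s else 0"
    show ?thesis
    proof (rule ex1I[of _ ?u], intro conjI)
      show "?u \<in> matrices linked Ws Zs" using H(1) unfolding matrices_def cols_def by auto
      show "live_mult Ws Zs Xs k ?u = g"
      proof (intro ext)
        fix i j
        show "live_mult Ws Zs Xs k ?u i j = g i j"
        proof (cases "j < length Ws")
          case True
          then have "live_mult Ws Zs Xs k ?u i j = live_action (Ws ! j) Zs Xs k (H j) i"
            unfolding live_mult_live_action by simp
          then show ?thesis using H(2) by simp
        next
          case False
          then have "g i j = 0" using g(1) unfolding matrices_def by blast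
          then show ?thesis using False by (auto simp: live_mult_def intro!: sum.neutral)
        qed
      qed
      fix u assume u: "u \<in> matrices linked Ws Zs \<and> live_mult Ws Zs Xs k u = g"
      have "(\<lambda>s. u s j) = H j" for j
      proof (rule Hu)
        show "(\<lambda>s. u s j) \<in> cols (Ws ! j) Zs" using col u by blast
        show "live_action (Ws ! j) Zs Xs k (\<lambda>s. u s j) = (\<lambda>s. g s j)"
        proof
          fix i
          show "live_action (Ws ! j) Zs Xs k (\<lambda>s. u s j) i = g i j"
            using u live_mult_live_action[of Ws Zs Xs k u i j] by simp
        qed
      qed
      moreover have "u s j = 0" if "\<not> j < length Ws" for s j using u that unfolding matrices_def by blast
      ultimately show "u = ?u" by (auto simp: fun_eq_iff)
    qed
  qed
  then show ?thesis using K(1,2) zero by (intro exI[of _ Zs] exI[of _ k]) blast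
qed

text \<open>
  The reflection \<open>(x, y) \<mapsto> (- x, - y)\<close> preserves \<open>\<T>\<close> and reverses the order. Together with transposition of
  matrices it is a duality, which turns kernels into cokernels.
\<close>

lemma linked_reflect: "linked (reflect q) (reflect p) \<longleftrightarrow> linked p q"
proof -
  have "linked (reflect q) (reflect p)" if "linked p q" for p q
  proof -
    obtain k where "live p (Fpow k q)" using \<open>linked p q\<close> linked_def by blast
    then have "live (Fpow (- k) (reflect q)) (reflect p)"
      using live_reflect[of "Fpow k q" p] by (simp add: reflect_Fpow)
    then show ?thesis unfolding linked_def by (auto simp: live_Fpow_move)
  qed
  from this[of p q] this[of "reflect q" "reflect p"] show ?thesis by auto
qed

lemma composable_reflect: "composable (reflect r) (reflect q) (reflect p) \<longleftrightarrow> composable p q r"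
proof -
  have "composable (reflect r) (reflect q) (reflect p)" if "composable p q r" for p q r
  proof -
    obtain k l where "live p (Fpow k q)" "live q (Fpow l r)" "live p (Fpow (k + l) r)"
      using \<open>composable p q r\<close> unfolding composable_def by blast
    then have "live (reflect q) (Fpow k (reflect p))" "live (reflect r) (Fpow l (reflect q))"
      "live (reflect r) (Fpow (k + l) (reflect p))"
      using live_reflect[of "Fpow k q" p] live_reflect[of "Fpow l r" q] live_reflect[of "Fpow (k + l) r" p]
      by (simp_all add: reflect_Fpow live_Fpow_move add.commute)
    then show ?thesis unfolding composable_def by (metis add.commute)
  qed
  from this[of p q r] this[of "reflect r" "reflect q" "reflect p"] show ?thesis by auto
qed

abbreviation (input) flip :: "(nat \<Rightarrow> nat \<Rightarrow> 'a) \<Rightarrow> nat \<Rightarrow> nat \<Rightarrow> 'a" where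
  "flip M \<equiv> \<lambda>i j. M j i"

lemma mat_transp: "flip M \<in> matrices linked (map reflect Ys) (map reflect Xs) \<longleftrightarrow> M \<in> matrices linked Xs Ys"
proof -
  have pt: "(i < length Xs \<and> j < length Ys \<and> linked (map reflect Ys ! j) (map reflect Xs ! i)) \<longleftrightarrow>
      (j < length Ys \<and> i < length Xs \<and> linked (Xs ! i) (Ys ! j))" for i j
    by (cases "i < length Xs"; cases "j < length Ys") (simp_all add: linked_reflect)
  show ?thesis unfolding matrices_def mem_Collect_eq length_map pt by blast
qed

lemma live_mult_transp:
  assumes "N \<in> matrices linked Ys Zs" "M \<in> matrices linked Xs Ys"
  shows "live_mult (map reflect Zs) (map reflect Ys) (map reflect Xs) (flip M) (flip N) =
    flip (live_mult Xs Ys Zs N M)"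
proof (intro ext)
  fix i j
  show "live_mult (map reflect Zs) (map reflect Ys) (map reflect Xs) (flip M) (flip N) i j =
    live_mult Xs Ys Zs N M j i"
    unfolding live_mult_def
  proof (rule sum.cong)
    fix s assume s: "s \<in> {..<length Ys}"
    show "(if composable (map reflect Zs ! j) (map reflect Ys ! s) (map reflect Xs ! i) then M s i * N j s else 0) =
      (if composable (Xs ! i) (Ys ! s) (Zs ! j) then N j s * M s i else 0)"
    proof (cases "M s i = 0 \<or> N j s = 0")
      case False
      then have "i < length Xs" "j < length Zs" using assms unfolding matrices_def by blast+
      then show ?thesis using s by (simp add: composable_reflect mult.commute)
    qed auto
  qed simp
qed

theorem matrix_cokernel:
  fixes f :: "nat \<Rightarrow> nat \<Rightarrow> 'k::field"
  assumes f: "f \<in> matrices linked Xs Ys"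
  shows "\<exists>Zs c. (\<forall>z\<in>set Zs. live z z) \<and> c \<in> matrices linked Ys Zs \<and> live_mult Xs Ys Zs c f = (\<lambda>i j. 0) \<and>
     (\<forall>Ws. \<forall>g\<in>matrices linked Ys Ws. live_mult Xs Ys Ws g f = (\<lambda>i j. 0) \<longrightarrow>
        (\<exists>!u. u \<in> matrices linked Zs Ws \<and> live_mult Ys Zs Ws u c = g))"
proof -
  let ?r = "map reflect"
  have rr: "?r (?r As) = As" for As by (induction As) auto
  have "flip f \<in> matrices linked (?r Ys) (?r Xs)" using f mat_transp by blast
  from matrix_kernel[OF this] obtain Vs k where
    V: "\<forall>z\<in>set Vs. live z z" "k \<in> matrices linked Vs (?r Ys)" "live_mult Vs (?r Ys) (?r Xs) (flip f) k = (\<lambda>i j. 0)"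
    and V3: "\<forall>Ws. \<forall>g\<in>matrices linked Ws (?r Ys). live_mult Ws (?r Ys) (?r Xs) (flip f) g = (\<lambda>i j. 0) \<longrightarrow>
        (\<exists>!u. u \<in> matrices linked Ws Vs \<and> live_mult Ws Vs (?r Ys) k u = g)"
    by (elim exE conjE)
  note Vu = V3[rule_format]
  define Zs where "Zs = ?r Vs"
  have Vs: "Vs = ?r Zs" unfolding Zs_def by (rule rr[symmetric])
  have c: "flip k \<in> matrices linked Ys Zs" using V(2) mat_transp[of "flip k" Zs Ys] Vs by simp
  show ?thesis
  proof (intro exI[of _ Zs] exI[of _ "flip k"] conjI allI ballI impI)
    show "live z z" if "z \<in> set Zs" for z using that V(1) unfolding Zs_def by auto
    show "flip k \<in> matrices linked Ys Zs" by (rule c)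
    show "live_mult Xs Ys Zs (flip k) f = (\<lambda>i j. 0)"
      using live_mult_transp[OF c f] V(3) unfolding Vs by (auto simp: fun_eq_iff)
    fix Ws and g :: "nat \<Rightarrow> nat \<Rightarrow> 'k" assume g: "g \<in> matrices linked Ys Ws" "live_mult Xs Ys Ws g f = (\<lambda>i j. 0)"
    have "flip g \<in> matrices linked (?r Ws) (?r Ys)" using g mat_transp by blast
    moreover have "live_mult (?r Ws) (?r Ys) (?r Xs) (flip f) (flip g) = (\<lambda>i j. 0)"
      using live_mult_transp[OF g(1) f] g(2) by simp
    ultimately have "\<exists>!u. u \<in> matrices linked (?r Ws) Vs \<and> live_mult (?r Ws) Vs (?r Ys) k u = flip g"
      by (rule Vu)
    then obtain u where u: "u \<in> matrices linked (?r Ws) Vs" "live_mult (?r Ws) Vs (?r Ys) k u = flip g"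
      and uu: "\<And>u'. u' \<in> matrices linked (?r Ws) Vs \<Longrightarrow> live_mult (?r Ws) Vs (?r Ys) k u' = flip g \<Longrightarrow> u' = u"
      by blast
    have eq: "live_mult (?r Ws) Vs (?r Ys) k (flip v) = flip (live_mult Ys Zs Ws v (flip k))"
      if "v \<in> matrices linked Zs Ws" for v
      using live_mult_transp[OF that c] by (simp add: Vs)
    have tm: "flip v \<in> matrices linked (?r Ws) Vs \<longleftrightarrow> v \<in> matrices linked Zs Ws" for v :: "nat \<Rightarrow> nat \<Rightarrow> 'k"
      unfolding Vs by (rule mat_transp)
    show "\<exists>!u. u \<in> matrices linked Zs Ws \<and> live_mult Ys Zs Ws u (flip k) = g"
    proof (rule ex1I[of _ "flip u"], intro conjI)
      show u': "flip u \<in> matrices linked Zs Ws" using u(1) tm[of "flip u"] by simp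
      have "flip (live_mult Ys Zs Ws (flip u) (flip k)) = flip g"
        using eq[OF u'] u(2) by simp
      then show "live_mult Ys Zs Ws (flip u) (flip k) = g" by (auto simp: fun_eq_iff)
    next
      fix v assume v: "v \<in> matrices linked Zs Ws \<and> live_mult Ys Zs Ws v (flip k) = g"
      then have "flip v = u" using uu[of "flip v"] eq tm by simp
      then show "v = flip u" by (auto simp: fun_eq_iff)
    qed
  qed
qed

section \<open>Quotient modules as modules of fibres\<close>

lemma abelian_group_image:
  fixes c :: "'v::ab_group_add \<Rightarrow> 'm" and M (structure)
  assumes carr: "carrier M = c ` D" and D0: "0 \<in> D" and Dadd: "\<And>x y. x \<in> D \<Longrightarrow> y \<in> D \<Longrightarrow> x + y \<in> D"
    and Dneg: "\<And>x. x \<in> D \<Longrightarrow> - x \<in> D"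
    and add: "\<And>x y. x \<in> D \<Longrightarrow> y \<in> D \<Longrightarrow> c x \<oplus> c y = c (x + y)" and zero: "\<zero> = c 0"
  shows "abelian_group M"
proof (rule abelian_groupI)
  show "\<zero> \<in> carrier M" unfolding zero carr using D0 by blast
  show "x \<oplus> y \<in> carrier M" if "x \<in> carrier M" "y \<in> carrier M" for x y
    using that add Dadd unfolding carr by auto
  show "x \<oplus> y \<oplus> z = x \<oplus> (y \<oplus> z)" if "x \<in> carrier M" "y \<in> carrier M" "z \<in> carrier M" for x y z
    using that add Dadd unfolding carr by (auto simp: add.assoc)
  show "x \<oplus> y = y \<oplus> x" if "x \<in> carrier M" "y \<in> carrier M" for x y
    using that add unfolding carr by (auto simp: add.commute)
  show "\<zero> \<oplus> x = x" if "x \<in> carrier M" for x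
    using that add[OF D0] unfolding carr zero by auto
  show "\<exists>y\<in>carrier M. y \<oplus> x = \<zero>" if x: "x \<in> carrier M" for x
  proof -
    obtain v where v: "v \<in> D" "x = c v" using x unfolding carr by blast
    then have "c (- v) \<in> carrier M" "c (- v) \<oplus> x = \<zero>"
      using add[of "- v" v] Dneg unfolding carr zero by auto
    then show ?thesis by blast
  qed
qed

text \<open>
  If the kernel of an additive map is the ideal that is divided out, the cosets are the fibres of the map. This
  is used for both quotients, that by the thick points and that by \<open>\<T>\<close>.
\<close>

lemma fibre_quotient:
  fixes \<Phi> :: "'m \<Rightarrow> 'v::ab_group_add" and M :: "('k, 'm) module"
  assumes M: "abelian_group M"
    and add: "\<And>x y. x \<in> carrier M \<Longrightarrow> y \<in> carrier M \<Longrightarrow> \<Phi> (x \<oplus>\<^bsub>M\<^esub> y) = \<Phi> x + \<Phi> y"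
    and N: "N = {x \<in> carrier M. \<Phi> x = 0}"
  defines "fib \<equiv> \<lambda>v. {x \<in> carrier M. \<Phi> x = v}"
  shows fibre_coset: "\<And>x. x \<in> carrier M \<Longrightarrow> N +>\<^bsub>M\<^esub> x = fib (\<Phi> x)"
    and fibre_carrier: "carrier (quot_module M N) = fib ` \<Phi> ` carrier M"
    and fibre_zero: "\<zero>\<^bsub>quot_module M N\<^esub> = fib 0"
    and fibre_add: "\<And>u v. u \<in> \<Phi> ` carrier M \<Longrightarrow> v \<in> \<Phi> ` carrier M \<Longrightarrow>
        fib u \<oplus>\<^bsub>quot_module M N\<^esub> fib v = fib (u + v)"
proof -
  interpret abelian_group M by (rule M)
  have \<Phi>0: "\<Phi> \<zero>\<^bsub>M\<^esub> = 0" using add[of "\<zero>\<^bsub>M\<^esub>" "\<zero>\<^bsub>M\<^esub>"] by simp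
  have \<Phi>neg: "\<Phi> (\<ominus>\<^bsub>M\<^esub> x) = - \<Phi> x" if "x \<in> carrier M" for x
    using add[of "\<ominus>\<^bsub>M\<^esub> x" x] that \<Phi>0 by (simp add: l_neg eq_neg_iff_add_eq_0)
  show coset: "N +>\<^bsub>M\<^esub> x = fib (\<Phi> x)" if x: "x \<in> carrier M" for x
  proof
    show "N +>\<^bsub>M\<^esub> x \<subseteq> fib (\<Phi> x)" using x add unfolding a_r_coset_def' N fib_def by auto
    show "fib (\<Phi> x) \<subseteq> N +>\<^bsub>M\<^esub> x"
    proof
      fix y assume "y \<in> fib (\<Phi> x)"
      then have y: "y \<in> carrier M" "\<Phi> y = \<Phi> x" by (auto simp: fib_def)
      have "y \<oplus>\<^bsub>M\<^esub> \<ominus>\<^bsub>M\<^esub> x \<in> N" using x y add[of y "\<ominus>\<^bsub>M\<^esub> x"] \<Phi>neg unfolding N by simp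
      moreover have "y = y \<oplus>\<^bsub>M\<^esub> \<ominus>\<^bsub>M\<^esub> x \<oplus>\<^bsub>M\<^esub> x" using x y by (simp add: a_assoc l_neg)
      ultimately show "y \<in> N +>\<^bsub>M\<^esub> x" unfolding a_r_coset_def' by blast
    qed
  qed
  show carr: "carrier (quot_module M N) = fib ` \<Phi> ` carrier M"
    using coset unfolding quot_module_def hom_module_def A_RCOSETS_def' by auto
  show "\<zero>\<^bsub>quot_module M N\<^esub> = fib 0"
    unfolding quot_module_def hom_module_def fib_def N by simp
  show "fib u \<oplus>\<^bsub>quot_module M N\<^esub> fib v = fib (u + v)" if uv: "u \<in> \<Phi> ` carrier M" "v \<in> \<Phi> ` carrier M" for u v
  proof -
    have "fib u \<oplus>\<^bsub>quot_module M N\<^esub> fib v = (\<Union>h\<in>fib u. \<Union>k\<in>fib v. {h \<oplus>\<^bsub>M\<^esub> k})"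
      unfolding quot_module_def hom_module_def set_add_def' by simp
    also have "\<dots> = fib (u + v)"
    proof
      show "(\<Union>h\<in>fib u. \<Union>k\<in>fib v. {h \<oplus>\<^bsub>M\<^esub> k}) \<subseteq> fib (u + v)" using add by (auto simp: fib_def)
      show "fib (u + v) \<subseteq> (\<Union>h\<in>fib u. \<Union>k\<in>fib v. {h \<oplus>\<^bsub>M\<^esub> k})"
      proof
        fix z assume "z \<in> fib (u + v)"
        then have z: "z \<in> carrier M" "\<Phi> z = u + v" by (auto simp: fib_def)
        obtain k where k: "k \<in> carrier M" "\<Phi> k = v" using uv by blast
        have "z \<oplus>\<^bsub>M\<^esub> \<ominus>\<^bsub>M\<^esub> k \<in> fib u" using z k add[of z "\<ominus>\<^bsub>M\<^esub> k"] \<Phi>neg[of k] by (simp add: fib_def)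
        moreover have "k \<in> fib v" using k by (simp add: fib_def)
        moreover have "z = z \<oplus>\<^bsub>M\<^esub> \<ominus>\<^bsub>M\<^esub> k \<oplus>\<^bsub>M\<^esub> k" using z k by (simp add: a_assoc l_neg)
        ultimately show "z \<in> (\<Union>h\<in>fib u. \<Union>k\<in>fib v. {h \<oplus>\<^bsub>M\<^esub> k})" by blast
      qed
    qed
    finally show ?thesis .
  qed
qed

section \<open>Morphisms of the derived category as matrices\<close>

text \<open>
  The rectangle of \<open>p\<close> and \<open>q\<close> stays inside the strip, so that the basic morphism is nonzero in \<open>\<D>\<close>.
\<close>

definition valid :: "point \<Rightarrow> point \<Rightarrow> bool" where
  "valid p q \<longleftrightarrow> below p q \<and> fst q < snd p + pi \<and> snd q < fst p + pi"

definition trunc :: "point list \<Rightarrow> point list \<Rightarrow> 'k::field matrix \<Rightarrow> 'k matrix" where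
  "trunc P Q M i j = (if i < length Q \<and> j < length P \<and> valid (P ! j) (Q ! i) then M i j else 0)"

text \<open>
  A morphism of \<open>\<D>\<close> is a class of matrices that agree at the valid pairs; it is represented by the matrix
  that vanishes elsewhere.
\<close>

definition D_class :: "point list \<Rightarrow> point list \<Rightarrow> 'k::field matrix \<Rightarrow> 'k matrix set" where
  "D_class P Q N = {M \<in> matrices below P Q. trunc P Q M = N}"

definition mat_mult :: "nat \<Rightarrow> 'k::field matrix \<Rightarrow> 'k matrix \<Rightarrow> 'k matrix" where
  "mat_mult n N M i j = (\<Sum>s<n. N i s * M s j)"

abbreviation thick :: "point list set" where
  "thick \<equiv> lists {(x, y). \<bar>y - x\<bar> \<ge> pi}"

definition D_hom :: "point list \<Rightarrow> point list \<Rightarrow> ('k::field, 'k matrix set) module" where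
  "D_hom P Q = quot_module (Hom B_cat P Q) (factor_ideal B_cat thick P Q)"

lemma matrices_closed:
  "0 \<in> matrices R P Q" "M \<in> matrices R P Q \<Longrightarrow> N \<in> matrices R P Q \<Longrightarrow> M + N \<in> matrices R P Q"
  "M \<in> matrices R P Q \<Longrightarrow> - M \<in> matrices R P Q"
  unfolding matrices_def by (simp, simp, metis add.right_neutral add_cancel_right_right, simp)

lemma B_hom:
  "carrier (Hom B_cat P Q) = matrices below P Q" "M \<oplus>\<^bsub>Hom B_cat P Q\<^esub> N = M + N" "\<zero>\<^bsub>Hom B_cat P Q\<^esub> = 0"
  "Comp B_cat P Q R N M = mat_mult (length Q) N M"
  by (auto simp: B_cat_def hom_module_def matrices_def fun_eq_iff mat_mult_def)

lemma B_hom_group: "abelian_group (Hom B_cat P Q :: ('k::field, 'k matrix) module)"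
  by (rule abelian_group_image[where c = id and D = "matrices below P Q"])
    (simp_all add: B_hom matrices_closed)

lemma valid_below: "valid p q \<Longrightarrow> below p q" by (simp add: valid_def)

lemma valid_between:
  assumes "valid p r" "below p q" "below q r"
  shows "valid p q" "valid q r"
  using assms unfolding valid_def below_def by auto

lemma valid_subset: "M \<in> matrices valid P Q \<Longrightarrow> M \<in> matrices below P Q"
  unfolding matrices_def using valid_below by blast

lemma trunc_valid: "M \<in> matrices valid P Q \<Longrightarrow> trunc P Q M = M"
  unfolding matrices_def trunc_def by (intro ext) auto

lemma trunc_mem: "trunc P Q M \<in> matrices valid P Q"
  unfolding matrices_def trunc_def by auto

lemma trunc_add: "trunc P Q (M + N) = trunc P Q M + trunc P Q N"
  unfolding trunc_def by (intro ext) auto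

lemma trunc_image: "trunc P Q ` matrices below P Q = matrices valid P Q"
proof
  show "trunc P Q ` matrices below P Q \<subseteq> matrices valid P Q" using trunc_mem by blast
  show "matrices valid P Q \<subseteq> trunc P Q ` matrices below P Q"
    using trunc_valid valid_subset by (metis image_eqI subsetI)
qed

lemma mat_mult_below:
  assumes "N \<in> matrices below Q R" "M \<in> matrices below P Q"
  shows "mat_mult n N M \<in> matrices below P R"
  unfolding matrices_def
proof (intro CollectI allI impI)
  fix i j assume "mat_mult n N M i j \<noteq> 0"
  then obtain s where "N i s * M s j \<noteq> 0" unfolding mat_mult_def by (rule sum.not_neutral_contains_not_neutral)
  then have "N i s \<noteq> 0" "M s j \<noteq> 0" by auto
  then show "i < length R \<and> j < length P \<and> below (P ! j) (R ! i)"
    using assms below_trans unfolding matrices_def by blast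
qed

lemma trunc_mat_mult:
  assumes "N \<in> matrices below Q R" "M \<in> matrices below P Q"
  shows "trunc P R (mat_mult n N M) = trunc P R (mat_mult n (trunc Q R N) (trunc P Q M))"
proof (intro ext)
  fix i j
  have "N i s * M s j = trunc Q R N i s * trunc P Q M s j" if "valid (P ! j) (R ! i)" for s
  proof (cases "N i s = 0 \<or> M s j = 0")
    case True
    then show ?thesis by (auto simp: trunc_def)
  next
    case False
    then have *: "i < length R" "s < length Q" "below (Q ! s) (R ! i)" "j < length P" "below (P ! j) (Q ! s)"
      using assms unfolding matrices_def by blast+
    then show ?thesis using valid_between[OF that *(5,3)] by (simp add: trunc_def)
  qed
  then show "trunc P R (mat_mult n N M) i j = trunc P R (mat_mult n (trunc Q R N) (trunc P Q M)) i j"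
    unfolding trunc_def[of P R] mat_mult_def by (auto intro!: sum.cong)
qed

lemma thick_between_iff:
  assumes "below p q"
  shows "(\<exists>z. below p z \<and> below z q \<and> \<bar>snd z - fst z\<bar> \<ge> pi) \<longleftrightarrow> \<not> valid p q"
proof
  assume "\<exists>z. below p z \<and> below z q \<and> \<bar>snd z - fst z\<bar> \<ge> pi"
  then show "\<not> valid p q" by (auto simp: valid_def below_def abs_if split: if_splits)
next
  assume "\<not> valid p q"
  then consider "fst p + pi \<le> snd q" | "snd p + pi \<le> fst q"
    using assms unfolding valid_def by force
  then show "\<exists>z. below p z \<and> below z q \<and> \<bar>snd z - fst z\<bar> \<ge> pi"
  proof cases
    case 1
    then show ?thesis using assms by (intro exI[of _ "(fst p, snd q)"]) (auto simp: below_def)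
  next
    case 2
    then show ?thesis using assms by (intro exI[of _ "(fst q, snd p)"]) (auto simp: below_def)
  qed
qed

text \<open>
  A matrix whose nonzero entries are at invalid pairs factors through the sum of one thick point for each
  of these entries.
\<close>

lemma B_ideal: "factor_ideal B_cat thick P Q = {M \<in> carrier (Hom B_cat P Q). trunc P Q M = (0 :: 'k::field matrix)}"
proof
  show "factor_ideal B_cat thick P Q \<subseteq> {M \<in> carrier (Hom B_cat P Q). trunc P Q M = (0 :: 'k matrix)}"
  proof
    fix m :: "'k matrix" assume "m \<in> factor_ideal B_cat thick P Q"
    then obtain Z f g where m: "m = mat_mult (length Z) g f" and Z: "Z \<in> thick"
      and f: "f \<in> matrices below P Z" and g: "g \<in> matrices below Z Q"
      unfolding factor_ideal_def B_hom by blast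
    have "trunc Z Q g = 0"
    proof -
      have "\<not> valid (Z ! s) q" if "s < length Z" for s q
      proof
        assume v: "valid (Z ! s) q"
        have "Z ! s \<in> {(x, y). \<bar>y - x\<bar> \<ge> pi}" using Z nth_mem[OF that] by (auto simp del: nth_mem)
        then have "\<bar>snd (Z ! s) - fst (Z ! s)\<bar> \<ge> pi" by (auto simp: split_beta)
        then show False using thick_between_iff[OF valid_below[OF v]] v valid_below[OF v] by auto
      qed
      then show ?thesis unfolding trunc_def by (intro ext) (simp, blast)
    qed
    moreover have "mat_mult n (0 :: 'k matrix) M = 0" "trunc P Q (0 :: 'k matrix) = 0" for n M
      by (intro ext, simp add: mat_mult_def trunc_def)+
    ultimately have "trunc P Q m = 0"
      unfolding m trunc_mat_mult[OF g f] by simp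
    then show "m \<in> {M \<in> carrier (Hom B_cat P Q). trunc P Q M = 0}"
      using mat_mult_below[OF g f] by (simp add: B_hom m)
  qed
  show "{M \<in> carrier (Hom B_cat P Q). trunc P Q M = (0 :: 'k matrix)} \<subseteq> factor_ideal B_cat thick P Q"
  proof
    fix M :: "'k matrix" assume "M \<in> {M \<in> carrier (Hom B_cat P Q). trunc P Q M = 0}"
    then have M: "M i j \<noteq> 0 \<Longrightarrow> i < length Q \<and> j < length P \<and> below (P ! j) (Q ! i)"
      and M0: "trunc P Q M i j = 0" for i j
      unfolding B_hom matrices_def by auto
    define E where "E = {(i, j). M i j \<noteq> 0}"
    have "E \<subseteq> {..<length Q} \<times> {..<length P}" using M unfolding E_def by auto
    then have "finite E" by (rule finite_subset) simp
    define n where "n = card E"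
    obtain e where e: "bij_betw e {..<n} E"
      using ex_bij_betw_nat_finite[OF \<open>finite E\<close>] unfolding n_def lessThan_atLeast0 by blast
    have "\<exists>z. below (P ! j) z \<and> below z (Q ! i) \<and> \<bar>snd z - fst z\<bar> \<ge> pi" if "M i j \<noteq> 0" for i j
    proof -
      have "\<not> valid (P ! j) (Q ! i)" using M0[of i j] M that by (auto simp: trunc_def split: if_splits)
      then show ?thesis using thick_between_iff M[OF that] by blast
    qed
    then obtain z where z: "\<And>i j. M i j \<noteq> 0 \<Longrightarrow>
        below (P ! j) (z i j) \<and> below (z i j) (Q ! i) \<and> \<bar>snd (z i j) - fst (z i j)\<bar> \<ge> pi"
      by metis
    have eE: "l < n \<Longrightarrow> M (fst (e l)) (snd (e l)) \<noteq> 0" for l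
      using e unfolding bij_betw_def E_def by force
    define Z where "Z = map (\<lambda>l. z (fst (e l)) (snd (e l))) [0..<n]"
    have Z: "length Z = n" "l < n \<Longrightarrow> Z ! l = z (fst (e l)) (snd (e l))" for l by (simp_all add: Z_def)
    have eF: "fst (e l) < length Q \<and> snd (e l) < length P \<and> below (P ! snd (e l)) (Z ! l) \<and>
        below (Z ! l) (Q ! fst (e l))" if "l < n" for l
      using M[OF eE[OF that]] z[OF eE[OF that]] Z(2)[OF that] by simp
    define f :: "'k matrix" where "f l j = (if l < n \<and> j = snd (e l) then 1 else 0)" for l j
    define g :: "'k matrix" where "g i l = (if l < n \<and> i = fst (e l) then M i (snd (e l)) else 0)" for i l
    have "x \<in> {(x, y). \<bar>y - x\<bar> \<ge> pi}" if "x \<in> set Z" for x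
    proof -
      obtain l where "l < n" "x = z (fst (e l)) (snd (e l))" using \<open>x \<in> set Z\<close> unfolding Z_def by auto
      then show ?thesis using z[OF eE[of l]] by (simp add: split_beta)
    qed
    then have "Z \<in> thick" by blast
    moreover have "f \<in> matrices below P Z"
      unfolding matrices_def using eF by (auto simp: f_def Z(1) split: if_splits)
    moreover have "g \<in> matrices below Z Q"
      unfolding matrices_def using eF by (auto simp: g_def Z(1) split: if_splits)
    moreover have "M = mat_mult (length Z) g f"
    proof (intro ext)
      fix i j
      have "mat_mult (length Z) g f i j = (\<Sum>l<n. if e l = (i, j) then M i j else 0)"
        unfolding mat_mult_def Z by (intro sum.cong) (auto simp: f_def g_def prod_eq_iff)
      also have "\<dots> = (\<Sum>x\<in>E. if x = (i, j) then M i j else 0)"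
        using sum.reindex_bij_betw[OF e, of "\<lambda>x. if x = (i, j) then M i j else 0"] by simp
      also have "\<dots> = M i j" using \<open>finite E\<close> by (auto simp: E_def)
      finally show "M i j = mat_mult (length Z) g f i j" by simp
    qed
    ultimately show "M \<in> factor_ideal B_cat thick P Q"
      unfolding factor_ideal_def B_hom by blast
  qed
qed

lemma D_hom:
  fixes u v :: "'k::field matrix"
  shows D_hom_carrier: "carrier (D_hom P Q) = (D_class P Q ` matrices valid P Q :: 'k matrix set set)"
    and D_hom_zero: "\<zero>\<^bsub>D_hom P Q\<^esub> = (D_class P Q 0 :: 'k matrix set)"
    and D_hom_add: "u \<in> matrices valid P Q \<Longrightarrow> v \<in> matrices valid P Q \<Longrightarrow>
        D_class P Q u \<oplus>\<^bsub>D_hom P Q\<^esub> D_class P Q v = D_class P Q (u + v)"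
    and D_coset: "M \<in> matrices below P Q \<Longrightarrow>
        factor_ideal B_cat thick P Q +>\<^bsub>Hom B_cat P Q\<^esub> M = D_class P Q (trunc P Q M :: 'k matrix)"
proof -
  have add: "trunc P Q (x \<oplus>\<^bsub>Hom B_cat P Q\<^esub> y) = trunc P Q x + trunc P Q y" for x y :: "'k matrix"
    by (simp add: B_hom trunc_add)
  have c: "{x \<in> carrier (Hom B_cat P Q). trunc P Q x = v} = D_class P Q v" for v :: "'k matrix"
    by (simp add: D_class_def B_hom)
  note F = fibre_quotient[where \<Phi> = "trunc P Q", OF B_hom_group add B_ideal, unfolded c, folded D_hom_def]
  show "carrier (D_hom P Q) = (D_class P Q ` matrices valid P Q :: 'k matrix set set)"
    using F(2) by (simp add: B_hom trunc_image)
  show "\<zero>\<^bsub>D_hom P Q\<^esub> = (D_class P Q 0 :: 'k matrix set)" by (rule F(3))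
  show "u \<in> matrices valid P Q \<Longrightarrow> v \<in> matrices valid P Q \<Longrightarrow>
        D_class P Q u \<oplus>\<^bsub>D_hom P Q\<^esub> D_class P Q v = D_class P Q (u + v)"
    by (rule F(4)) (simp_all add: B_hom trunc_image)
  show "M \<in> matrices below P Q \<Longrightarrow>
        factor_ideal B_cat thick P Q +>\<^bsub>Hom B_cat P Q\<^esub> M = D_class P Q (trunc P Q M :: 'k matrix)" for M
    by (rule F(1)) (simp add: B_hom)
qed

lemma D_hom_group: "abelian_group (D_hom P Q :: ('k::field, 'k matrix set) module)"
  by (rule abelian_group_image[where c = "D_class P Q" and D = "matrices valid P Q"])
    (simp_all add: D_hom_carrier D_hom_zero D_hom_add matrices_closed)

lemma D_class_mem: "N \<in> matrices valid P Q \<Longrightarrow> N \<in> D_class P Q N"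
  by (simp add: D_class_def valid_subset trunc_valid)

lemma D_class_inject: "M \<in> matrices valid P Q \<Longrightarrow> D_class P Q M = D_class P Q N \<longleftrightarrow> M = N"
proof
  assume M: "M \<in> matrices valid P Q" and "D_class P Q M = D_class P Q N"
  then have "M \<in> D_class P Q N" using D_class_mem[OF M] by simp
  then show "M = N" using trunc_valid[OF M] by (simp add: D_class_def)
qed simp

lemma D2_hom: "Hom D2_cat X Y = D_hom (map fst X) (map fst Y)"
  by (simp add: D2_cat_def doubled_def D_cat_def full_subcat_def quot_cat_def D_hom_def)

lemma D2_comp:
  fixes N M :: "'k::field matrix"
  assumes PQR: "P = map fst X" "Q = map fst Y" "R = map fst Z"
    and N: "N \<in> matrices valid Q R" and M: "M \<in> matrices valid P Q"
  shows "Comp D2_cat X Y Z (D_class Q R N) (D_class P Q M) = D_class P R (trunc P R (mat_mult (length Q) N M))"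
proof -
  have "Comp D2_cat X Y Z (D_class Q R N) (D_class P Q M) =
      (\<Union>g\<in>D_class Q R N. \<Union>f\<in>D_class P Q M. factor_ideal B_cat thick P R +>\<^bsub>Hom B_cat P R\<^esub> Comp B_cat P Q R g f)"
    by (simp add: D2_cat_def doubled_def D_cat_def full_subcat_def quot_cat_def PQR)
  also have "\<dots> = (\<Union>g\<in>D_class Q R N. \<Union>f\<in>D_class P Q M. D_class P R (trunc P R (mat_mult (length Q) N M)))"
  proof (intro SUP_cong refl)
    fix g f assume g: "g \<in> D_class Q R N" and f: "f \<in> D_class P Q M"
    then have gf: "g \<in> matrices below Q R" "f \<in> matrices below P Q" "trunc Q R g = N" "trunc P Q f = M"
      by (auto simp: D_class_def)
    show "factor_ideal B_cat thick P R +>\<^bsub>Hom B_cat P R\<^esub> Comp B_cat P Q R g f =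
        D_class P R (trunc P R (mat_mult (length Q) N M))"
      unfolding B_hom(4) D_coset[OF mat_mult_below[OF gf(1,2)]] trunc_mat_mult[OF gf(1,2)] gf(3,4) ..
  qed
  also have "\<dots> = D_class P R (trunc P R (mat_mult (length Q) N M))"
    using D_class_mem[OF N] D_class_mem[OF M] by blast
  finally show ?thesis .
qed

definition idm :: "point list \<Rightarrow> 'k::field matrix" where
  "idm P i j = (if i = j \<and> i < length P \<and> valid (P ! i) (P ! i) then 1 else 0)"

lemma idm_mem: "idm P \<in> matrices valid P P"
  by (auto simp: idm_def matrices_def split: if_splits)

lemma D2_idn: "P = map fst X \<Longrightarrow> Idn D2_cat X = D_class P P (idm P :: 'k::field matrix)"
proof -
  assume P: "P = map fst X"
  have I: "(\<lambda>i j. if i = j \<and> i < length P then 1 else 0) \<in> (matrices below P P :: 'k matrix set)"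
    by (auto simp: matrices_def split: if_splits)
  have "Idn D2_cat X = factor_ideal B_cat thick P P +>\<^bsub>Hom B_cat P P\<^esub> (\<lambda>i j. if i = j \<and> i < length P then 1 else (0::'k))"
    by (simp add: D2_cat_def doubled_def D_cat_def full_subcat_def quot_cat_def P B_cat_def)
  also have "\<dots> = D_class P P (trunc P P (\<lambda>i j. if i = j \<and> i < length P then 1 else (0::'k)))"
    by (rule D_coset[OF I])
  also have "trunc P P (\<lambda>i j. if i = j \<and> i < length P then 1 else (0::'k)) = idm P"
    by (auto simp: trunc_def idm_def fun_eq_iff)
  finally show ?thesis .
qed

section \<open>Morphisms of the cluster category as families of matrices\<close>

text \<open>
  The summands of an object of \<open>\<C>\<close>, in the lifts given by the representative of the orbit.
\<close>

definition pts :: "(point \<times> bool) list set \<Rightarrow> point list" where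
  "pts A = map fst (orbit_rep A)"

abbreviation shift :: "int \<Rightarrow> point list \<Rightarrow> point list" where
  "shift k \<equiv> map (Fpow k)"

lemma shift_shift [simp]: "map (Fpow k \<circ> Fpow l) P = shift (k + l) P"
  by (simp add: comp_def)

lemma shift_0 [simp]: "shift 0 P = P"
  by (induction P) auto

lemma map_fst_iterate: "map fst (int_iterate (map F_ind) k X) = shift k (map fst X)"
proof -
  have pos: "map fst ((map F_ind ^^ n) X) = shift (int n) (map fst X)" for n X
  proof (induction n)
    case (Suc n)
    have "map fst ((map F_ind ^^ Suc n) X) = map swap_pt (map fst ((map F_ind ^^ n) X))"
      unfolding funpow.simps comp_def map_fst_F ..
    also have "map swap_pt = shift 1" by (auto simp: Fpow_1 fun_eq_iff)
    finally show ?case unfolding Suc by (simp add: add.commute)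
  qed simp
  have inv: "map fst (inv_into UNIV (map F_ind) X) = shift (- 1) (map fst X)" for X
  proof -
    obtain Y where Y: "X = map F_ind Y" using bij_map_F by (metis bij_def surj_def)
    have "inv_into UNIV (map F_ind) X = Y" unfolding Y by (rule inv_into_f_f[OF bij_is_inj[OF bij_map_F] UNIV_I])
    moreover have "map fst X = shift 1 (map fst Y)"
      unfolding Y map_fst_F by (simp add: Fpow_1[abs_def, symmetric] flip: Fpow_1)
    ultimately show ?thesis by simp
  qed
  have neg: "map fst ((inv_into UNIV (map F_ind) ^^ n) X) = shift (- int n) (map fst X)" for n
  proof (induction n)
    case (Suc n)
    have "map fst ((inv_into UNIV (map F_ind) ^^ Suc n) X) =
        shift (- 1) (map fst ((inv_into UNIV (map F_ind) ^^ n) X))"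
      unfolding funpow.simps comp_def inv ..
    then show ?case unfolding Suc by simp
  qed simp
  show ?thesis
    using pos[of "nat k" X] neg[of "nat (- k)"] by (simp add: int_iterate_def)
qed

lemma int_iterate_id: "int_iterate (\<lambda>A. A) k x = x"
proof -
  have "(\<lambda>A. A) = (id :: 'a \<Rightarrow> 'a)" by auto
  then show ?thesis unfolding int_iterate_def by (simp add: id_def[symmetric] del: id_apply) (simp add: id_def)
qed

lemma pts_orbit: "\<exists>k. pts (orbit_of (map F_ind) X) = shift k (map fst X)"
proof -
  have "int_iterate (map F_ind) 0 X \<in> orbit_of (map F_ind) X" unfolding orbit_of_def by blast
  then have "orbit_rep (orbit_of (map F_ind) X) \<in> orbit_of (map F_ind) X"
    unfolding orbit_rep_def by (rule someI)
  then obtain k where "orbit_rep (orbit_of (map F_ind) X) = int_iterate (map F_ind) k X"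
    unfolding orbit_of_def by blast
  then show ?thesis unfolding pts_def by (auto simp: map_fst_iterate)
qed

lemma matrices_valid_shift: "matrices valid (shift i P) (shift i Q) = matrices valid P Q"
proof -
  have v: "valid (Fpow i p) (Fpow i q) \<longleftrightarrow> valid p q" for p q
    unfolding valid_def below_Fpow by (auto simp: Fpow_def)
  have "i' < length Q \<and> j < length P \<and> valid (shift i P ! j) (shift i Q ! i') \<longleftrightarrow>
      i' < length Q \<and> j < length P \<and> valid (P ! j) (Q ! i')" for i' j
    by (cases "i' < length Q"; cases "j < length P") (simp_all add: v)
  then show ?thesis unfolding matrices_def length_map by (simp only:)
qed

lemma D_class_shift: "D_class (shift i P) (shift i Q) N = D_class P Q (N :: 'k::field matrix)"
proof -
  have v: "valid (Fpow i p) (Fpow i q) \<longleftrightarrow> valid p q" for p q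
    unfolding valid_def below_Fpow by (auto simp: Fpow_def)
  have "matrices below (shift i P) (shift i Q) = (matrices below P Q :: 'k matrix set)"
  proof -
    have "i' < length Q \<and> j < length P \<and> below (shift i P ! j) (shift i Q ! i') \<longleftrightarrow>
        i' < length Q \<and> j < length P \<and> below (P ! j) (Q ! i')" for i' j
      by (cases "i' < length Q"; cases "j < length P") simp_all
    then show ?thesis unfolding matrices_def length_map by (simp only:)
  qed
  moreover have "trunc (shift i P) (shift i Q) M = trunc P Q M" for M :: "'k matrix"
    by (intro ext) (auto simp: trunc_def v)
  ultimately show ?thesis unfolding D_class_def by simp
qed

text \<open>
  A morphism of \<open>\<C>\<close> is a family of morphisms of \<open>\<D>\<close>, with index the power of \<open>F\<close>; here each of them is
  given by its representing matrix.
\<close>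

definition families :: "point list \<Rightarrow> point list \<Rightarrow> (int \<Rightarrow> 'k::field matrix) set" where
  "families P Q = {G. (\<forall>k. G k \<in> matrices valid P (shift k Q)) \<and> finite {k. G k \<noteq> 0}}"

definition C_family :: "point list \<Rightarrow> point list \<Rightarrow> (int \<Rightarrow> 'k::field matrix) \<Rightarrow> int \<Rightarrow> 'k matrix set" where
  "C_family P Q G k = D_class P (shift k Q) (G k)"

definition family_comp :: "point list \<Rightarrow> point list \<Rightarrow> point list \<Rightarrow>
    (int \<Rightarrow> 'k::field matrix) \<Rightarrow> (int \<Rightarrow> 'k matrix) \<Rightarrow> int \<Rightarrow> 'k matrix" where
  "family_comp P Q R G H k = (\<Sum>i | H i \<noteq> 0. trunc P (shift k R) (mat_mult (length Q) (G (k - i)) (H i)))"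

lemma families_closed:
  "0 \<in> families P Q" "G \<in> families P Q \<Longrightarrow> H \<in> families P Q \<Longrightarrow> G + H \<in> families P Q"
  "G \<in> families P Q \<Longrightarrow> - G \<in> families P Q"
proof -
  show "0 \<in> families P Q" by (simp add: families_def matrices_closed)
  show "G + H \<in> families P Q" if "G \<in> families P Q" "H \<in> families P Q"
  proof -
    have "{k. (G + H) k \<noteq> 0} \<subseteq> {k. G k \<noteq> 0} \<union> {k. H k \<noteq> 0}" by auto
    then have "finite {k. (G + H) k \<noteq> 0}"
      using that by (auto simp: families_def intro: finite_subset)
    then show ?thesis using that by (simp add: families_def matrices_closed)
  qed
  show "- G \<in> families P Q" if "G \<in> families P Q"
    using that by (simp add: families_def matrices_closed)
qed

lemma C_family_inject: "G \<in> families P Q \<Longrightarrow> C_family P Q G = C_family P Q H \<longleftrightarrow> G = H"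
  unfolding C_family_def families_def fun_eq_iff[of "\<lambda>k. D_class P (shift k Q) (G k)"]
  by (auto simp: D_class_inject)

lemma C_hom_D: "Hom C_cat A B = (let H = (\<lambda>k. D_hom (pts A) (shift k (pts B))) in
    hom_module {f. (\<forall>k. f k \<in> carrier (H k)) \<and> finite {k. f k \<noteq> \<zero>\<^bsub>H k\<^esub>}}
        (\<lambda>k. \<zero>\<^bsub>H k\<^esub>) (\<lambda>f g k. f k \<oplus>\<^bsub>H k\<^esub> g k) (\<lambda>a f k. a \<odot>\<^bsub>H k\<^esub> f k))"
  by (simp add: C_cat_def orbit_cat_def orbit_hom_def D2_hom map_fst_iterate pts_def[symmetric])

lemma C_hom:
  fixes G H :: "int \<Rightarrow> 'k::field matrix"
  shows C_hom_carrier: "carrier (Hom C_cat A B) = (C_family (pts A) (pts B) ` families (pts A) (pts B) :: (int \<Rightarrow> 'k matrix set) set)"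
    and C_hom_zero: "\<zero>\<^bsub>Hom C_cat A B\<^esub> = (C_family (pts A) (pts B) 0 :: int \<Rightarrow> 'k matrix set)"
    and C_hom_add: "G \<in> families (pts A) (pts B) \<Longrightarrow> H \<in> families (pts A) (pts B) \<Longrightarrow>
      C_family (pts A) (pts B) G \<oplus>\<^bsub>Hom C_cat A B\<^esub> C_family (pts A) (pts B) H = C_family (pts A) (pts B) (G + H)"
proof -
  let ?P = "pts A" and ?Q = "pts B"
  show "carrier (Hom C_cat A B) = (C_family ?P ?Q ` families ?P ?Q :: (int \<Rightarrow> 'k matrix set) set)" (is "?L = ?R")
  proof
    show "?L \<subseteq> ?R"
    proof
      fix f :: "int \<Rightarrow> 'k matrix set" assume "f \<in> ?L"
      then have f: "\<forall>k. \<exists>N. N \<in> matrices valid ?P (shift k ?Q) \<and> f k = D_class ?P (shift k ?Q) N"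
        "finite {k. f k \<noteq> D_class ?P (shift k ?Q) 0}"
        unfolding C_hom_D Let_def hom_module_def D_hom_carrier D_hom_zero by auto
      from f(1) obtain G where G: "\<forall>k. G k \<in> matrices valid ?P (shift k ?Q) \<and> f k = D_class ?P (shift k ?Q) (G k)"
        by (rule choice[THEN exE])
      then have "{k. G k \<noteq> 0} = {k. f k \<noteq> D_class ?P (shift k ?Q) 0}"
        by (auto simp: D_class_inject)
      then have "G \<in> families ?P ?Q" using G f(2) by (simp add: families_def)
      moreover have "f = C_family ?P ?Q G" using G by (auto simp: C_family_def)
      ultimately show "f \<in> ?R" by blast
    qed
    show "?R \<subseteq> ?L"
    proof
      fix f :: "int \<Rightarrow> 'k matrix set" assume "f \<in> ?R"
      then obtain G where G: "G \<in> families ?P ?Q" "f = C_family ?P ?Q G" by blast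
      then have "{k. f k \<noteq> D_class ?P (shift k ?Q) 0} = {k. G k \<noteq> 0}"
        by (auto simp: D_class_inject C_family_def families_def)
      then show "f \<in> ?L"
        using G unfolding C_hom_D Let_def hom_module_def D_hom_carrier D_hom_zero
        by (auto simp: C_family_def families_def)
    qed
  qed
  show "\<zero>\<^bsub>Hom C_cat A B\<^esub> = (C_family ?P ?Q 0 :: int \<Rightarrow> 'k matrix set)"
    by (auto simp: C_hom_D hom_module_def D_hom_zero C_family_def)
  show "C_family ?P ?Q G \<oplus>\<^bsub>Hom C_cat A B\<^esub> C_family ?P ?Q H = C_family ?P ?Q (G + H)"
    if "G \<in> families ?P ?Q" "H \<in> families ?P ?Q"
    using that by (auto simp: C_hom_D hom_module_def D_hom_add C_family_def families_def)
qed

lemma C_hom_group: "abelian_group (Hom C_cat A B :: ('k::field, int \<Rightarrow> 'k matrix set) module)"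
  by (rule abelian_group_image[where c = "C_family (pts A) (pts B)" and D = "families (pts A) (pts B)"])
    (simp_all add: C_hom_carrier C_hom_zero C_hom_add families_closed)

lemma finsum_image:
  fixes c :: "'v::ab_group_add \<Rightarrow> 'm" and M (structure)
  assumes M: "abelian_group M"
    and carr: "carrier M = c ` D" and D0: "0 \<in> D" and Dadd: "\<And>x y. x \<in> D \<Longrightarrow> y \<in> D \<Longrightarrow> x + y \<in> D"
    and add: "\<And>x y. x \<in> D \<Longrightarrow> y \<in> D \<Longrightarrow> c x \<oplus> c y = c (x + y)" and zero: "\<zero> = c 0"
    and fin: "finite I" and N: "\<And>i. i \<in> I \<Longrightarrow> N i \<in> D"
  shows "finsum M (\<lambda>i. c (N i)) I = c (\<Sum>i\<in>I. N i)"
proof -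
  interpret abelian_group M by (rule M)
  have "finsum M (\<lambda>i. c (N i)) I = c (\<Sum>i\<in>I. N i) \<and> (\<Sum>i\<in>I. N i) \<in> D"
    using fin N
  proof (induction I)
    case empty
    then show ?case using zero D0 by simp
  next
    case (insert i I)
    then have "finsum M (\<lambda>i. c (N i)) (insert i I) = c (N i) \<oplus> finsum M (\<lambda>i. c (N i)) I"
      by (intro finsum_insert) (auto simp: carr)
    then show ?case using insert add Dadd by simp
  qed
  then show ?thesis by blast
qed

lemma finsum_D_class:
  assumes "finite I" "\<And>i. i \<in> I \<Longrightarrow> N i \<in> (matrices valid P Q :: 'k::field matrix set)"
  shows "finsum (D_hom P Q) (\<lambda>i. D_class P Q (N i)) I = D_class P Q (\<Sum>i\<in>I. N i)"
  by (rule finsum_image[where c = "D_class P Q", OF D_hom_group, where D = "matrices valid P Q"])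
    (simp_all add: D_hom_carrier D_hom_zero D_hom_add matrices_closed assms)

lemma finsum_C_family:
  assumes "finite I" "\<And>i. i \<in> I \<Longrightarrow> N i \<in> (families (pts A) (pts B) :: (int \<Rightarrow> 'k::field matrix) set)"
  shows "finsum (Hom C_cat A B) (\<lambda>i. C_family (pts A) (pts B) (N i)) I = C_family (pts A) (pts B) (\<Sum>i\<in>I. N i)"
  by (rule finsum_image[where c = "C_family (pts A) (pts B)", OF C_hom_group, where D = "families (pts A) (pts B)"])
    (simp_all add: C_hom_carrier C_hom_zero C_hom_add families_closed assms)

lemma C_comp:
  fixes G H :: "int \<Rightarrow> 'k::field matrix"
  assumes G: "G \<in> families (pts B) (pts D)" and H: "H \<in> families (pts A) (pts B)"
  shows "Comp C_cat A B D (C_family (pts B) (pts D) G) (C_family (pts A) (pts B) H) =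
    C_family (pts A) (pts D) (family_comp (pts A) (pts B) (pts D) G H)"
proof
  fix k
  let ?P = "pts A" and ?Q = "pts B" and ?R = "pts D"
  let ?X = "orbit_rep A" and ?Y = "orbit_rep B" and ?Z = "orbit_rep D"
  have supp: "{i. C_family ?P ?Q H i \<noteq> D_class ?P (shift i ?Q) 0} = {i. H i \<noteq> 0}"
    using H by (auto simp: D_class_inject C_family_def families_def)
  have fin: "finite {i. H i \<noteq> 0}" using H by (simp add: families_def)
  have "Comp C_cat A B D (C_family ?Q ?R G) (C_family ?P ?Q H) k =
      finsum (D_hom ?P (shift k ?R))
       (\<lambda>i. Comp D2_cat ?X (int_iterate (map F_ind) i ?Y) (int_iterate (map F_ind) k ?Z)
          (C_family ?Q ?R G (k - i)) (C_family ?P ?Q H i)) {i. H i \<noteq> 0}"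
    by (simp add: C_cat_def orbit_cat_def orbit_comp_def D2_hom map_fst_iterate pts_def[symmetric]
        int_iterate_id D_hom_zero supp)
  also have "\<dots> = finsum (D_hom ?P (shift k ?R))
       (\<lambda>i. D_class ?P (shift k ?R) (trunc ?P (shift k ?R) (mat_mult (length ?Q) (G (k - i)) (H i)))) {i. H i \<noteq> 0}"
  proof (rule arg_cong[where f = "\<lambda>h. finsum (D_hom ?P (shift k ?R)) h {i. H i \<noteq> 0}"], rule ext)
    fix i
    have g: "C_family ?Q ?R G (k - i) = D_class (shift i ?Q) (shift k ?R) (G (k - i))"
      using D_class_shift[of i ?Q "shift (k - i) ?R" "G (k - i)"] by (simp add: C_family_def)
    have "G (k - i) \<in> matrices valid (shift i ?Q) (shift k ?R)"
      using G matrices_valid_shift[of i ?Q "shift (k - i) ?R"] by (auto simp: families_def)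
    moreover have "H i \<in> matrices valid ?P (shift i ?Q)" using H by (simp add: families_def)
    ultimately show "Comp D2_cat ?X (int_iterate (map F_ind) i ?Y) (int_iterate (map F_ind) k ?Z)
          (C_family ?Q ?R G (k - i)) (C_family ?P ?Q H i) =
        D_class ?P (shift k ?R) (trunc ?P (shift k ?R) (mat_mult (length ?Q) (G (k - i)) (H i)))"
      unfolding g C_family_def[of ?P]
      by (subst D2_comp) (simp_all add: map_fst_iterate pts_def)
  qed
  also have "\<dots> = D_class ?P (shift k ?R) (family_comp ?P ?Q ?R G H k)"
    unfolding family_comp_def by (rule finsum_D_class[OF fin trunc_mem])
  finally show "Comp C_cat A B D (C_family ?Q ?R G) (C_family ?P ?Q H) k = C_family ?P ?R (family_comp ?P ?Q ?R G H) k"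
    by (simp add: C_family_def)
qed

definition single :: "int \<Rightarrow> 'k::field matrix \<Rightarrow> int \<Rightarrow> 'k matrix" where
  "single d N k = (if k = d then N else 0)"

lemma C_idn: "Idn C_cat A = C_family (pts A) (pts A) (single 0 (idm (pts A)) :: int \<Rightarrow> 'k::field matrix)"
proof
  fix k
  have "Idn C_cat A k = (if k = 0 then Idn D2_cat (orbit_rep A)
      else \<zero>\<^bsub>Hom D2_cat (orbit_rep A) (int_iterate (map F_ind) k (orbit_rep A))\<^esub> :: 'k matrix set)"
    by (simp add: C_cat_def orbit_cat_def orbit_id_def)
  then show "Idn C_cat A k = C_family (pts A) (pts A) (single 0 (idm (pts A)) :: int \<Rightarrow> 'k matrix) k"
    by (simp add: D2_idn[OF pts_def] D2_hom D_hom_zero map_fst_iterate pts_def[symmetric] C_family_def single_def)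
qed

lemma single_mem: "N \<in> matrices valid P (shift d Q) \<Longrightarrow> single d N \<in> families P Q"
proof -
  assume N: "N \<in> matrices valid P (shift d Q)"
  have "{k. single d N k \<noteq> 0} \<subseteq> {d}" by (auto simp: single_def)
  then have "finite {k. single d N k \<noteq> 0}" by (rule finite_subset) simp
  then show ?thesis using N matrices_closed(1) unfolding families_def single_def by auto
qed

lemma family_comp_single: "family_comp P Q R G (single d N) k = trunc P (shift k R) (mat_mult (length Q) (G (k - d)) N)"
proof -
  have zero: "trunc P (shift k R) (mat_mult n M 0) = 0" for n and M :: "'a matrix"
    by (intro ext) (simp add: trunc_def mat_mult_def)
  have "family_comp P Q R G (single d N) k =
      (\<Sum>i\<in>{d}. trunc P (shift k R) (mat_mult (length Q) (G (k - i)) (single d N i)))"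
    unfolding family_comp_def
  proof (rule sum.mono_neutral_left)
    show "\<forall>i\<in>{d} - {i. single d N i \<noteq> 0}. trunc P (shift k R) (mat_mult (length Q) (G (k - i)) (single d N i)) = 0"
    proof
      fix i assume "i \<in> {d} - {i. single d N i \<noteq> 0}"
      then have "single d N i = 0" by blast
      then show "trunc P (shift k R) (mat_mult (length Q) (G (k - i)) (single d N i)) = 0"
        by (simp only: zero)
    qed
  qed (auto simp: single_def)
  then show ?thesis by (simp add: single_def)
qed

lemma sum_entry: "(\<Sum>i\<in>S. N i) r c = (\<Sum>i\<in>S. N i r c :: 'k::field)"
  by (induction S rule: infinite_finite_induct) simp_all

lemma family_comp_mem:
  assumes "G \<in> families Q R" "H \<in> families P Q"
  shows "family_comp P Q R G H k \<in> matrices valid P (shift k R)"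
proof -
  have sums: "finite I \<Longrightarrow> (\<Sum>i\<in>I. trunc P (shift k R) (N i)) \<in> matrices valid P (shift k R)" for I and N :: "int \<Rightarrow> 'a matrix"
  proof (induction I rule: finite_induct)
    case empty
    show ?case unfolding sum.empty by (rule matrices_closed(1))
  next
    case (insert i I)
    show ?case unfolding sum.insert[OF insert.hyps] by (rule matrices_closed(2)[OF trunc_mem insert.IH])
  qed
  have "finite {i. H i \<noteq> 0}" using assms(2) unfolding families_def by blast
  then show ?thesis unfolding family_comp_def by (rule sums)
qed

section \<open>Surviving entries of a morphism\<close>

definition degree :: "point \<Rightarrow> point \<Rightarrow> int" where
  "degree p q = (THE k. live p (Fpow k q))"

lemma degree_eq: "live p (Fpow k q) \<Longrightarrow> degree p q = k"
  unfolding degree_def using live_degree by blast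

lemma linked_degree: "linked p q \<Longrightarrow> live p (Fpow (degree p q) q)"
  unfolding linked_def using degree_eq by blast

lemma live_valid: "live p q \<Longrightarrow> valid p q"
  by (simp add: live_def valid_def)

text \<open>
  Of all components of a morphism of \<open>\<C>\<close>, only those survive in \<open>\<C> / \<T>\<close> that have the degree in which
  the two summands are linked.
\<close>

definition live_part :: "point list \<Rightarrow> point list \<Rightarrow> (int \<Rightarrow> 'k::field matrix) \<Rightarrow> 'k matrix" where
  "live_part P Q G i j = (if i < length Q \<and> j < length P \<and> linked (P ! j) (Q ! i)
     then G (degree (P ! j) (Q ! i)) i j else 0)"

lemma live_part_mem: "live_part P Q G \<in> matrices linked P Q"
  by (auto simp: live_part_def matrices_def split: if_splits)

lemma live_part_add: "live_part P Q (G + H) = live_part P Q G + live_part P Q H"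
  by (intro ext) (simp add: live_part_def)

lemma live_part_surj:
  assumes N: "N \<in> matrices linked P Q"
  shows "\<exists>G\<in>families P Q. live_part P Q G = N"
proof -
  define G :: "int \<Rightarrow> 'a matrix" where
    "G k i j = (if linked (P ! j) (Q ! i) \<and> degree (P ! j) (Q ! i) = k then N i j else 0)" for k i j
  have Nz: "N i j \<noteq> 0 \<Longrightarrow> i < length Q \<and> j < length P \<and> linked (P ! j) (Q ! i)" for i j
    using N unfolding matrices_def by blast
  have "{k. G k \<noteq> 0} \<subseteq> (\<lambda>(i, j). degree (P ! j) (Q ! i)) ` ({..<length Q} \<times> {..<length P})"
  proof
    fix k assume "k \<in> {k. G k \<noteq> 0}"
    then obtain i j where "G k i j \<noteq> 0" by (auto simp: fun_eq_iff)
    then have "degree (P ! j) (Q ! i) = k" "N i j \<noteq> 0" by (auto simp: G_def split: if_splits)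
    then show "k \<in> (\<lambda>(i, j). degree (P ! j) (Q ! i)) ` ({..<length Q} \<times> {..<length P})"
      using Nz by force
  qed
  then have fin: "finite {k. G k \<noteq> 0}" by (rule finite_subset) simp
  have "G k \<in> matrices valid P (shift k Q)" for k
    unfolding matrices_def
  proof (intro CollectI allI impI)
    fix i j assume "G k i j \<noteq> 0"
    then have *: "degree (P ! j) (Q ! i) = k" "N i j \<noteq> 0" by (auto simp: G_def split: if_splits)
    then have "valid (P ! j) (Fpow k (Q ! i))" using Nz linked_degree live_valid by blast
    then show "i < length (shift k Q) \<and> j < length P \<and> valid (P ! j) (shift k Q ! i)"
      using Nz[OF *(2)] by simp
  qed
  then have "G \<in> families P Q" using fin by (simp add: families_def)
  moreover have "live_part P Q G = N" using Nz by (intro ext) (auto simp: live_part_def G_def)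
  ultimately show ?thesis by blast
qed

text \<open>
  For a surviving entry of a composite, every contribution runs through a point between its ends, so
  both factors survive and have the expected degrees.
\<close>

lemma live_part_family_comp:
  fixes G H :: "int \<Rightarrow> 'k::field matrix"
  assumes G: "G \<in> families Q R" and H: "H \<in> families P Q"
  shows "live_part P R (family_comp P Q R G H) = live_mult P Q R (live_part Q R G) (live_part P Q H)"
proof (intro ext)
  fix r c
  have mem: "live_mult P Q R (live_part Q R G) (live_part P Q H) \<in> matrices linked P R" by (intro live_mult_mat live_part_mem)
  show "live_part P R (family_comp P Q R G H) r c = live_mult P Q R (live_part Q R G) (live_part P Q H) r c"
  proof (cases "r < length R \<and> c < length P \<and> linked (P ! c) (R ! r)")
    case False
    then have "live_mult P Q R (live_part Q R G) (live_part P Q H) r c = 0" using mem unfolding matrices_def by blast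
    then show ?thesis using False by (auto simp: live_part_def)
  next
    case True
    define k where "k = degree (P ! c) (R ! r)"
    have k: "live (P ! c) (Fpow k (R ! r))" using True linked_degree unfolding k_def by blast
    let ?S = "{i. H i \<noteq> 0}"
    have fin: "finite ?S" using H by (simp add: families_def)
    have Gv: "G d r s \<noteq> 0 \<Longrightarrow> s < length Q \<and> valid (Q ! s) (Fpow d (R ! r))" for d s
      using G True unfolding families_def matrices_def by force
    have Hv: "H d s c \<noteq> 0 \<Longrightarrow> s < length Q \<and> valid (P ! c) (Fpow d (Q ! s))" for d s
      using H True unfolding families_def matrices_def by force
    have entry: "(\<Sum>i\<in>?S. G (k - i) r s * H i s c) =
      (if composable (P ! c) (Q ! s) (R ! r) then live_part Q R G r s * live_part P Q H s c else 0)"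
      if s: "s < length Q" for s
    proof -
      have nz: "composable (P ! c) (Q ! s) (R ! r) \<and> i = degree (P ! c) (Q ! s) \<and> k - i = degree (Q ! s) (R ! r)"
        if "G (k - i) r s * H i s c \<noteq> 0" for i
      proof -
        have "below (P ! c) (Fpow i (Q ! s))" "below (Fpow i (Q ! s)) (Fpow k (R ! r))"
          using that Gv[of "k - i" s] Hv[of i s] valid_below
            below_Fpow[of i "Q ! s" "Fpow (k - i) (R ! r)"] by auto
        from live_between[OF k this] have l: "live (P ! c) (Fpow i (Q ! s))" "live (Q ! s) (Fpow (k - i) (R ! r))"
          using live_Fpow[of i "Q ! s" "Fpow (k - i) (R ! r)"] by auto
        moreover have "live (P ! c) (Fpow (i + (k - i)) (R ! r))" using k by simp
        ultimately have "composable (P ! c) (Q ! s) (R ! r)" unfolding composable_def by blast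
        then show ?thesis using degree_eq[OF l(1)] degree_eq[OF l(2)] by simp
      qed
      show ?thesis
      proof (cases "composable (P ! c) (Q ! s) (R ! r)")
        case False
        then have "(\<Sum>i\<in>?S. G (k - i) r s * H i s c) = 0" using nz by (intro sum.neutral) blast
        then show ?thesis using False by simp
      next
        case comp: True
        then obtain a b where ab: "live (P ! c) (Fpow a (Q ! s))" "live (Q ! s) (Fpow b (R ! r))"
          "live (P ! c) (Fpow (a + b) (R ! r))" unfolding composable_def by blast
        have deg: "degree (P ! c) (Q ! s) = a" "degree (Q ! s) (R ! r) = b" using ab degree_eq by blast+
        have kab: "k - a = b" using live_degree[OF k ab(3)] by simp
        have "(\<Sum>i\<in>?S. G (k - i) r s * H i s c) = (\<Sum>i\<in>?S. if i = a then G b r s * H a s c else 0)"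
        proof (rule sum.cong[OF refl])
          fix i
          show "G (k - i) r s * H i s c = (if i = a then G b r s * H a s c else 0)"
            using nz[of i] deg kab by (cases "i = a") auto
        qed
        also have "\<dots> = G b r s * H a s c" using fin by (auto simp only: sum.delta mem_Collect_eq zero_fun_apply mult_zero_right split: if_splits)
        also have "\<dots> = live_part Q R G r s * live_part P Q H s c"
          using True s composable_linked[OF comp] by (simp add: live_part_def deg)
        finally show ?thesis using comp by simp
      qed
    qed
    have "family_comp P Q R G H k r c = (\<Sum>i\<in>?S. trunc P (shift k R) (mat_mult (length Q) (G (k - i)) (H i)) r c)"
      unfolding family_comp_def by (rule sum_entry)
    also have "\<dots> = (\<Sum>i\<in>?S. \<Sum>s<length Q. G (k - i) r s * H i s c)"
      using True live_valid[OF k] by (simp add: trunc_def mat_mult_def)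
    also have "\<dots> = (\<Sum>s<length Q. \<Sum>i\<in>?S. G (k - i) r s * H i s c)" by (rule sum.swap)
    also have "\<dots> = live_mult P Q R (live_part Q R G) (live_part P Q H) r c"
      unfolding live_mult_def by (intro sum.cong refl) (simp add: entry)
    finally show ?thesis using True by (simp add: live_part_def[of P R] k_def)
  qed
qed

lemma family_comp_families:
  assumes "G \<in> families Q R" "H \<in> families P Q"
  shows "family_comp P Q R G H \<in> families P R"
proof -
  have "{k. family_comp P Q R G H k \<noteq> 0} \<subseteq> (\<lambda>(i, m). i + m) ` ({i. H i \<noteq> 0} \<times> {m. G m \<noteq> 0})"
  proof
    fix k assume "k \<in> {k. family_comp P Q R G H k \<noteq> 0}"
    then have "(\<Sum>i | H i \<noteq> 0. trunc P (shift k R) (mat_mult (length Q) (G (k - i)) (H i))) \<noteq> 0"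
      by (simp add: family_comp_def)
    then obtain i where i: "H i \<noteq> 0" "trunc P (shift k R) (mat_mult (length Q) (G (k - i)) (H i)) \<noteq> 0"
      by (rule sum.not_neutral_contains_not_neutral) blast
    have "trunc P (shift k R) (mat_mult n 0 M) = 0" for n and M :: "'a matrix"
      by (intro ext) (simp add: trunc_def mat_mult_def)
    then have "G (k - i) \<noteq> 0" using i(2) by metis
    then have "(i, k - i) \<in> {i. H i \<noteq> 0} \<times> {m. G m \<noteq> 0}" using i(1) by blast
    then show "k \<in> (\<lambda>(i, m). i + m) ` ({i. H i \<noteq> 0} \<times> {m. G m \<noteq> 0})"
      by (rule rev_image_eqI) simp
  qed
  moreover have "finite ((\<lambda>(i, m). i + m) ` ({i. H i \<noteq> 0} \<times> {m. G m \<noteq> 0}))"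
    using assms by (intro finite_imageI finite_cartesian_product) (simp_all add: families_def)
  ultimately have "finite {k. family_comp P Q R G H k \<noteq> 0}" by (rule finite_subset)
  then show ?thesis using family_comp_mem[OF assms] by (simp add: families_def)
qed

definition live_matrix :: "(point \<times> bool) list set \<Rightarrow> (point \<times> bool) list set \<Rightarrow>
    (int \<Rightarrow> 'k::field matrix set) \<Rightarrow> 'k matrix" where
  "live_matrix A B \<phi> = live_part (pts A) (pts B) (THE G. G \<in> families (pts A) (pts B) \<and> \<phi> = C_family (pts A) (pts B) G)"

lemma live_matrix_C_family: "G \<in> families (pts A) (pts B) \<Longrightarrow> live_matrix A B (C_family (pts A) (pts B) G) = live_part (pts A) (pts B) G"
proof -
  assume G: "G \<in> families (pts A) (pts B)"
  then have "(THE H. H \<in> families (pts A) (pts B) \<and> C_family (pts A) (pts B) G = C_family (pts A) (pts B) H) = G"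
    by (intro the_equality) (simp_all add: C_family_inject)
  then show ?thesis by (simp add: live_matrix_def)
qed

lemma live_matrix_add:
  fixes \<phi> \<psi> :: "int \<Rightarrow> 'k::field matrix set"
  assumes "\<phi> \<in> carrier (Hom C_cat A B)" "\<psi> \<in> carrier (Hom C_cat A B)"
  shows "live_matrix A B (\<phi> \<oplus>\<^bsub>Hom C_cat A B\<^esub> \<psi>) = live_matrix A B \<phi> + live_matrix A B \<psi>"
  using assms by (auto simp: C_hom_carrier C_hom_add live_matrix_C_family families_closed live_part_add)

lemma live_matrix_image: "live_matrix A B ` carrier (Hom C_cat A B) = (matrices linked (pts A) (pts B) :: 'k::field matrix set)"
proof
  show "live_matrix A B ` carrier (Hom C_cat A B) \<subseteq> (matrices linked (pts A) (pts B) :: 'k matrix set)"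
    by (auto simp: C_hom_carrier live_matrix_C_family live_part_mem)
  show "(matrices linked (pts A) (pts B) :: 'k matrix set) \<subseteq> live_matrix A B ` carrier (Hom C_cat A B)"
  proof
    fix N :: "'k matrix" assume "N \<in> matrices linked (pts A) (pts B)"
    then obtain G where "G \<in> families (pts A) (pts B)" "live_part (pts A) (pts B) G = N"
      using live_part_surj by blast
    then show "N \<in> live_matrix A B ` carrier (Hom C_cat A B)"
      by (intro image_eqI[of _ _ "C_family (pts A) (pts B) G"]) (simp_all add: live_matrix_C_family C_hom_carrier)
  qed
qed

lemma live_matrix_mem: "\<phi> \<in> carrier (Hom C_cat A B) \<Longrightarrow> live_matrix A B \<phi> \<in> matrices linked (pts A) (pts B)"
  using live_matrix_image by blast

lemma live_matrix_comp:
  fixes g f :: "int \<Rightarrow> 'k::field matrix set"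
  assumes "g \<in> carrier (Hom C_cat B D)" "f \<in> carrier (Hom C_cat A B)"
  shows "Comp C_cat A B D g f \<in> carrier (Hom C_cat A D)"
    and "live_matrix A D (Comp C_cat A B D g f) = live_mult (pts A) (pts B) (pts D) (live_matrix B D g) (live_matrix A B f)"
  using assms
  by (auto simp: C_hom_carrier C_comp family_comp_families live_matrix_C_family live_part_family_comp)

lemma live_mult_zero_right: "live_mult P Q R N 0 = 0"
proof (intro ext)
  fix i j
  have "live_mult P Q R N 0 i j = 0" unfolding live_mult_def by (intro sum.neutral ballI) simp
  then show "live_mult P Q R N 0 i j = 0 i j" by simp
qed

lemma live_matrix_finsum:
  fixes f :: "nat \<Rightarrow> int \<Rightarrow> 'k::field matrix set"
  assumes "finite I" "\<And>i. i \<in> I \<Longrightarrow> f i \<in> carrier (Hom C_cat A B) \<and> live_matrix A B (f i) = 0"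
  shows "live_matrix A B (finsum (Hom C_cat A B) f I) = 0"
proof -
  interpret abelian_group "Hom C_cat A B :: ('k, int \<Rightarrow> 'k matrix set) module" by (rule C_hom_group)
  have "live_part (pts A) (pts B) 0 = (0 :: 'k matrix)" by (intro ext) (simp add: live_part_def)
  then have z: "live_matrix A B (\<zero>\<^bsub>Hom C_cat A B\<^esub> :: int \<Rightarrow> 'k matrix set) = 0"
    by (simp add: C_hom_zero live_matrix_C_family families_closed)
  show ?thesis
    using assms
  proof (induction I rule: finite_induct)
    case empty
    then show ?case using z by simp
  next
    case (insert i I)
    then have "finsum (Hom C_cat A B) f (insert i I) = f i \<oplus>\<^bsub>Hom C_cat A B\<^esub> finsum (Hom C_cat A B) f I"
      by (intro finsum_insert) auto
    moreover have "finsum (Hom C_cat A B) f I \<in> carrier (Hom C_cat A B)"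
      using insert by (intro finsum_closed) auto
    ultimately show ?case using insert by (simp add: live_matrix_add)
  qed
qed

section \<open>The ideal of the standard cluster\<close>

lemma standard_lifts_T:
  assumes "A \<in> standard_cluster"
  shows "\<exists>t\<in>lifts_T. pts A = [t]"
proof -
  obtain x y n m where A: "A = M_obj (x, y)"
    and x: "x = real m * pi / 2 ^ n" and y: "y = pi + (real m - 1) * pi / 2 ^ n"
    using assms unfolding standard_cluster_def by blast
  have "dyadic n x" unfolding dyadic_def x by (rule exI[of _ "int m"]) simp
  moreover have "y + pi = x + 2 * pi - pi / 2 ^ n" unfolding x y by (simp add: field_simps)
  ultimately have "(x, y) \<in> lifts_T" unfolding lifts_T_def arc_def by auto
  moreover obtain k where "pts A = shift k [(x, y)]"
    using pts_orbit[of "[((x, y), False)]"] unfolding A M_obj_def by auto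
  ultimately show ?thesis by (intro bexI[of _ "Fpow k (x, y)"]) simp_all
qed

text \<open>
  The standard cluster lists one lift of each arc. The complements of dyadic intervals are translates of
  these by even powers of \<open>F\<close>, the dyadic intervals by odd powers. The lift \<open>(\<pi>, \<pi>)\<close>, which is
  omitted from the list, is \<open>F\<close> applied to \<open>(0, 0)\<close>.
\<close>

lemma lifts_T_standard:
  assumes "t \<in> lifts_T"
  shows "\<exists>p k. M_obj p \<in> standard_cluster \<and> t = Fpow k p"
proof -
  have upper: "\<exists>p k. M_obj p \<in> standard_cluster \<and> (x, y) = Fpow k p"
    if "x = of_int m * (pi / 2 ^ n)" "y = x + pi - pi / 2 ^ n" for x y and m :: int and n :: nat
  proof -
    define m' where "m' = nat (m mod 2 ^ (n + 1))"
    define q where "q = m div 2 ^ (n + 1)"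
    have m': "m' < 2 ^ (n + 1)" "m = int m' + 2 ^ (n + 1) * q"
    proof -
      have "int m' = m mod 2 ^ (n + 1)" unfolding m'_def by simp
      moreover have "m mod 2 ^ (n + 1) < 2 ^ (n + 1)" by simp
      ultimately have "int m' < int (2 ^ (n + 1))" by simp
      then show "m' < 2 ^ (n + 1)" by (simp only: of_nat_less_iff)
      show "m = int m' + 2 ^ (n + 1) * q" using \<open>int m' = _\<close> unfolding q_def by simp
    qed
    let ?x = "real m' * pi / 2 ^ n" and ?y = "pi + (real m' - 1) * pi / 2 ^ n"
    have "x = ?x + real_of_int (2 * q) * pi"
      unfolding that(1) m'(2) by (simp add: field_simps)
    moreover have "y = ?y + real_of_int (2 * q) * pi"
      unfolding that(2) calculation by (simp add: field_simps)
    ultimately have F: "(x, y) = Fpow (2 * q) (?x, ?y)" by (simp add: Fpow_def)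
    show ?thesis
    proof (cases "(?x, ?y) = (pi, pi)")
      case False
      then have "M_obj (?x, ?y) \<in> standard_cluster" unfolding standard_cluster_def using m'(1) by blast
      then show ?thesis using F by blast
    next
      case True
      have "(pi, pi) = Fpow 1 (0, 0)" by (simp add: Fpow_def)
      then have "(x, y) = Fpow (2 * q + 1) (0, 0)" using F True by simp
      moreover have "M_obj (0, 0) \<in> standard_cluster"
        unfolding standard_cluster_def
        by (intro CollectI exI[of _ 0] exI[of _ "0::nat"]) simp
      ultimately show ?thesis by blast
    qed
  qed
  obtain n where n: "dyadic n (fst t)" "snd t + pi = fst t + pi / 2 ^ n \<or> snd t + pi = fst t + 2 * pi - pi / 2 ^ n"
    using assms unfolding lifts_T_def arc_def by blast
  obtain m :: int where m: "fst t = of_int m * (pi / 2 ^ n)" using n(1) dyadic_def by blast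
  from n(2) show ?thesis
  proof
    assume "snd t + pi = fst t + 2 * pi - pi / 2 ^ n"
    then have "snd t = fst t + pi - pi / 2 ^ n" by linarith
    from upper[OF m this] show ?thesis by simp
  next
    assume *: "snd t + pi = fst t + pi / 2 ^ n"
    have "snd t + pi = of_int (m + 1) * (pi / 2 ^ n)" unfolding * m by (simp add: field_simps)
    moreover have "fst t + pi = (snd t + pi) + pi - pi / 2 ^ n" using * by linarith
    ultimately obtain p k where "M_obj p \<in> standard_cluster" "(snd t + pi, fst t + pi) = Fpow k p"
      using upper by blast
    moreover have "t = Fpow (- 1) (snd t + pi, fst t + pi)" by (simp add: Fpow_def)
    ultimately have "M_obj p \<in> standard_cluster \<and> t = Fpow (- 1 + k) p" by simp
    then show ?thesis by blast
  qed
qed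

text \<open>
  The identity of a sum of objects of \<open>\<T>\<close> is a sum of morphisms through objects of \<open>\<T>\<close>, hence it has no surviving
  entries. But it has an entry \<open>1\<close> at each summand that survives to itself.
\<close>

lemma add_closure_dead:
  assumes Z: "Z \<in> add_closure (C_cat :: 'k::field cluster_category) standard_cluster"
    and z: "z \<in> set (pts Z)"
  shows "\<not> live z z"
proof
  assume live: "live z z"
  obtain Xs where Xs: "set Xs \<subseteq> standard_cluster" "is_direct_sum (C_cat :: 'k cluster_category) Xs Z"
    using Z unfolding add_closure_def by blast
  from Xs(2) obtain \<iota> \<rho> where
    mem: "\<forall>i<length Xs. \<iota> i \<in> carrier (Hom (C_cat :: 'k cluster_category) (Xs ! i) Z) \<and> \<rho> i \<in> carrier (Hom C_cat Z (Xs ! i))"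
    and sum: "finsum (Hom (C_cat :: 'k cluster_category) Z Z) (\<lambda>i. Comp C_cat Z (Xs ! i) Z (\<iota> i) (\<rho> i)) {..<length Xs} = Idn C_cat Z"
    unfolding is_direct_sum_def by blast
  have "live_matrix Z Z (finsum (Hom (C_cat :: 'k cluster_category) Z Z) (\<lambda>i. Comp C_cat Z (Xs ! i) Z (\<iota> i) (\<rho> i)) {..<length Xs}) = 0"
  proof (rule live_matrix_finsum)
    fix i assume "i \<in> {..<length Xs}"
    then have i: "i < length Xs" by simp
    then obtain t where t: "t \<in> lifts_T" "pts (Xs ! i) = [t]"
      using Xs(1) standard_lifts_T nth_mem by blast
    have "\<not> live t t" using t(1) below_refl unfolding live_def by blast
    then have "\<not> linked p t" for p using linked_self by blast
    note dead = this
    have M: "live_matrix Z (Xs ! i) (\<rho> i) \<in> matrices linked (pts Z) [t]"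
      using live_matrix_mem[of "\<rho> i" Z "Xs ! i"] mem i t(2) by simp
    have "live_matrix Z (Xs ! i) (\<rho> i) = 0"
    proof (intro ext, rule ccontr)
      fix r c assume "live_matrix Z (Xs ! i) (\<rho> i) r c \<noteq> 0 r c"
      then have "live_matrix Z (Xs ! i) (\<rho> i) r c \<noteq> 0" by simp
      then have "r < length [t] \<and> linked (pts Z ! c) ([t] ! r)" using M unfolding matrices_def by blast
      then have "linked (pts Z ! c) t" by auto
      then show False using dead by blast
    qed
    then show "Comp C_cat Z (Xs ! i) Z (\<iota> i) (\<rho> i) \<in> carrier (Hom C_cat Z Z) \<and>
        live_matrix Z Z (Comp C_cat Z (Xs ! i) Z (\<iota> i) (\<rho> i)) = 0"
      using live_matrix_comp[of "\<iota> i" "Xs ! i" Z "\<rho> i" Z] mem i by (simp add: live_mult_zero_right)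
  qed simp
  then have "live_matrix Z Z (Idn (C_cat :: 'k cluster_category) Z) = 0" unfolding sum .
  moreover have "single 0 (idm (pts Z)) \<in> (families (pts Z) (pts Z) :: (int \<Rightarrow> 'k matrix) set)"
    by (rule single_mem) (simp add: idm_mem)
  ultimately have ev0: "live_part (pts Z) (pts Z) (single 0 (idm (pts Z)) :: int \<Rightarrow> 'k matrix) = 0"
    by (simp add: C_idn live_matrix_C_family)
  obtain i where i: "i < length (pts Z)" "pts Z ! i = z" using z by (auto simp: in_set_conv_nth)
  have "degree z z = 0" using live degree_eq[of z 0 z] by simp
  then have "live_part (pts Z) (pts Z) (single 0 (idm (pts Z)) :: int \<Rightarrow> 'k matrix) i i = 1"
    using i live live_linked live_valid by (simp add: live_part_def single_def idm_def)
  then show False using ev0 by simp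
qed

definition strip :: "point set" where
  "strip = {(x, y). \<bar>y - x\<bar> < pi}"

lemma strip_Fpow: "Fpow k p \<in> strip \<longleftrightarrow> p \<in> strip"
  by (auto simp: strip_def Fpow_def split_beta abs_less_iff)

lemma strip_valid: "p \<in> strip \<Longrightarrow> valid p p"
  by (auto simp: strip_def valid_def below_def split_beta abs_less_iff)

lemma live_strip: "live p p \<Longrightarrow> p \<in> strip"
  by (auto simp: strip_def live_def split_beta abs_less_iff)

lemma lifts_T_strip: "t \<in> lifts_T \<Longrightarrow> t \<in> strip"
  using arc_ends[of "fst t" "snd t + pi"] by (auto simp: lifts_T_def strip_def split_beta abs_less_iff)

lemma orbit_Obj: "set (map fst X) \<subseteq> strip \<Longrightarrow> orbit_of (map F_ind) X \<in> Obj C_cat"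
proof -
  assume "set (map fst X) \<subseteq> strip"
  then have "map fst X \<in> lists {(x, y). \<bar>y - x\<bar> < pi}" unfolding strip_def by blast
  then show ?thesis
    by (simp add: C_cat_def orbit_cat_def D2_cat_def doubled_def D_cat_def full_subcat_def
        quot_cat_def B_cat_def image_eqI)
qed

definition unit_mat :: "nat \<Rightarrow> nat \<Rightarrow> 'k::field matrix" where
  "unit_mat i j r c = (if r = i \<and> c = j then 1 else 0)"

text \<open>
  An object is the direct sum of its summands also if each of these is represented by another lift. The
  inclusions and projections are unit columns and rows in the degrees by which the lifts differ.
\<close>

lemma is_direct_sum_of_points:
  assumes Z: "Z \<in> Obj (C_cat :: 'k::field cluster_category)" and strip: "set (pts Z) \<subseteq> strip"
    and Xs: "set Xs \<subseteq> Obj (C_cat :: 'k cluster_category)" and len: "length Xs = length (pts Z)"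
    and d: "\<And>i. i < length Xs \<Longrightarrow> pts (Xs ! i) = [Fpow (d i) (pts Z ! i)]"
  shows "is_direct_sum (C_cat :: 'k cluster_category) Xs Z"
proof -
  let ?n = "length Xs" and ?P = "pts Z"
  define I :: "nat \<Rightarrow> int \<Rightarrow> 'k matrix" where "I i = single (d i) (unit_mat i 0)" for i
  define R :: "nat \<Rightarrow> int \<Rightarrow> 'k matrix" where "R i = single (- d i) (unit_mat 0 i)" for i
  define \<iota> where "\<iota> i = C_family (pts (Xs ! i)) ?P (I i)" for i
  define \<rho> where "\<rho> i = C_family ?P (pts (Xs ! i)) (R i)" for i
  have val: "valid (?P ! i) (?P ! i)" "valid (Fpow k (?P ! i)) (Fpow k (?P ! i))" if "i < ?n" for i k
  proof -
    have "?P ! i \<in> strip" using that strip len nth_mem by (metis subsetD)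
    then show "valid (?P ! i) (?P ! i)" "valid (Fpow k (?P ! i)) (Fpow k (?P ! i))"
      by (simp_all add: strip_valid strip_Fpow)
  qed
  have I: "I i \<in> families (pts (Xs ! i)) ?P" if "i < ?n" for i
    unfolding I_def using that len val[OF that] d[OF that]
    by (intro single_mem) (auto simp: matrices_def unit_mat_def split: if_splits)
  have R: "R i \<in> families ?P (pts (Xs ! i))" if "i < ?n" for i
    unfolding R_def using that len val[OF that] d[OF that]
    by (intro single_mem) (auto simp: matrices_def unit_mat_def split: if_splits)
  have RI: "family_comp (pts (Xs ! i)) ?P (pts (Xs ! j)) (R j) (I i) =
      (if i = j then single 0 (idm (pts (Xs ! i))) else 0)" if ij: "i < ?n" "j < ?n" for i j
  proof (intro ext)
    fix k r c
    have "family_comp (pts (Xs ! i)) ?P (pts (Xs ! j)) (R j) (I i) k r c =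
        trunc (pts (Xs ! i)) (shift k (pts (Xs ! j))) (mat_mult (length ?P) (single (- d j) (unit_mat 0 j) (k - d i)) (unit_mat i 0)) r c"
      unfolding I_def R_def family_comp_single ..
    moreover have "mat_mult (length ?P) (single (- d j) (unit_mat 0 j) (k - d i)) (unit_mat i 0 :: 'k matrix) r c =
        (\<Sum>s<length ?P. if s = i then (if k = d i - d j \<and> r = 0 \<and> i = j \<and> c = 0 then 1 else 0) else 0)"
      unfolding mat_mult_def by (intro sum.cong) (auto simp: single_def unit_mat_def)
    moreover have "\<dots> = (if k = d i - d j \<and> r = 0 \<and> i = j \<and> c = 0 then 1 else 0)"
      using ij len by simp
    ultimately show "family_comp (pts (Xs ! i)) ?P (pts (Xs ! j)) (R j) (I i) k r c =
        (if i = j then single 0 (idm (pts (Xs ! i))) else 0) k r c"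
      using val(2)[OF ij(1)] by (auto simp: trunc_def d[OF ij(1)] d[OF ij(2)] single_def idm_def)
  qed
  have IR: "family_comp ?P (pts (Xs ! i)) ?P (I i) (R i) = single 0 (unit_mat i i)" if i: "i < ?n" for i
  proof (intro ext)
    fix k r c
    have "family_comp ?P (pts (Xs ! i)) ?P (I i) (R i) k r c =
        trunc ?P (shift k ?P) (mat_mult (length (pts (Xs ! i))) (single (d i) (unit_mat i 0) (k + d i)) (unit_mat 0 i)) r c"
      unfolding I_def R_def family_comp_single by simp
    also have "\<dots> = trunc ?P (shift k ?P) (if k = 0 then unit_mat i i else 0) r c"
      by (auto simp: d[OF i] trunc_def mat_mult_def single_def unit_mat_def)
    also have "\<dots> = single 0 (unit_mat i i) k r c"
      using i len val(1)[OF i] by (auto simp: trunc_def single_def unit_mat_def)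
    finally show "family_comp ?P (pts (Xs ! i)) ?P (I i) (R i) k r c = single 0 (unit_mat i i) k r c" .
  qed
  have S: "(\<Sum>i<?n. single 0 (unit_mat i i) :: int \<Rightarrow> 'k matrix) = single 0 (idm ?P)"
  proof (intro ext)
    fix k r c
    have apply3: "(\<Sum>i<m. N i) k r c = (\<Sum>i<m. N i k r c)" for m and N :: "nat \<Rightarrow> int \<Rightarrow> 'k matrix"
      by (induction m) simp_all
    have "(\<Sum>i<?n. single 0 (unit_mat i i) :: int \<Rightarrow> 'k matrix) k r c =
        (\<Sum>i<?n. if i = r then (if k = 0 \<and> r = c then 1 else 0) else 0)"
      unfolding apply3 by (intro sum.cong) (auto simp: single_def unit_mat_def)
    also have "\<dots> = single 0 (idm ?P) k r c"
      using val(1) len by (auto simp: single_def idm_def)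
    finally show "(\<Sum>i<?n. single 0 (unit_mat i i) :: int \<Rightarrow> 'k matrix) k r c = single 0 (idm ?P) k r c" .
  qed
  have hom: "\<iota> i \<in> carrier (Hom C_cat (Xs ! i) Z) \<and> \<rho> i \<in> carrier (Hom C_cat Z (Xs ! i))" if "i < ?n" for i
    using I[OF that] R[OF that] by (simp add: \<iota>_def \<rho>_def C_hom_carrier)
  have unit: "Comp C_cat (Xs ! i) Z (Xs ! j) (\<rho> j) (\<iota> i) =
      (if i = j then Idn C_cat (Xs ! i) else \<zero>\<^bsub>Hom C_cat (Xs ! i) (Xs ! j)\<^esub>)" if "i < ?n" "j < ?n" for i j
    unfolding \<iota>_def \<rho>_def using C_comp[OF R[OF that(2)] I[OF that(1)]] RI[OF that]
    by (simp add: C_idn C_hom_zero)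
  have "finsum (Hom C_cat Z Z) (\<lambda>i. Comp C_cat Z (Xs ! i) Z (\<iota> i) (\<rho> i)) {..<?n} =
      finsum (Hom C_cat Z Z) (\<lambda>i. C_family ?P ?P (single 0 (unit_mat i i))) {..<?n}"
  proof (rule abelian_monoid.finsum_cong'[OF abelian_group.axioms(1)[OF C_hom_group]])
    fix i assume "i \<in> {..<?n}"
    then have i: "i < ?n" by simp
    show "Comp C_cat Z (Xs ! i) Z (\<iota> i) (\<rho> i) = C_family ?P ?P (single 0 (unit_mat i i))"
      unfolding \<iota>_def \<rho>_def C_comp[OF I[OF i] R[OF i]] IR[OF i] ..
  next
    show "(\<lambda>i. C_family ?P ?P (single 0 (unit_mat i i))) \<in> {..<?n} \<rightarrow> carrier (Hom C_cat Z Z)"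
      using val(1) len by (auto simp: C_hom_carrier matrices_def unit_mat_def split: if_splits intro!: imageI single_mem)
  qed simp
  also have "\<dots> = C_family ?P ?P (\<Sum>i<?n. single 0 (unit_mat i i))"
    using val(1) len by (intro finsum_C_family) (auto simp: matrices_def unit_mat_def split: if_splits intro!: single_mem)
  also have "\<dots> = Idn C_cat Z" unfolding S C_idn ..
  finally have sum: "finsum (Hom C_cat Z Z) (\<lambda>i. Comp C_cat Z (Xs ! i) Z (\<iota> i) (\<rho> i)) {..<?n} = Idn C_cat Z" .
  show ?thesis
    unfolding is_direct_sum_def
    using Z Xs hom unit sum by (intro conjI exI[of _ \<iota>] exI[of _ \<rho>]) auto
qed

lemma sum_of_T_objects:
  assumes "set Ts \<subseteq> lifts_T"
  shows "\<exists>Z\<in>add_closure (C_cat :: 'k::field cluster_category) standard_cluster. \<exists>b. pts Z = shift b Ts"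
proof -
  define Z where "Z = orbit_of (map F_ind) (map (\<lambda>t. (t, False)) Ts)"
  obtain b where b: "pts Z = shift b Ts"
    using pts_orbit[of "map (\<lambda>t. (t, False)) Ts"] unfolding Z_def by (auto simp: comp_def)
  have Ts: "set Ts \<subseteq> strip" using assms lifts_T_strip by blast
  have ZObj: "Z \<in> Obj (C_cat :: 'k cluster_category)"
    unfolding Z_def using Ts by (intro orbit_Obj) (auto simp: comp_def)
  have "\<forall>t\<in>set Ts. \<exists>X d. X \<in> standard_cluster \<and> X \<in> Obj (C_cat :: 'k cluster_category) \<and> pts X = [Fpow d t]"
  proof
    fix t assume "t \<in> set Ts"
    then obtain p k where p: "M_obj p \<in> standard_cluster" "t = Fpow k p"
      using assms lifts_T_standard by blast
    have "p \<in> strip" using p(2) \<open>t \<in> set Ts\<close> Ts strip_Fpow by blast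
    then have "M_obj p \<in> Obj (C_cat :: 'k cluster_category)"
      unfolding M_obj_def by (intro orbit_Obj) simp
    moreover obtain c where "pts (M_obj p) = shift c [p]"
      using pts_orbit[of "[(p, False)]"] unfolding M_obj_def by auto
    then have "pts (M_obj p) = [Fpow (c - k) t]" using p(2) by simp
    ultimately show "\<exists>X d. X \<in> standard_cluster \<and> X \<in> Obj (C_cat :: 'k cluster_category) \<and> pts X = [Fpow d t]"
      using p(1) by blast
  qed
  then obtain X d where X: "\<And>t. t \<in> set Ts \<Longrightarrow> X t \<in> standard_cluster \<and>
      X t \<in> Obj (C_cat :: 'k cluster_category) \<and> pts (X t) = [Fpow (d t) t]"
    by metis
  have "is_direct_sum (C_cat :: 'k cluster_category) (map X Ts) Z"
  proof (rule is_direct_sum_of_points[OF ZObj])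
    show "set (pts Z) \<subseteq> strip" using Ts strip_Fpow by (auto simp: b)
    show "set (map X Ts) \<subseteq> Obj (C_cat :: 'k cluster_category)" using X by auto
    show "length (map X Ts) = length (pts Z)" by (simp add: b)
    show "pts (map X Ts ! i) = [Fpow (d (Ts ! i) - b) (pts Z ! i)]" if "i < length (map X Ts)" for i
      using that X[of "Ts ! i"] by (simp add: b)
  qed
  moreover have "set (map X Ts) \<subseteq> standard_cluster" using X by auto
  ultimately show ?thesis using b unfolding add_closure_def by blast
qed


text \<open>
  A morphism without surviving entries factors through the sum of one object of \<open>\<T>\<close> for each nonzero
  entry of each of its components. The first factor has a single degree, determined by the lift of the
  sum; the degrees of the entries are in the second factor.
\<close>

lemma C_ideal:
  "factor_ideal C_cat (add_closure (C_cat :: 'k::field cluster_category) standard_cluster) A B =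
    {\<phi> \<in> carrier (Hom (C_cat :: 'k cluster_category) A B). live_matrix A B \<phi> = 0}" (is "?L = ?R")
proof
  show "?L \<subseteq> ?R"
  proof
    fix \<phi> assume "\<phi> \<in> ?L"
    then obtain Z f g where Z: "Z \<in> add_closure (C_cat :: 'k cluster_category) standard_cluster"
      and \<phi>: "\<phi> = Comp C_cat A Z B g f"
      and f: "f \<in> carrier (Hom C_cat A Z)" and g: "g \<in> carrier (Hom C_cat Z B)"
      unfolding factor_ideal_def by blast
    have "live_matrix A Z f = 0"
    proof (intro ext, rule ccontr)
      fix r c assume "live_matrix A Z f r c \<noteq> 0 r c"
      then have "live_matrix A Z f r c \<noteq> 0" by simp
      then have "r < length (pts Z)" "linked (pts A ! c) (pts Z ! r)"
        using live_matrix_mem[OF f] unfolding matrices_def by blast+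
      then show False using linked_self add_closure_dead[OF Z] nth_mem by blast
    qed
    then show "\<phi> \<in> ?R" using live_matrix_comp[OF g f] unfolding \<phi> by (simp add: live_mult_zero_right)
  qed
  show "?R \<subseteq> ?L"
  proof
    fix \<phi> assume "\<phi> \<in> ?R"
    then obtain G where G: "G \<in> families (pts A) (pts B)" "\<phi> = C_family (pts A) (pts B) G"
      and ev0: "live_part (pts A) (pts B) G = 0"
      by (auto simp: C_hom_carrier live_matrix_C_family)
    let ?P = "pts A" and ?Q = "pts B"
    have Gz: "i < length ?Q \<and> j < length ?P \<and> valid (?P ! j) (Fpow k (?Q ! i))" if "G k i j \<noteq> 0" for k i j
    proof -
      have "i < length (shift k ?Q) \<and> j < length ?P \<and> valid (?P ! j) (shift k ?Q ! i)"
        using G(1) that unfolding families_def matrices_def by blast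
      then show ?thesis by auto
    qed
    have "\<exists>t\<in>lifts_T. below (?P ! j) t \<and> below t (Fpow k (?Q ! i))" if nz: "G k i j \<noteq> 0" for k i j
    proof (rule ccontr)
      assume "\<not> ?thesis"
      then have live: "live (?P ! j) (Fpow k (?Q ! i))"
        using Gz[OF nz] unfolding live_def valid_def by blast
      then have "linked (?P ! j) (?Q ! i)" unfolding linked_def by blast
      then have "live_part ?P ?Q G i j = G k i j" using Gz[OF nz] degree_eq[OF live] by (simp add: live_part_def)
      then show False using nz ev0 by simp
    qed
    then obtain t where t: "\<And>k i j. G k i j \<noteq> 0 \<Longrightarrow>
        t k i j \<in> lifts_T \<and> below (?P ! j) (t k i j) \<and> below (t k i j) (Fpow k (?Q ! i))"
      by metis
    define E where "E = {(k, i, j). G k i j \<noteq> 0}"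
    have "E \<subseteq> {k. G k \<noteq> 0} \<times> {..<length ?Q} \<times> {..<length ?P}"
      using Gz unfolding E_def by force
    moreover have "finite {k. G k \<noteq> 0}" using G(1) unfolding families_def by blast
    then have "finite ({k. G k \<noteq> 0} \<times> {..<length ?Q} \<times> {..<length ?P})"
      by (intro finite_cartesian_product) simp_all
    ultimately have finE: "finite E" by (rule finite_subset)
    define n where "n = card E"
    obtain e where e: "bij_betw e {..<n} E"
      using ex_bij_betw_nat_finite[OF finE] unfolding n_def lessThan_atLeast0 by blast
    define ek ei ej where "ek l = fst (e l)" and "ei l = fst (snd (e l))" and "ej l = snd (snd (e l))" for l
    have e_eq: "e l = (ek l, ei l, ej l)" for l by (simp add: ek_def ei_def ej_def)
    have eE: "G (ek l) (ei l) (ej l) \<noteq> 0" if "l < n" for l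
    proof -
      have "e l \<in> E" using bij_betwE[OF e] that by simp
      then show ?thesis unfolding e_eq E_def by simp
    qed
    define Ts where "Ts = map (\<lambda>l. t (ek l) (ei l) (ej l)) [0..<n]"
    have Ts: "length Ts = n" "l < n \<Longrightarrow> Ts ! l = t (ek l) (ei l) (ej l)" for l by (simp_all add: Ts_def)
    have "set Ts \<subseteq> lifts_T" unfolding Ts_def using t eE by auto
    then obtain Z b where Z: "Z \<in> add_closure (C_cat :: 'k cluster_category) standard_cluster"
      and b: "pts Z = shift b Ts" using sum_of_T_objects by blast
    have val: "ei l < length ?Q \<and> ej l < length ?P \<and> valid (?P ! ej l) (Ts ! l) \<and>
        valid (Fpow b (Ts ! l)) (Fpow (ek l + b) (?Q ! ei l))" if l: "l < n" for l
    proof -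
      note g = Gz[OF eE[OF l]] and tt = t[OF eE[OF l]]
      have v: "valid (?P ! ej l) (Ts ! l)" "valid (Ts ! l) (Fpow (ek l) (?Q ! ei l))"
        unfolding Ts(2)[OF l] using valid_between g tt by blast+
      have "valid (Fpow b p) (Fpow b q)" if "valid p q" for p q
        using that unfolding valid_def below_Fpow by (auto simp: Fpow_def)
      from this[OF v(2)] show ?thesis using v g by (simp add: add.commute)
    qed
    define f :: "'k matrix" where "f l j = (if l < n \<and> j = ej l then 1 else 0)" for l j
    define g :: "int \<Rightarrow> 'k matrix" where
      "g m i l = (if l < n \<and> m = ek l + b \<and> i = ei l then G (ek l) i (ej l) else 0)" for m i l
    have F: "single (- b) f \<in> families ?P (pts Z)"
      using val by (intro single_mem) (auto simp: matrices_def f_def b Ts(1) split: if_splits)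
    have "{m. g m \<noteq> 0} \<subseteq> (\<lambda>l. ek l + b) ` {..<n}"
      by (auto simp: g_def fun_eq_iff split: if_splits)
    then have "finite {m. g m \<noteq> 0}" by (rule finite_subset) simp
    moreover have "g m \<in> matrices valid (pts Z) (shift m ?Q)" for m
      using val by (auto simp: matrices_def g_def b Ts(1) split: if_splits)
    ultimately have Gm: "g \<in> families (pts Z) ?Q" by (simp add: families_def)
    have comp: "family_comp ?P (pts Z) ?Q g (single (- b) f) = G"
    proof
      fix k
      have "mat_mult (length (pts Z)) (g (k + b)) f = G k"
      proof (intro ext)
        fix i j
        have "mat_mult (length (pts Z)) (g (k + b)) f i j = (\<Sum>l<n. if e l = (k, i, j) then G k i j else 0)"
          unfolding mat_mult_def b by (intro sum.cong) (auto simp: f_def g_def Ts(1) e_eq)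
        also have "\<dots> = (\<Sum>x\<in>E. if x = (k, i, j) then G k i j else 0)"
          using sum.reindex_bij_betw[OF e, of "\<lambda>x. if x = (k, i, j) then G k i j else 0"] by simp
        also have "\<dots> = G k i j" using finE by (auto simp: E_def)
        finally show "mat_mult (length (pts Z)) (g (k + b)) f i j = G k i j" .
      qed
      moreover have "G k \<in> matrices valid ?P (shift k ?Q)" using G(1) by (simp add: families_def)
      ultimately show "family_comp ?P (pts Z) ?Q g (single (- b) f) k = G k"
        unfolding family_comp_single by (simp add: trunc_valid)
    qed
    have "\<phi> = Comp C_cat A Z B (C_family (pts Z) ?Q g) (C_family ?P (pts Z) (single (- b) f))"
      unfolding C_comp[OF Gm F] comp G(2) ..
    moreover have "C_family (pts Z) ?Q g \<in> carrier (Hom C_cat Z B)" "C_family ?P (pts Z) (single (- b) f) \<in> carrier (Hom C_cat A Z)"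
      using Gm F by (simp_all add: C_hom_carrier)
    ultimately show "\<phi> \<in> ?L" using Z unfolding factor_ideal_def by blast
  qed
qed

section \<open>Kernels and cokernels in the quotient\<close>

definition fibre :: "(point \<times> bool) list set \<Rightarrow> (point \<times> bool) list set \<Rightarrow> 'k::field matrix \<Rightarrow>
    (int \<Rightarrow> 'k matrix set) set" where
  "fibre A B N = {\<phi> \<in> carrier (Hom C_cat A B). live_matrix A B \<phi> = N}"

text \<open>
  With the ideal of \<open>\<T>\<close> identified, a morphism of \<open>\<C> / \<T>\<close> is the set of all morphisms of \<open>\<C>\<close> with given surviving
  entries. So \<open>fibre\<close> is a full and faithful correspondence with matrices at linked pairs.
\<close>

lemma C_mod_T_hom:
  fixes \<phi> :: "int \<Rightarrow> 'k::field matrix set"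
  shows C_mod_T_carrier: "carrier (Hom (C_mod_T :: 'k::field cluster_quotient) A B) = fibre A B ` matrices linked (pts A) (pts B)"
    and C_mod_T_zero: "\<zero>\<^bsub>Hom (C_mod_T :: 'k::field cluster_quotient) A B\<^esub> = fibre A B (\<lambda>i j. 0)"
    and C_coset: "\<phi> \<in> carrier (Hom C_cat A B) \<Longrightarrow>
      factor_ideal C_cat (add_closure (C_cat :: 'k cluster_category) standard_cluster) A B +>\<^bsub>Hom C_cat A B\<^esub> \<phi> =
      fibre A B (live_matrix A B \<phi>)"
proof -
  note F = fibre_quotient[where \<Phi> = "live_matrix A B", OF C_hom_group live_matrix_add C_ideal, folded fibre_def]
  show "carrier (Hom (C_mod_T :: 'k cluster_quotient) A B) = fibre A B ` matrices linked (pts A) (pts B)"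
    unfolding live_matrix_image[symmetric] using F(2) by (simp add: C_mod_T_def quot_cat_def)
  show "\<zero>\<^bsub>Hom (C_mod_T :: 'k cluster_quotient) A B\<^esub> = fibre A B (\<lambda>i j. 0)"
    using F(3) by (simp add: C_mod_T_def quot_cat_def zero_fun_def)
  show "\<phi> \<in> carrier (Hom C_cat A B) \<Longrightarrow>
      factor_ideal C_cat (add_closure (C_cat :: 'k cluster_category) standard_cluster) A B +>\<^bsub>Hom C_cat A B\<^esub> \<phi> =
      fibre A B (live_matrix A B \<phi>)"
    by (rule F(1))
qed

lemma fibre_nonempty: "N \<in> matrices linked (pts A) (pts B) \<Longrightarrow> fibre A B N \<noteq> {}"
  unfolding live_matrix_image[symmetric] fibre_def by blast

lemma fibre_inject: "N \<in> matrices linked (pts A) (pts B) \<Longrightarrow> fibre A B N = fibre A B M \<longleftrightarrow> N = M"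
  using fibre_nonempty[of N A B] unfolding fibre_def by blast

lemma C_mod_T_comp:
  assumes N: "N \<in> matrices linked (pts B) (pts D)" and M: "M \<in> matrices linked (pts A) (pts B)"
  shows "Comp (C_mod_T :: 'k::field cluster_quotient) A B D (fibre B D N) (fibre A B M) =
    fibre A D (live_mult (pts A) (pts B) (pts D) N M)"
proof -
  have "Comp (C_mod_T :: 'k cluster_quotient) A B D (fibre B D N) (fibre A B M) =
      (\<Union>g\<in>fibre B D N. \<Union>f\<in>fibre A B M.
        factor_ideal C_cat (add_closure (C_cat :: 'k cluster_category) standard_cluster) A D +>\<^bsub>Hom C_cat A D\<^esub> Comp C_cat A B D g f)"
    by (simp add: C_mod_T_def quot_cat_def)
  also have "\<dots> = (\<Union>g\<in>fibre B D N. \<Union>f\<in>fibre A B M. fibre A D (live_mult (pts A) (pts B) (pts D) N M))"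
  proof (intro SUP_cong refl)
    fix g f assume "g \<in> fibre B D N" "f \<in> fibre A B M"
    then have gf: "g \<in> carrier (Hom C_cat B D)" "f \<in> carrier (Hom C_cat A B)" "live_matrix B D g = N" "live_matrix A B f = M"
      by (auto simp: fibre_def)
    show "factor_ideal C_cat (add_closure (C_cat :: 'k cluster_category) standard_cluster) A D +>\<^bsub>Hom C_cat A D\<^esub> Comp C_cat A B D g f =
        fibre A D (live_mult (pts A) (pts B) (pts D) N M)"
      unfolding C_coset[OF live_matrix_comp(1)[OF gf(1,2)]] live_matrix_comp(2)[OF gf(1,2)] gf(3,4) ..
  qed
  also have "\<dots> = fibre A D (live_mult (pts A) (pts B) (pts D) N M)"
    using fibre_nonempty[OF N] fibre_nonempty[OF M] by blast
  finally show ?thesis .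
qed

lemma C_mod_T_Obj: "Obj (C_mod_T :: 'k::field cluster_quotient) = Obj (C_cat :: 'k cluster_category)"
  by (simp add: C_mod_T_def quot_cat_def)

lemma mat_shift: "matrices linked (shift b P) Q = matrices linked P Q" "matrices linked P (shift b Q) = matrices linked P Q"
proof -
  have "i < length Q \<and> j < length P \<and> linked (shift b P ! j) (Q ! i) \<longleftrightarrow>
      i < length Q \<and> j < length P \<and> linked (P ! j) (Q ! i)" for i j
    by (cases "j < length P") simp_all
  then show "matrices linked (shift b P) Q = matrices linked P Q" unfolding matrices_def length_map by (simp only:)
  have "i < length Q \<and> j < length P \<and> linked (P ! j) (shift b Q ! i) \<longleftrightarrow>
      i < length Q \<and> j < length P \<and> linked (P ! j) (Q ! i)" for i j
    by (cases "i < length Q") simp_all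
  then show "matrices linked P (shift b Q) = matrices linked P Q" unfolding matrices_def length_map by (simp only:)
qed

lemma live_mult_shift:
  "M \<in> matrices linked P Q \<Longrightarrow> live_mult (shift b P) Q R N M = live_mult P Q R N M"
  "live_mult P (shift b Q) R N M = live_mult P Q R N M"
  "N \<in> matrices linked Q R \<Longrightarrow> live_mult P Q (shift b R) N M = live_mult P Q R N M"
proof -
  show "live_mult P (shift b Q) R N M = live_mult P Q R N M"
    by (intro ext) (simp add: live_mult_def)
  show "live_mult (shift b P) Q R N M = live_mult P Q R N M" if M: "M \<in> matrices linked P Q"
  proof (intro ext)
    fix i j
    show "live_mult (shift b P) Q R N M i j = live_mult P Q R N M i j"
    proof (cases "j < length P")
      case True
      then show ?thesis by (simp add: live_mult_def)
    next
      case False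
      then have "M s j = 0" for s using M unfolding matrices_def by blast
      then show ?thesis by (auto simp: live_mult_def intro!: sum.cong)
    qed
  qed
  show "live_mult P Q (shift b R) N M = live_mult P Q R N M" if N: "N \<in> matrices linked Q R"
  proof (intro ext)
    fix i j
    show "live_mult P Q (shift b R) N M i j = live_mult P Q R N M i j"
    proof (cases "i < length R")
      case True
      then show ?thesis by (simp add: live_mult_def)
    next
      case False
      then have "N i s = 0" for s using N unfolding matrices_def by blast
      then show ?thesis by (auto simp: live_mult_def intro!: sum.cong)
    qed
  qed
qed

text \<open>
  The representative of an orbit is some common shift of the given points, so kernels that
  are computed for the points have to be transported along a shift.
\<close>

lemma object_with_points:
  assumes "\<forall>z\<in>set Zs. live z z"
  shows "\<exists>Z\<in>Obj (C_mod_T :: 'k::field cluster_quotient). \<exists>b. pts Z = shift b Zs"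
proof -
  let ?X = "map (\<lambda>z. (z, False)) Zs"
  have "map fst ?X = Zs" by (simp add: comp_def)
  then have "orbit_of (map F_ind) ?X \<in> Obj (C_mod_T :: 'k cluster_quotient)"
    unfolding C_mod_T_Obj using assms live_strip by (intro orbit_Obj) auto
  then show ?thesis using pts_orbit[of ?X] \<open>map fst ?X = Zs\<close> by metis
qed

lemma C_mod_T_kernel:
  assumes F: "F \<in> matrices linked (pts X) (pts Y)"
  shows "\<exists>Z k. is_kernel (C_mod_T :: 'k::field cluster_quotient) X Y (fibre X Y F) Z k"
proof -
  from matrix_kernel[OF F] obtain Zs k where
    Zs: "\<forall>z\<in>set Zs. live z z" and k: "k \<in> matrices linked Zs (pts X)"
    and fk: "live_mult Zs (pts X) (pts Y) F k = (\<lambda>i j. 0)"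
    and univ: "\<forall>Ws. \<forall>g\<in>matrices linked Ws (pts X). live_mult Ws (pts X) (pts Y) F g = (\<lambda>i j. 0) \<longrightarrow>
        (\<exists>!u. u \<in> matrices linked Ws Zs \<and> live_mult Ws Zs (pts X) k u = g)"
    by (elim exE conjE)
  obtain Z b where Z: "Z \<in> Obj (C_mod_T :: 'k cluster_quotient)" "pts Z = shift b Zs"
    using object_with_points[OF Zs] by blast
  have kZ: "k \<in> matrices linked (pts Z) (pts X)" using k by (simp add: Z(2) mat_shift)
  have "is_kernel (C_mod_T :: 'k cluster_quotient) X Y (fibre X Y F) Z (fibre Z X k)"
    unfolding is_kernel_def
  proof (intro conjI ballI impI)
    show "Z \<in> Obj (C_mod_T :: 'k cluster_quotient)" by (rule Z)
    show "fibre Z X k \<in> carrier (Hom C_mod_T Z X)" unfolding C_mod_T_carrier using kZ by blast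
    show "Comp C_mod_T Z X Y (fibre X Y F) (fibre Z X k) = \<zero>\<^bsub>Hom C_mod_T Z Y\<^esub>"
      unfolding C_mod_T_comp[OF F kZ] C_mod_T_zero Z(2) live_mult_shift(1)[OF k] fk ..
    fix W g assume g: "g \<in> carrier (Hom (C_mod_T :: 'k cluster_quotient) W X)"
      and zero: "Comp C_mod_T W X Y (fibre X Y F) g = \<zero>\<^bsub>Hom C_mod_T W Y\<^esub>"
    obtain N where N: "N \<in> matrices linked (pts W) (pts X)" "g = fibre W X N"
      using g unfolding C_mod_T_carrier by blast
    have "live_mult (pts W) (pts X) (pts Y) F N = (\<lambda>i j. 0)"
      using zero unfolding N(2) C_mod_T_comp[OF F N(1)] C_mod_T_zero fibre_inject[OF live_mult_mat[OF F N(1)]] .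
    then have "\<exists>!u. u \<in> matrices linked (pts W) Zs \<and> live_mult (pts W) Zs (pts X) k u = N"
      using univ N(1) by blast
    then obtain u where u: "u \<in> matrices linked (pts W) Zs" "live_mult (pts W) Zs (pts X) k u = N"
      and uniq: "\<And>v. v \<in> matrices linked (pts W) Zs \<Longrightarrow> live_mult (pts W) Zs (pts X) k v = N \<Longrightarrow> v = u"
      by blast
    have mW: "matrices linked (pts W) (pts Z) = (matrices linked (pts W) Zs :: 'k matrix set)" by (simp add: Z(2) mat_shift)
    have comp: "Comp C_mod_T W Z X (fibre Z X k) (fibre W Z v) = fibre W X (live_mult (pts W) Zs (pts X) k v)"
      if "v \<in> matrices linked (pts W) Zs" for v
      using C_mod_T_comp[OF kZ, of v W] that unfolding mW by (simp add: Z(2) live_mult_shift)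
    show "\<exists>!u. u \<in> carrier (Hom C_mod_T W Z) \<and> Comp C_mod_T W Z X (fibre Z X k) u = g"
    proof (rule ex1I[of _ "fibre W Z u"], intro conjI)
      show "fibre W Z u \<in> carrier (Hom C_mod_T W Z)" unfolding C_mod_T_carrier mW using u(1) by blast
      show "Comp C_mod_T W Z X (fibre Z X k) (fibre W Z u) = g" unfolding comp[OF u(1)] u(2) N(2) ..
      fix v assume v: "v \<in> carrier (Hom C_mod_T W Z) \<and> Comp C_mod_T W Z X (fibre Z X k) v = g"
      then obtain V where V: "V \<in> matrices linked (pts W) Zs" "v = fibre W Z V"
        unfolding C_mod_T_carrier mW by blast
      have "fibre W X N = fibre W X (live_mult (pts W) Zs (pts X) k V)"
        using v unfolding V(2) comp[OF V(1)] N(2) by simp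
      then have "N = live_mult (pts W) Zs (pts X) k V" unfolding fibre_inject[OF N(1)] .
      then show "v = fibre W Z u" using uniq[OF V(1)] V(2) by simp
    qed
  qed
  then show ?thesis by blast
qed

lemma C_mod_T_cokernel:
  assumes F: "F \<in> matrices linked (pts X) (pts Y)"
  shows "\<exists>Z c. is_cokernel (C_mod_T :: 'k::field cluster_quotient) X Y (fibre X Y F) Z c"
proof -
  from matrix_cokernel[OF F] obtain Zs c where
    Zs: "\<forall>z\<in>set Zs. live z z" and c: "c \<in> matrices linked (pts Y) Zs"
    and cf: "live_mult (pts X) (pts Y) Zs c F = (\<lambda>i j. 0)"
    and univ: "\<forall>Ws. \<forall>g\<in>matrices linked (pts Y) Ws. live_mult (pts X) (pts Y) Ws g F = (\<lambda>i j. 0) \<longrightarrow>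
        (\<exists>!u. u \<in> matrices linked Zs Ws \<and> live_mult (pts Y) Zs Ws u c = g)"
    by (elim exE conjE)
  obtain Z b where Z: "Z \<in> Obj (C_mod_T :: 'k cluster_quotient)" "pts Z = shift b Zs"
    using object_with_points[OF Zs] by blast
  have cZ: "c \<in> matrices linked (pts Y) (pts Z)" using c by (simp add: Z(2) mat_shift)
  have "is_cokernel (C_mod_T :: 'k cluster_quotient) X Y (fibre X Y F) Z (fibre Y Z c)"
    unfolding is_cokernel_def
  proof (intro conjI ballI impI)
    show "Z \<in> Obj (C_mod_T :: 'k cluster_quotient)" by (rule Z)
    show "fibre Y Z c \<in> carrier (Hom C_mod_T Y Z)" unfolding C_mod_T_carrier using cZ by blast
    show "Comp C_mod_T X Y Z (fibre Y Z c) (fibre X Y F) = \<zero>\<^bsub>Hom C_mod_T X Z\<^esub>"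
      unfolding C_mod_T_comp[OF cZ F] C_mod_T_zero Z(2) live_mult_shift(3)[OF c] cf ..
    fix W g assume g: "g \<in> carrier (Hom (C_mod_T :: 'k cluster_quotient) Y W)"
      and zero: "Comp C_mod_T X Y W g (fibre X Y F) = \<zero>\<^bsub>Hom C_mod_T X W\<^esub>"
    obtain N where N: "N \<in> matrices linked (pts Y) (pts W)" "g = fibre Y W N"
      using g unfolding C_mod_T_carrier by blast
    have "live_mult (pts X) (pts Y) (pts W) N F = (\<lambda>i j. 0)"
      using zero unfolding N(2) C_mod_T_comp[OF N(1) F] C_mod_T_zero fibre_inject[OF live_mult_mat[OF N(1) F]] .
    then have "\<exists>!u. u \<in> matrices linked Zs (pts W) \<and> live_mult (pts Y) Zs (pts W) u c = N"
      using univ N(1) by blast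
    then obtain u where u: "u \<in> matrices linked Zs (pts W)" "live_mult (pts Y) Zs (pts W) u c = N"
      and uniq: "\<And>v. v \<in> matrices linked Zs (pts W) \<Longrightarrow> live_mult (pts Y) Zs (pts W) v c = N \<Longrightarrow> v = u"
      by blast
    have mW: "matrices linked (pts Z) (pts W) = (matrices linked Zs (pts W) :: 'k matrix set)" by (simp add: Z(2) mat_shift)
    have comp: "Comp C_mod_T Y Z W (fibre Z W v) (fibre Y Z c) = fibre Y W (live_mult (pts Y) Zs (pts W) v c)"
      if "v \<in> matrices linked Zs (pts W)" for v
      using C_mod_T_comp[OF _ cZ, of v W] that unfolding mW by (simp add: Z(2) live_mult_shift)
    show "\<exists>!u. u \<in> carrier (Hom C_mod_T Z W) \<and> Comp C_mod_T Y Z W u (fibre Y Z c) = g"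
    proof (rule ex1I[of _ "fibre Z W u"], intro conjI)
      show "fibre Z W u \<in> carrier (Hom C_mod_T Z W)" unfolding C_mod_T_carrier mW using u(1) by blast
      show "Comp C_mod_T Y Z W (fibre Z W u) (fibre Y Z c) = g" unfolding comp[OF u(1)] u(2) N(2) ..
      fix v assume v: "v \<in> carrier (Hom C_mod_T Z W) \<and> Comp C_mod_T Y Z W v (fibre Y Z c) = g"
      then obtain V where V: "V \<in> matrices linked Zs (pts W)" "v = fibre Z W V"
        unfolding C_mod_T_carrier mW by blast
      have "fibre Y W N = fibre Y W (live_mult (pts Y) Zs (pts W) V c)"
        using v unfolding V(2) comp[OF V(1)] N(2) by simp
      then have "N = live_mult (pts Y) Zs (pts W) V c" unfolding fibre_inject[OF N(1)] .
      then show "v = fibre Z W u" using uniq[OF V(1)] V(2) by simp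
    qed
  qed
  then show ?thesis by blast
qed

theorem proposition2p5p1:
  fixes f :: "(int \<Rightarrow> 'k::field matrix set) set"
  assumes "X \<in> Obj (C_mod_T :: 'k cluster_quotient)"
    and "Y \<in> Obj (C_mod_T :: 'k cluster_quotient)"
    and "f \<in> carrier (Hom (C_mod_T :: 'k cluster_quotient) X Y)"
  shows "(\<exists>Z k. is_kernel (C_mod_T :: 'k cluster_quotient) X Y f Z k) \<and>
         (\<exists>Z c. is_cokernel (C_mod_T :: 'k cluster_quotient) X Y f Z c)"
proof -
  obtain F where "F \<in> matrices linked (pts X) (pts Y)" "f = fibre X Y F"
    using assms(3) unfolding C_mod_T_carrier by blast
  then show ?thesis using C_mod_T_kernel C_mod_T_cokernel by blast
qed

end
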